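(* Let $G$ be a locally compact group and let $\kappa(G)$ be the smallest cardinality of a covering of $G$ by compact subsets. If $\kappa(G)>\aleph_0$, then $\mathrm{LIM}_0(G)=\mathrm{LIM}(G)$.
   Context: All groups are Hausdorff; $|E|$ is the left Haar measure of $E\subset G$. $L_\infty(G)$ is the algebra of bounded locally measurable functions modulo equality off locally null sets, the dual of $L_1(G)$. $M(G)$ is the set of means on $L_\infty(G)$: linear functionals $\mu$ with $\|\mu\|=1$, $\mu\ge0$; write $\mu(E)=\mu(\mathbb 1_E)$. With $l_x\phi(y)=\phi(x^{-1}y)$, $\mathrm{LIM}(G)$ is the set of $\mu\in M(G)$ with $\mu(l_x\phi)=\mu(\phi)$ for all $x\in G$, $\phi\in L_\infty(G)$. For a finite measurable partition $\mathcal P$ of $G$ and $\epsilon\in(0,1)$, $\mathcal N(\mu,\mathcal P,\epsilon)=\{\nu\in M(G):|\mu(E)-\nu(E)|<\epsilon\ \text{for all }E\in\mathcal P\}$. For compact $A\subset G$ with $|A|>0$, $\mu_A=\mathbb 1_A/|A|$, regarded as a mean on $L_\infty(G)$. For finite $K\subset G$ and $\epsilon\in(0,1)$, $\mathscr C^+(K,\epsilon)$ is the set of compact $A\subset G$ with $|A|>0$ and $|xA\,\triangle\,A|/|A|<\epsilon$ for each $x\in K$. Then $\mathrm{LIM}_0(G)$ is the set of $\mu\in\mathrm{LIM}(G)$ such that for all finite measurable partitions $\mathcal P$ of $G$, finite sets $K\subset G$ and $\epsilon\in(0,1)$ there exists $A\in\mathscr C^+(K,\epsilon)$ with $\mu_A\in\mathcal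 N(\mu,\mathcal P,\epsilon)$ (i.e. $\mu$ is a limit point of a Følner net). *)

theory Defs
  imports "HOL-Analysis.Analysis" "HOL-Library.Disjoint_Sets"
begin

unbundle cardinal_syntax

text \<open>
  A Hausdorff topological group is a type of class \<open>{topological_group_add, t2_space}\<close>.
  The group operation is written additively but is \<^emph>\<open>not\<close> assumed to be commutative:
  the product \<open>x y\<close> is \<open>x + y\<close>, the inverse is \<open>- x\<close>, and the left
  translate \<open>x A\<close> is \<open>(+) x ` A\<close>.
\<close>

subsection \<open>Left Haar measure\<close>

text \<open>
  A nonzero left invariant Radon measure on the Borel sets. Outer regularity is required of all
  Borel sets, inner regularity of open sets only: outside the \<open>\<sigma>\<close>-compact case
  one cannot ask for more.
\<close>

definition left_haar_measure :: "'a::{topological_group_add, t2_space} measure \<Rightarrow> bool" where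
  "left_haar_measure m \<longleftrightarrow>
     sets m = sets borel \<and>
     emeasure m UNIV \<noteq> 0 \<and>
     (\<forall>K. compact K \<longrightarrow> emeasure m K < \<infinity>) \<and>
     (\<forall>E\<in>sets borel. emeasure m E = (INF U\<in>{U. open U \<and> E \<subseteq> U}. emeasure m U)) \<and>
     (\<forall>U. open U \<longrightarrow> emeasure m U = (SUP K\<in>{K. compact K \<and> K \<subseteq> U}. emeasure m K)) \<and>
     (\<forall>x. \<forall>E\<in>sets borel. emeasure m ((+) x ` E) = emeasure m E)"

subsection \<open>The space of essentially bounded functions\<close>

text \<open>The Borel measure is completed, so these are the Haar measurable sets, localised.\<close>

definition locally_measurable_set :: "'a::topological_space measure \<Rightarrow> 'a set \<Rightarrow> bool" where
  "locally_measurable_set m E \<longleftrightarrow> (\<forall>K. compact K \<longrightarrow> E \<inter> K \<in> sets (completion m))"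

definition locally_null_set :: "'a::topological_space measure \<Rightarrow> 'a set \<Rightarrow> bool" where
  "locally_null_set m E \<longleftrightarrow> (\<forall>K. compact K \<longrightarrow> E \<inter> K \<in> null_sets (completion m))"

definition locally_measurable_fun ::
  "'a::topological_space measure \<Rightarrow> ('a \<Rightarrow> real) \<Rightarrow> bool" where
  "locally_measurable_fun m \<phi> \<longleftrightarrow> (\<forall>B\<in>sets borel. locally_measurable_set m (\<phi> -` B))"

text \<open>
  \<open>Linf m\<close> consists of the representatives; the quotient by equality off locally null
  sets is taken by requiring functionals to respect it (see \<open>Linf_functional\<close>).
\<close>

definition Linf :: "'a::topological_space measure \<Rightarrow> ('a \<Rightarrow> real) set" where
  "Linf m = {\<phi>. bounded (range \<phi>) \<and> locally_measurable_fun m \<phi>}"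

definition Linf_norm :: "'a::topological_space measure \<Rightarrow> ('a \<Rightarrow> real) \<Rightarrow> real" where
  "Linf_norm m \<phi> = Inf {c. 0 \<le> c \<and> locally_null_set m {x. c < \<bar>\<phi> x\<bar>}}"

text \<open>
  Linear functionals on the quotient space; extensionality fixes the (irrelevant) values
  outside \<open>Linf m\<close>, so that equality of functionals is HOL equality.
\<close>

definition Linf_functional ::
  "'a::topological_space measure \<Rightarrow> (('a \<Rightarrow> real) \<Rightarrow> real) \<Rightarrow> bool" where
  "Linf_functional m \<mu> \<longleftrightarrow>
     \<mu> \<in> extensional (Linf m) \<and>
     (\<forall>\<phi>\<in>Linf m. \<forall>\<psi>\<in>Linf m. locally_null_set m {x. \<phi> x \<noteq> \<psi> x} \<longrightarrow> \<mu> \<phi> = \<mu> \<psi>) \<and>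
     (\<forall>\<phi>\<in>Linf m. \<forall>\<psi>\<in>Linf m. \<mu> (\<lambda>x. \<phi> x + \<psi> x) = \<mu> \<phi> + \<mu> \<psi>) \<and>
     (\<forall>\<phi>\<in>Linf m. \<forall>c. \<mu> (\<lambda>x. c * \<phi> x) = c * \<mu> \<phi>)"

definition functional_norm ::
  "'a::topological_space measure \<Rightarrow> (('a \<Rightarrow> real) \<Rightarrow> real) \<Rightarrow> ereal" where
  "functional_norm m \<mu> = (SUP \<phi>\<in>{\<phi>\<in>Linf m. Linf_norm m \<phi> \<le> 1}. ereal \<bar>\<mu> \<phi>\<bar>)"

subsection \<open>Means\<close>

definition means :: "'a::topological_space measure \<Rightarrow> (('a \<Rightarrow> real) \<Rightarrow> real) set" where
  "means m = {\<mu>. Linf_functional m \<mu> \<and> functional_norm m \<mu> = 1 \<and>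
     (\<forall>\<phi>\<in>Linf m. locally_null_set m {x. \<phi> x < 0} \<longrightarrow> 0 \<le> \<mu> \<phi>)}"

definition ltrans :: "'a::group_add \<Rightarrow> ('a \<Rightarrow> real) \<Rightarrow> 'a \<Rightarrow> real" where
  "ltrans x \<phi> = (\<lambda>y. \<phi> (- x + y))"

definition LIMeans :: "'a::topological_group_add measure \<Rightarrow> (('a \<Rightarrow> real) \<Rightarrow> real) set" where
  "LIMeans m = {\<mu>\<in>means m. \<forall>x. \<forall>\<phi>\<in>Linf m. \<mu> (ltrans x \<phi>) = \<mu> \<phi>}"

definition measurable_partition :: "'a::topological_space measure \<Rightarrow> 'a set set \<Rightarrow> bool" where
  "measurable_partition m P \<longleftrightarrow> partition_on UNIV P \<and> (\<forall>E\<in>P. locally_measurable_set m E)"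

definition mean_nhd :: "'a::topological_space measure \<Rightarrow>
    (('a \<Rightarrow> real) \<Rightarrow> real) \<Rightarrow> 'a set set \<Rightarrow> real \<Rightarrow> (('a \<Rightarrow> real) \<Rightarrow> real) set" where
  "mean_nhd m \<mu> P \<epsilon> =
     {\<nu>\<in>means m. \<forall>E\<in>P. \<bar>\<mu> (indicator E) - \<nu> (indicator E)\<bar> < \<epsilon>}"

definition set_mean :: "'a::topological_space measure \<Rightarrow> 'a set \<Rightarrow> ('a \<Rightarrow> real) \<Rightarrow> real" where
  "set_mean m A = (\<lambda>\<phi>\<in>Linf m. (LINT y:A|completion m. \<phi> y) / measure m A)"

definition folner_sets ::
  "'a::topological_group_add measure \<Rightarrow> 'a set \<Rightarrow> real \<Rightarrow> 'a set set" where
  "folner_sets m K \<epsilon> = {A. compact A \<and> 0 < emeasure m A \<and>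
     (\<forall>x\<in>K. measure m (sym_diff ((+) x ` A) A) / measure m A < \<epsilon>)}"

definition LIMeans\<^sub>0 :: "'a::topological_group_add measure \<Rightarrow> (('a \<Rightarrow> real) \<Rightarrow> real) set" where
  "LIMeans\<^sub>0 m = {\<mu>\<in>LIMeans m. \<forall>P K \<epsilon>.
     finite P \<and> measurable_partition m P \<and> finite K \<and> 0 < \<epsilon> \<and> \<epsilon> < 1 \<longrightarrow>
       (\<exists>A\<in>folner_sets m K \<epsilon>. set_mean m A \<in> mean_nhd m \<mu> P \<epsilon>)}"

subsection \<open>The compact covering number\<close>

definition compact_covers :: "'a::topological_space set set set" where
  "compact_covers = {C. (\<forall>K\<in>C. compact K) \<and> \<Union>C = UNIV}"

text \<open>The space is determined by the type: \<open>\<kappa> :: 'a set rel\<close> is the covering number of \<open>'a\<close>.\<close>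

definition \<kappa> :: "'a::topological_space set rel" where
  "\<kappa> = card_of (SOME C :: 'a set set. C \<in> compact_covers \<and>
     (\<forall>D\<in>(compact_covers :: 'a set set set). |C| \<le>o |D| ))"

lemma \<kappa>_attained:
  "\<exists>C\<in>compact_covers. (\<kappa> :: 'a::topological_space set rel) = |C| \<and>
     (\<forall>D\<in>(compact_covers :: 'a set set set). |C| \<le>o |D| )"
proof -
  let ?R = "card_of ` (compact_covers :: 'a set set set)"
  let ?P = "\<lambda>C::'a set set. C \<in> compact_covers \<and>
    (\<forall>D\<in>(compact_covers :: 'a set set set). |C| \<le>o |D| )"
  have "(\<lambda>x. {x}) ` UNIV \<in> (compact_covers :: 'a set set set)"
    unfolding compact_covers_def by simp
  hence "?R \<noteq> {}" by blast
  moreover have "\<forall>r\<in>?R. Card_order r"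
    by (simp add: card_of_Card_order)
  ultimately have "\<exists>r\<in>?R. \<forall>r'\<in>?R. r \<le>o r'"
    by (rule exists_minim_Card_order)
  then obtain C where "?P C"
    unfolding bex_simps ball_simps by (elim bexE) (rule that, rule conjI)
  hence "?P (SOME C. ?P C)"
    by (rule someI)
  thus ?thesis
    unfolding \<kappa>_def by (intro bexI[of _ "SOME C. ?P C"] conjI refl) (elim conjE, assumption)+
qed

end

theory Submission
  imports Defs "HOL-Library.Function_Algebras"
begin

text \<open>
  An invariant mean \<open>\<mu>\<close> is a weak limit of densities, and Namioka's argument makes these almost invariant in
  norm: by Hahn-Banach and the duality of \<open>L\<^sub>1\<close> and \<open>L\<^sub>\<infinity>\<close> there are densities that are almost invariant under
  the given finite set and have almost the integrals \<open>\<mu> E\<close> over the members \<open>E\<close> of the partition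
  (\<open>almost_invariant_density\<close>). Slicing such a density into level sets exhibits the vector of the \<open>\<mu> E\<close>
  approximately as a convex combination of vectors \<open>\<mu>\<^sub>A E\<close>, for almost invariant compact sets \<open>A\<close>
  (\<open>mean_convex_combination\<close>). What remains is to replace the combination by a single set.

  Every sigma-compact set lies in an open sigma-compact subgroup, which has infinitely many disjoint
  translates because the group is not sigma-compact, so \<open>\<mu>\<close> vanishes on it (\<open>invariant_mean_subgroup\<close>). Hence all the sets \<open>A\<close> can be found off any
  given sigma-compact set. Up to rounding only countably many combinations of a vector \<open>(\<mu>\<^sub>A E)\<close> and a
  bound on the size of \<open>A\<close> and its inverse occur. For each type that does not occur arbitrarily far out there is
  a sigma-compact set meeting all sets of this type. Taking the convex combination off the union of these
  countably many obstructions, all its members are of types that occur off every sigma-compact set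
  (\<open>ex_recurrent_blocks\<close>). So arbitrarily many disjoint sets of each of the finitely many types used are
  available, and their measures are bounded above and away from \<open>0\<close>. A disjoint union in which the types
  occupy measures proportional to the coefficients, up to a relatively small error, is the set that was sought
  (\<open>combine_blocks\<close>, \<open>ex_single_set\<close>).

  Since \<open>m\<close> need not be sigma-finite, the density of a functional on \<open>L\<^sub>1\<close> is glued from densities on pieces of
  the cosets of an open sigma-compact subgroup (\<open>bounded_set_function_density\<close>).
\<close>

section \<open>A Hahn-Banach theorem\<close>

text \<open>
  The form of Hahn-Banach known as the Mazur-Orlicz theorem. A linear functional below \<open>p\<close> is a
  half-space of \<open>W \<times> \<real>\<close> lying above a graph. The points \<open>(w, t)\<close> with \<open>p (w + c) - s \<le> t\<close> for some
  \<open>(c, s) \<in> C\<close> form a convex cone that must lie above that graph. By Zorn's lemma the cone is contained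
  in a convex cone that is maximal among those missing \<open>(0, -1)\<close>, and maximality forces it to be a
  half-space. The space is a subspace of an ambient vector space because \<open>p\<close> will be an \<open>L\<^sub>1\<close> norm, which
  makes sense for integrable functions only.
\<close>

lemma mazur_orlicz:
  fixes p :: "'v::real_vector \<Rightarrow> real" and C :: "('v \<times> real) set"
  assumes W: "subspace W"
    and p_add: "\<And>u v. u \<in> W \<Longrightarrow> v \<in> W \<Longrightarrow> p (u + v) \<le> p u + p v"
    and p_scale: "\<And>c v. v \<in> W \<Longrightarrow> 0 \<le> c \<Longrightarrow> p (c *\<^sub>R v) = c * p v"
    and CW: "\<And>c s. (c, s) \<in> C \<Longrightarrow> c \<in> W"
    and C0: "(0, 0) \<in> C"
    and C_add: "\<And>u v. u \<in> C \<Longrightarrow> v \<in> C \<Longrightarrow> u + v \<in> C"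
    and C_scale: "\<And>r u. u \<in> C \<Longrightarrow> 0 \<le> r \<Longrightarrow> r *\<^sub>R u \<in> C"
    and Cp: "\<And>c s. (c, s) \<in> C \<Longrightarrow> s \<le> p c"
  shows "\<exists>L. (\<forall>u\<in>W. \<forall>v\<in>W. L (u + v) = L u + L v) \<and> (\<forall>c. \<forall>v\<in>W. L (c *\<^sub>R v) = c * L v) \<and>
     (\<forall>v\<in>W. L v \<le> p v) \<and> (\<forall>(c, s)\<in>C. s \<le> (L c :: real))"
proof -
  note Wadd = subspace_add[OF W] and Wsc = subspace_scale[OF W] and W0 = subspace_0[OF W]
  note Wneg = subspace_neg[OF W]
  have p0: "p 0 = 0" using p_scale[OF W0, of 0] by simp
  define K0 where "K0 = {(w, t). w \<in> W \<and> (\<exists>c s. (c, s) \<in> C \<and> p (w + c) - s \<le> t)}"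
  define cone where "cone K \<longleftrightarrow> (\<forall>u\<in>K. \<forall>v\<in>K. u + v \<in> K) \<and> (\<forall>r\<ge>0. \<forall>u\<in>K. r *\<^sub>R u \<in> K)"
    for K :: "('v \<times> real) set"
  define A where "A = {K. K0 \<subseteq> K \<and> K \<subseteq> W \<times> UNIV \<and> cone K \<and> (0, -1) \<notin> K}"
  have K0A: "K0 \<in> A"
  proof -
    have "u + v \<in> K0" if uK: "u \<in> K0" and vK: "v \<in> K0" for u v
    proof -
      obtain w1 t1 c1 s1 where 1: "u = (w1, t1)" "w1 \<in> W" "(c1, s1) \<in> C" "p (w1 + c1) - s1 \<le> t1"
        using uK unfolding K0_def by auto
      obtain w2 t2 c2 s2 where 2: "v = (w2, t2)" "w2 \<in> W" "(c2, s2) \<in> C" "p (w2 + c2) - s2 \<le> t2"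
        using vK unfolding K0_def by auto
      have "p ((w1 + c1) + (w2 + c2)) \<le> p (w1 + c1) + p (w2 + c2)"
        using 1 2 CW by (intro p_add Wadd) auto
      moreover have "(w1 + c1) + (w2 + c2) = (w1 + w2) + (c1 + c2)" by simp
      ultimately have "p ((w1 + w2) + (c1 + c2)) - (s1 + s2) \<le> t1 + t2"
        using 1 2 by simp
      moreover have "(c1 + c2, s1 + s2) \<in> C" using C_add[OF 1(3) 2(3)] by simp
      ultimately show ?thesis using 1 2 Wadd unfolding K0_def by auto
    qed
    moreover have "r *\<^sub>R u \<in> K0" if uK: "u \<in> K0" and r: "r \<ge> 0" for u r
    proof -
      obtain w1 t1 c1 s1 where 1: "u = (w1, t1)" "w1 \<in> W" "(c1, s1) \<in> C" "p (w1 + c1) - s1 \<le> t1"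
        using uK unfolding K0_def by auto
      have "p (r *\<^sub>R w1 + r *\<^sub>R c1) = r * p (w1 + c1)"
        using p_scale[OF Wadd[OF 1(2) CW[OF 1(3)]] r] by (simp add: scaleR_add_right)
      moreover have "r * (p (w1 + c1) - s1) \<le> r * t1" using 1(4) r by (rule mult_left_mono)
      ultimately have "p (r *\<^sub>R w1 + r *\<^sub>R c1) - r * s1 \<le> r * t1" by (simp add: right_diff_distrib)
      moreover have "(r *\<^sub>R c1, r * s1) \<in> C" using C_scale[OF 1(3) r] by simp
      ultimately show ?thesis using 1 Wsc unfolding K0_def by auto
    qed
    moreover have "(0, -1) \<notin> K0" unfolding K0_def using Cp by fastforce
    ultimately show ?thesis unfolding A_def cone_def by (auto simp: K0_def)
  qed
  have "\<exists>M\<in>A. \<forall>X\<in>A. M \<subseteq> X \<longrightarrow> X = M"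
  proof (rule subset_Zorn_nonempty)
    show "A \<noteq> {}" using K0A by blast
    fix \<C> assume ne: "\<C> \<noteq> {}" and ch: "subset.chain A \<C>"
    have sub: "\<C> \<subseteq> A" and lin: "\<And>X Y. X \<in> \<C> \<Longrightarrow> Y \<in> \<C> \<Longrightarrow> X \<subseteq> Y \<or> Y \<subseteq> X"
      using ch by (auto simp: subset_chain_def)
    have "u + v \<in> \<Union>\<C>" if uv: "u \<in> \<Union>\<C>" "v \<in> \<Union>\<C>" for u v
    proof -
      obtain X Y where XY: "X \<in> \<C>" "Y \<in> \<C>" "u \<in> X" "v \<in> Y" using uv by blast
      then obtain Z where "Z \<in> \<C>" "u \<in> Z" "v \<in> Z" using lin[OF XY(1,2)] by blast
      then show ?thesis using sub unfolding A_def cone_def by blast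
    qed
    moreover have "r *\<^sub>R u \<in> \<Union>\<C>" if "r \<ge> 0" "u \<in> \<Union>\<C>" for r u
      using that sub unfolding A_def cone_def by blast
    ultimately show "\<Union>\<C> \<in> A" using sub ne unfolding A_def cone_def by blast
  qed
  then obtain K where KA: "K \<in> A" and Kmax: "\<And>X. X \<in> A \<Longrightarrow> K \<subseteq> X \<Longrightarrow> X = K" by blast
  have K0K: "K0 \<subseteq> K" and KW: "K \<subseteq> W \<times> UNIV" and Km1: "(0, -1) \<notin> K"
    and Kadd: "\<And>u v. u \<in> K \<Longrightarrow> v \<in> K \<Longrightarrow> u + v \<in> K"
    and Ksc: "\<And>r u. r \<ge> 0 \<Longrightarrow> u \<in> K \<Longrightarrow> r *\<^sub>R u \<in> K"
    using KA unfolding A_def cone_def by auto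
  have pK: "(w, p w) \<in> K" if "w \<in> W" for w
    using that C0 K0K unfolding K0_def by force
  have up: "(w, t') \<in> K" if "(w, t) \<in> K" "t \<le> t'" for w t t'
  proof -
    have "(0, t' - t) \<in> K0" unfolding K0_def using C0 W0 p0 that(2)
      by (auto intro!: exI[of _ 0])
    then show ?thesis using Kadd[OF that(1), of "(0, t' - t)"] K0K by auto
  qed
  have neg: "0 \<le> t" if "(0, t) \<in> K" for t
  proof (rule ccontr)
    assume "\<not> 0 \<le> t"
    then have "(1 / (-t)) *\<^sub>R (0::'v, t) = (0, -1)" "1 / (-t) \<ge> 0" by auto
    then show False using Ksc[OF _ that, of "1 / (-t)"] Km1 by simp
  qed
  \<comment> \<open>Adjoining a missing point must produce the forbidden one; this makes the cone a half-space.\<close>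
  have tot: "(- w, - t) \<in> K" if w: "w \<in> W" and nK: "(w, t) \<notin> K" for w t
  proof -
    define X where "X = {k + l *\<^sub>R (w, t) | k l. k \<in> K \<and> 0 \<le> (l::real)}"
    have 0: "(0, 0) \<in> K" using pK[OF W0] p0 by simp
    have KX: "K \<subseteq> X"
    proof
      fix k assume "k \<in> K"
      then have "k = k + 0 *\<^sub>R (w, t)" "k \<in> K" by (auto simp: zero_prod_def)
      then show "k \<in> X" unfolding X_def by blast
    qed
    have "(w, t) \<in> X"
    proof -
      have "(w, t) = (0, 0) + 1 *\<^sub>R (w, t)" by simp
      then show ?thesis unfolding X_def using 0 zero_le_one by blast
    qed
    then have "X \<noteq> K" using nK by blast
    then have "X \<notin> A" using Kmax KX by blast
    moreover have "cone X"
    proof -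
      have "u + v \<in> X" if uv: "u \<in> X" "v \<in> X" for u v
      proof -
        obtain k l k' l' where "u = k + l *\<^sub>R (w, t)" "v = k' + l' *\<^sub>R (w, t)"
          "k \<in> K" "k' \<in> K" "0 \<le> l" "0 \<le> l'" using uv unfolding X_def by blast
        moreover from this have "u + v = (k + k') + (l + l') *\<^sub>R (w, t)"
          by (simp add: scaleR_left_distrib del: scaleR_Pair)
        ultimately show ?thesis unfolding X_def using Kadd[of k k'] add_nonneg_nonneg[of l l'] by blast
      qed
      moreover have "r *\<^sub>R u \<in> X" if r: "r \<ge> 0" and u: "u \<in> X" for r u
      proof -
        obtain k l where "u = k + l *\<^sub>R (w, t)" "k \<in> K" "0 \<le> l" using u unfolding X_def by blast
        moreover from this have "r *\<^sub>R u = (r *\<^sub>R k) + (r * l) *\<^sub>R (w, t)"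
          by (simp add: scaleR_right_distrib del: scaleR_Pair)
        ultimately show ?thesis unfolding X_def using Ksc[OF r, of k] mult_nonneg_nonneg[OF r, of l] by blast
      qed
      ultimately show ?thesis unfolding cone_def by blast
    qed
    moreover have "X \<subseteq> W \<times> UNIV" unfolding X_def using KW w Wadd Wsc by auto
    ultimately have "(0, -1) \<in> X" using K0K KX unfolding A_def by blast
    then obtain k l where kl: "(0, -1) = k + l *\<^sub>R (w, t)" "k \<in> K" "0 \<le> l" unfolding X_def by blast
    have "l \<noteq> 0" using kl Km1 by (metis add.right_neutral scaleR_eq_0_iff)
    then have l: "l > 0" using kl by simp
    have "k = (0, -1) - l *\<^sub>R (w, t)" using kl(1) by (metis add_diff_cancel_right')
    then have "(1 / l) *\<^sub>R k = (- w, - t - 1 / l)" using l by (simp add: field_simps)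
    moreover have "(1 / l) *\<^sub>R k \<in> K" using Ksc[of "1 / l" k] l kl by simp
    ultimately have "(- w, - t - 1 / l) \<in> K" by simp
    then show ?thesis by (rule up) (use l in simp)
  qed
  define L where "L w = Inf {t. (w, t) \<in> K}" for w
  have lower: "- p (- w) \<le> t" if "(w, t) \<in> K" for w t
  proof -
    have "w \<in> W" using that KW by auto
    then have "(w, t) + (- w, p (- w)) \<in> K" using that pK[OF Wneg] Kadd by blast
    then show ?thesis using neg[of "t + p (- w)"] by simp
  qed
  have bdd: "bdd_below {t. (w, t) \<in> K}" for w using lower by (intro bdd_belowI[of _ "- p (- w)"]) auto
  have Lle: "L w \<le> t" if "(w, t) \<in> K" for w t
    unfolding L_def using that bdd by (intro cInf_lower) auto
  have Lge: "x \<le> L w" if "w \<in> W" "\<And>t. (w, t) \<in> K \<Longrightarrow> x \<le> t" for w x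
    unfolding L_def using that pK by (intro cInf_greatest) auto
  have L0: "L 0 = 0"
    using Lle[OF pK[OF W0]] Lge[OF W0 neg] p0 by simp
  have Lsub: "L (u + v) \<le> L u + L v" if "u \<in> W" "v \<in> W" for u v
  proof -
    have "L (u + v) - t \<le> L v" if t: "(u, t) \<in> K" for t
    proof (rule Lge[OF \<open>v \<in> W\<close>])
      fix s assume "(v, s) \<in> K"
      then have "(u + v, t + s) \<in> K" using Kadd[OF t] by fastforce
      then show "L (u + v) - t \<le> s" using Lle by fastforce
    qed
    then have "L (u + v) - L v \<le> L u" by (intro Lge[OF \<open>u \<in> W\<close>]) fastforce
    then show ?thesis by simp
  qed
  have Lneg: "L (- w) = - L w" if w: "w \<in> W" for w
  proof -
    have "0 \<le> L w + L (- w)" using Lsub[OF w Wneg[OF w]] L0 by simp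
    moreover have "L (- w) \<le> - L w"
    proof (rule field_le_epsilon)
      fix e :: real assume "e > 0"
      then have "(w, L w - e) \<notin> K" using Lle[of w "L w - e"] by auto
      from Lle[OF tot[OF w this]] show "L (- w) \<le> - L w + e" by simp
    qed
    ultimately show ?thesis by simp
  qed
  have Ladd: "L (u + v) = L u + L v" if "u \<in> W" "v \<in> W" for u v
    using Lsub[OF that] Lsub[OF Wneg[OF that(1)] Wneg[OF that(2)]] Lneg[OF Wadd[OF that]]
      Lneg[OF that(1)] Lneg[OF that(2)] by (simp add: add.commute)
  have Lpos1: "L (c *\<^sub>R w) \<le> c * L w" if c: "c > 0" and w: "w \<in> W" for c w
  proof -
    have "L (c *\<^sub>R w) / c \<le> L w"
    proof (rule Lge[OF w])
      fix t assume "(w, t) \<in> K"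
      then have "(c *\<^sub>R w, c * t) \<in> K" using Ksc[of c "(w, t)"] c by simp
      from Lle[OF this] show "L (c *\<^sub>R w) / c \<le> t" using c by (simp add: field_simps)
    qed
    then show ?thesis using c by (simp add: field_simps)
  qed
  have Lpos: "L (c *\<^sub>R w) = c * L w" if c: "c > 0" and w: "w \<in> W" for c w
  proof -
    have "L ((1 / c) *\<^sub>R (c *\<^sub>R w)) \<le> (1 / c) * L (c *\<^sub>R w)" using c w Wsc by (intro Lpos1) auto
    then have "c * L w \<le> L (c *\<^sub>R w)" using c by (simp add: field_simps)
    then show ?thesis using Lpos1[OF c w] by simp
  qed
  have Lsc: "L (c *\<^sub>R w) = c * L w" if w: "w \<in> W" for c w
  proof (cases c "0::real" rule: linorder_cases)
    case less
    then have "L ((- c) *\<^sub>R (- w)) = (- c) * L (- w)" using w Wneg by (intro Lpos) auto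
    then show ?thesis using Lneg[OF w] by simp
  qed (use L0 Lpos w in auto)
  have "s \<le> L c" if "(c, s) \<in> C" for c s
  proof -
    have "(- c, - s) \<in> K0" unfolding K0_def using that CW[OF that] Wneg p0 by force
    then show ?thesis using Lle[of "- c" "- s"] K0K Lneg[OF CW[OF that]] by auto
  qed
  then show ?thesis using Ladd Lsc Lle pK by (intro exI[of _ L]) blast
qed

section \<open>Sigma-compact sets and open subgroups\<close>

definition sigma_compact :: "'a::topological_space set \<Rightarrow> bool" where
  "sigma_compact S \<longleftrightarrow> (\<exists>\<C>. countable \<C> \<and> (\<forall>C\<in>\<C>. compact C) \<and> \<Union>\<C> = S)"

lemma sigma_compactI:
  "countable \<C> \<Longrightarrow> (\<And>C. C \<in> \<C> \<Longrightarrow> compact C) \<Longrightarrow> \<Union>\<C> = S \<Longrightarrow> sigma_compact S"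
  unfolding sigma_compact_def by blast

lemma sigma_compact_compact: "compact S \<Longrightarrow> sigma_compact S"
  by (rule sigma_compactI[of "{S}"]) auto

lemma sigma_compact_Union:
  assumes "countable \<S>" and "\<And>S. S \<in> \<S> \<Longrightarrow> sigma_compact S"
  shows "sigma_compact (\<Union>\<S>)"
proof -
  have "\<forall>S\<in>\<S>. \<exists>\<C>. countable \<C> \<and> (\<forall>C\<in>\<C>. compact C) \<and> \<Union>\<C> = S"
    using assms(2) unfolding sigma_compact_def by (intro ballI)
  from bchoice[OF this] obtain \<C> where *: "\<forall>S\<in>\<S>. countable (\<C> S) \<and>
    (\<forall>C\<in>\<C> S. compact C) \<and> \<Union>(\<C> S) = S" by (elim exE)
  then have \<C>: "\<And>S. S \<in> \<S> \<Longrightarrow> countable (\<C> S)"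
    "\<And>S C. S \<in> \<S> \<Longrightarrow> C \<in> \<C> S \<Longrightarrow> compact C" "\<And>S. S \<in> \<S> \<Longrightarrow> \<Union>(\<C> S) = S"
    by simp_all
  show ?thesis
  proof (rule sigma_compactI)
    show "countable (\<Union>S\<in>\<S>. \<C> S)" using assms(1) \<C>(1) by (rule countable_UN)
    show "\<And>C. C \<in> (\<Union>S\<in>\<S>. \<C> S) \<Longrightarrow> compact C" using \<C>(2) by blast
    have "\<Union> (\<Union>S\<in>\<S>. \<C> S) = (\<Union>S\<in>\<S>. \<Union>(\<C> S))" by blast
    then show "\<Union> (\<Union>S\<in>\<S>. \<C> S) = \<Union> \<S>" using \<C>(3) by simp
  qed
qed

lemma sigma_compact_Un: "sigma_compact S \<Longrightarrow> sigma_compact T \<Longrightarrow> sigma_compact (S \<union> T)"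
  using sigma_compact_Union[of "{S, T}"] by auto

lemma sigma_compact_image:
  assumes "sigma_compact S" and "continuous_on UNIV f"
  shows "sigma_compact (f ` S)"
proof -
  obtain \<C> where \<C>: "countable \<C>" "\<forall>C\<in>\<C>. compact C" "\<Union>\<C> = S"
    using assms(1) unfolding sigma_compact_def by blast
  show ?thesis
    by (rule sigma_compactI[of "(`) f ` \<C>"])
      (use \<C> assms(2) in \<open>auto intro: compact_continuous_image continuous_on_subset\<close>)
qed

lemma sigma_compact_Times:
  assumes "sigma_compact S" and "sigma_compact T"
  shows "sigma_compact (S \<times> T)"
proof -
  obtain \<C> \<D> where \<C>: "countable \<C>" "\<forall>C\<in>\<C>. compact C" "\<Union>\<C> = S"
    and \<D>: "countable \<D>" "\<forall>C\<in>\<D>. compact C" "\<Union>\<D> = T"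
    using assms unfolding sigma_compact_def by blast
  show ?thesis
    by (rule sigma_compactI[of "(\<lambda>(C, D). C \<times> D) ` (\<C> \<times> \<D>)"])
      (use \<C> \<D> in \<open>auto intro: compact_Times\<close>)
qed

lemma continuous_on_plus_pair:
  "continuous_on UNIV (\<lambda>z :: 'a::topological_group_add \<times> 'a. fst z + snd z)"
  by (intro continuous_intros)

lemma continuous_on_neg: "continuous_on S (\<lambda>x :: 'a::topological_group_add. - x)"
  unfolding continuous_on_def by (intro ballI tendsto_minus tendsto_ident_at)

lemma translation_eq_vimage: "(+) x ` S = (\<lambda>y. - x + y) -` S" for x :: "'a::group_add"
proof
  show "(\<lambda>y. - x + y) -` S \<subseteq> (+) x ` S"
  proof
    fix y assume "y \<in> (\<lambda>y. - x + y) -` S"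
    then show "y \<in> (+) x ` S" by (intro image_eqI[of _ _ "- x + y"]) (auto simp: add.assoc[symmetric])
  qed
qed (auto simp: add.assoc[symmetric])

lemma mem_translation: "y \<in> (+) x ` S \<longleftrightarrow> - x + y \<in> S" for x :: "'a::group_add"
  unfolding translation_eq_vimage by simp

lemma continuous_on_translation:
  "continuous_on S ((+) (x :: 'a::topological_group_add))"
  by (intro continuous_intros)

lemma open_left_translation: "open S \<Longrightarrow> open ((+) x ` S)" for x :: "'a::topological_group_add"
  unfolding translation_eq_vimage by (intro open_vimage continuous_on_translation)

lemma compact_left_translation: "compact S \<Longrightarrow> compact ((+) x ` S)" for x :: "'a::topological_group_add"
  by (intro compact_continuous_image continuous_on_translation)

definition subgrp :: "'a::group_add set \<Rightarrow> bool" where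
  "subgrp H \<longleftrightarrow> 0 \<in> H \<and> (\<forall>x\<in>H. \<forall>y\<in>H. x + y \<in> H) \<and> (\<forall>x\<in>H. - x \<in> H)"

lemma
  assumes "subgrp H"
  shows subgrp_zero: "0 \<in> H" and subgrp_add: "x \<in> H \<Longrightarrow> y \<in> H \<Longrightarrow> x + y \<in> H"
    and subgrp_neg: "x \<in> H \<Longrightarrow> - x \<in> H"
  using assms unfolding subgrp_def by auto

lemma coset_eq:
  assumes "subgrp H" and "y \<in> (+) x ` H"
  shows "(+) y ` H = (+) x ` H"
proof -
  have a: "- x + y \<in> H" using assms(2) by (simp add: mem_translation)
  then have "- (- x + y) \<in> H" by (rule subgrp_neg[OF assms(1)])
  then have b: "- y + x \<in> H" by (simp add: minus_add)
  have "- x + z \<in> H" if "- y + z \<in> H" for z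
  proof -
    have "(- x + y) + (- y + z) \<in> H" using a that by (rule subgrp_add[OF assms(1)])
    then show ?thesis by (simp add: add.assoc)
  qed
  moreover have "- y + z \<in> H" if "- x + z \<in> H" for z
  proof -
    have "(- y + x) + (- x + z) \<in> H" using b that by (rule subgrp_add[OF assms(1)])
    then show ?thesis by (simp add: add.assoc)
  qed
  ultimately show ?thesis unfolding set_eq_iff mem_translation by blast
qed

text \<open>
  Sums of finitely many elements of \<open>T\<close>, where \<open>T\<close> is the symmetrised union of \<open>S\<close> and a compact
  neighbourhood of \<open>0\<close>, form a subgroup, which is open because it contains that neighbourhood.
\<close>

lemma ex_open_sigma_compact_subgroup:
  fixes S :: "'a::{topological_group_add, t2_space} set"
  assumes lc: "locally_compact_space (euclidean :: 'a topology)" and S: "sigma_compact S"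
  shows "\<exists>H. open H \<and> sigma_compact H \<and> S \<subseteq> H \<and> subgrp H"
proof -
  obtain U K where UK: "open U" "compact K" "(0::'a) \<in> U" "U \<subseteq> K"
  proof -
    have "\<exists>U K. openin euclidean U \<and> compactin euclidean K \<and> (0::'a) \<in> U \<and> U \<subseteq> K"
      using lc unfolding locally_compact_space_def by (elim ballE) simp_all
    then show ?thesis using that by auto
  qed
  define T0 where "T0 = (S \<union> K) \<union> uminus ` (S \<union> K)"
  define T where "T n = ((\<lambda>A. (\<lambda>z. fst z + snd z) ` (A \<times> T0)) ^^ n) T0" for n :: nat
  define H where "H = (\<Union>n. T n)"
  have T_0: "T 0 = T0" and T_Suc: "T (Suc n) = (\<lambda>z. fst z + snd z) ` (T n \<times> T0)" for n
    unfolding T_def by simp_all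
  have scT0: "sigma_compact T0"
    unfolding T0_def using S UK
    by (intro sigma_compact_Un sigma_compact_image continuous_on_neg) (auto intro: sigma_compact_compact)
  have "sigma_compact (T n)" for n
    by (induction n) (auto simp: T_0 T_Suc intro!: scT0 sigma_compact_image sigma_compact_Times
      continuous_on_plus_pair)
  then have scH: "sigma_compact H"
    unfolding H_def by (intro sigma_compact_Union) auto
  have UT0: "U \<subseteq> T0" and ST0: "S \<subseteq> T0" and zero: "0 \<in> T0" using UK unfolding T0_def by auto
  have negT0: "- x \<in> T0" if "x \<in> T0" for x using that unfolding T0_def by auto
  have "x + y \<in> T (Suc (n + k))" if "x \<in> T k" "y \<in> T n" for x y k n
    using that(2)
  proof (induction n arbitrary: y)
    case 0
    then show ?case using that(1) by (force simp: T_0 T_Suc)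
  next
    case (Suc n)
    then obtain a b where ab: "y = a + b" "a \<in> T n" "b \<in> T0" by (auto simp: T_Suc)
    have "(x + a) + b \<in> T (Suc (Suc (n + k)))"
      unfolding T_Suc[of "Suc (n + k)"] using Suc.IH[OF ab(2)] ab(3) by force
    then show ?case using ab by (simp add: add.assoc)
  qed
  then have addH: "x + y \<in> H" if "x \<in> H" "y \<in> H" for x y using that unfolding H_def by blast
  have T0H: "T0 \<subseteq> H" unfolding H_def using T_0 by blast
  have "- x \<in> H" if "x \<in> T n" for x n
    using that
  proof (induction n arbitrary: x)
    case 0
    then show ?case using T0H negT0 by (auto simp: T_0)
  next
    case (Suc n)
    then obtain a b where ab: "x = a + b" "a \<in> T n" "b \<in> T0" by (auto simp: T_Suc)
    then show ?case using addH[of "- b" "- a"] Suc.IH[of a] negT0[of b] T0H by (auto simp: minus_add)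
  qed
  then have negH: "- x \<in> H" if "x \<in> H" for x using that unfolding H_def by blast
  have "open H"
  proof (subst open_subopen, intro ballI)
    fix x assume x: "x \<in> H"
    have "(+) x ` U \<subseteq> H" using x addH UT0 T0H by blast
    moreover have "x \<in> (+) x ` U" using UK by (simp add: mem_translation)
    ultimately show "\<exists>V. open V \<and> x \<in> V \<and> V \<subseteq> H" using open_left_translation[OF UK(1)] by blast
  qed
  moreover have "subgrp H" unfolding subgrp_def using zero T0H addH negH by blast
  ultimately show ?thesis using scH ST0 T0H by blast
qed

lemma not_sigma_compact_UNIV:
  assumes "natLeq <o (\<kappa> :: 'a::topological_space set rel)"
  shows "\<not> sigma_compact (UNIV :: 'a set)"
proof
  assume "sigma_compact (UNIV :: 'a set)"
  then obtain D :: "'a set set" where D: "countable D" "\<forall>C\<in>D. compact C" "\<Union>D = UNIV"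
    unfolding sigma_compact_def by (elim exE conjE) (rule that)
  obtain C :: "'a set set" where C: "\<kappa> = |C|" "\<forall>D\<in>(compact_covers :: 'a set set set). |C| \<le>o |D|"
    using \<kappa>_attained[where 'a = 'a] by (elim bexE conjE) (rule that)
  have "|C| \<le>o |D|" using C D unfolding compact_covers_def by blast
  also have "|D| \<le>o natLeq" 
  proof -
    obtain f :: "'a set \<Rightarrow> nat" where "inj_on f D" using D(1) by (rule countableE)
    then have "|D| \<le>o |UNIV :: nat set|" by (rule card_of_ordLeqI) simp
    then show ?thesis using card_of_nat ordLeq_ordIso_trans by blast
  qed
  finally have "(\<kappa> :: 'a set rel) \<le>o natLeq" using C(1) by simp
  then show False using assms not_ordLess_ordLeq by metis
qed

text \<open>
  Finitely many cosets of a sigma-compact subgroup are sigma-compact, so they never exhaust the group.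
\<close>

lemma ex_many_disjoint_cosets:
  fixes H :: "'a::topological_group_add set"
  assumes nsc: "\<not> sigma_compact (UNIV :: 'a set)" and H: "sigma_compact H" "subgrp H"
  shows "\<exists>F. finite F \<and> card F = n \<and> disjoint_family_on (\<lambda>x. (+) x ` H) F"
proof (induction n)
  case 0
  show ?case by (intro exI[of _ "{}"]) (auto simp: disjoint_family_on_def)
next
  case (Suc n)
  then obtain F where F: "finite F" "card F = n" "disjoint_family_on (\<lambda>x. (+) x ` H) F" by blast
  have "sigma_compact (\<Union>x\<in>F. (+) x ` H)"
    using F H by (intro sigma_compact_Union)
      (auto intro!: sigma_compact_image continuous_on_translation countable_finite)
  then have "(\<Union>x\<in>F. (+) x ` H) \<noteq> UNIV" using nsc by metis
  then obtain y where y: "\<And>x. x \<in> F \<Longrightarrow> y \<notin> (+) x ` H" by blast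
  note zero = subgrp_zero[OF H(2)]
  have "(+) y ` H \<inter> (+) x ` H = {}" if "x \<in> F" for x
  proof (rule ccontr)
    assume "(+) y ` H \<inter> (+) x ` H \<noteq> {}"
    then obtain z where z: "z \<in> (+) y ` H" "z \<in> (+) x ` H" by blast
    then have "(+) y ` H = (+) x ` H" using coset_eq[OF H(2)] by metis
    moreover have "y \<in> (+) y ` H" using zero by (simp add: mem_translation)
    ultimately show False using y[OF that] by simp
  qed
  moreover have "y \<notin> F" using y[of y] zero unfolding mem_translation by auto
  ultimately show ?case using F
    by (intro exI[of _ "insert y F"])
      (fastforce simp: disjoint_family_on_def)
qed

section \<open>Essentially bounded functions and means\<close>

locale haar =
  fixes m :: "'a::{topological_group_add, t2_space} measure"
  assumes haar: "left_haar_measure m"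
begin

abbreviation M where "M \<equiv> completion m"

lemma haar_parts:
  shows sets_m [simp]: "sets m = sets borel"
    and "\<forall>K. compact K \<longrightarrow> emeasure m K < \<infinity>"
    and "\<forall>E\<in>sets borel. emeasure m E = (INF U\<in>{U. open U \<and> E \<subseteq> U}. emeasure m U)"
    and "\<forall>x. \<forall>E\<in>sets borel. emeasure m ((+) x ` E) = emeasure m E"
  using haar unfolding left_haar_measure_def by - (elim conjE, assumption)+

lemma space_m [simp]: "space m = UNIV"
  using sets_eq_imp_space_eq[OF sets_m] by simp

lemma borel_measurable_m [simp]: "borel_measurable m = borel_measurable borel"
  by (rule measurable_cong_sets) simp_all

lemma compact_in_borel [simp, intro]: "compact K \<Longrightarrow> K \<in> sets borel" for K :: "'a set"
  by (rule borel_closed) (rule compact_imp_closed)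

lemma borel_in_M [simp, intro]: "E \<in> sets borel \<Longrightarrow> E \<in> sets M"
  using sets_completionI_sets[of E m] by simp

lemma emeasure_compact: "compact K \<Longrightarrow> emeasure m K < \<infinity>"
  using haar_parts(2) by blast

lemma emeasure_translation: "E \<in> sets borel \<Longrightarrow> emeasure m ((+) x ` E) = emeasure m E"
  using haar_parts(4) by blast

lemma outer_regular:
  "E \<in> sets borel \<Longrightarrow> emeasure m E = (INF U\<in>{U. open U \<and> E \<subseteq> U}. emeasure m U)"
  by (rule bspec[OF haar_parts(3)])

lemma Linf_iff:
  "\<phi> \<in> Linf m \<longleftrightarrow> bounded (range \<phi>) \<and>
     (\<forall>K. compact K \<longrightarrow> (\<lambda>x. indicator K x * \<phi> x) \<in> borel_measurable M)"
proof -
  have "(\<forall>B\<in>sets borel. \<phi> -` B \<inter> K \<in> sets M) \<longleftrightarrow> (\<lambda>x. indicator K x * \<phi> x) \<in> borel_measurable M"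
    if K: "compact K" for K
  proof
    assume L: "\<forall>B\<in>sets borel. \<phi> -` B \<inter> K \<in> sets M"
    show "(\<lambda>x. indicator K x * \<phi> x) \<in> borel_measurable M"
    proof (rule measurableI)
      fix B :: "real set" assume B: "B \<in> sets borel"
      have "(\<lambda>x. indicator K x * \<phi> x) -` B \<inter> space M
        = (\<phi> -` B \<inter> K) \<union> (if 0 \<in> B then - K else {})"
        by (auto simp: indicator_def of_bool_def split: if_splits)
      moreover have "- K \<in> sets M" by (intro borel_in_M borel_comp compact_in_borel K)
      ultimately show "(\<lambda>x. indicator K x * \<phi> x) -` B \<inter> space M \<in> sets M"
        using L B by auto
    qed simp
  next
    assume R: "(\<lambda>x. indicator K x * \<phi> x) \<in> borel_measurable M"
    show "\<forall>B\<in>sets borel. \<phi> -` B \<inter> K \<in> sets M"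
    proof
      fix B :: "real set" assume B: "B \<in> sets borel"
      have "\<phi> -` B \<inter> K = ((\<lambda>x. indicator K x * \<phi> x) -` B \<inter> space M) \<inter> K"
        by (auto simp: indicator_def of_bool_def split: if_splits)
      also have "\<dots> \<in> sets M" using measurable_sets[OF R B] K by auto
      finally show "\<phi> -` B \<inter> K \<in> sets M" .
    qed
  qed
  then show ?thesis
    unfolding Linf_def locally_measurable_fun_def locally_measurable_set_def by blast
qed

lemma Linf_bounded: "\<phi> \<in> Linf m \<Longrightarrow> \<exists>b\<ge>0. \<forall>x. \<bar>\<phi> x\<bar> \<le> b"
  unfolding Linf_iff bounded_iff
  by (metis UNIV_I abs_ge_zero dual_order.trans imageI real_norm_def)

lemma Linf_measurable:
  "\<phi> \<in> Linf m \<Longrightarrow> compact K \<Longrightarrow> (\<lambda>x. indicator K x * \<phi> x) \<in> borel_measurable M"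
  unfolding Linf_iff by blast

lemma LinfI:
  assumes "\<And>x. \<bar>\<phi> x\<bar> \<le> b" and "\<And>K. compact K \<Longrightarrow> (\<lambda>x. indicator K x * \<phi> x) \<in> borel_measurable M"
  shows "\<phi> \<in> Linf m"
  using assms unfolding Linf_iff by (auto simp: bounded_iff)

lemma Linf_const [simp, intro]: "(\<lambda>x. c) \<in> Linf m"
  by (rule LinfI[of _ "\<bar>c\<bar>"])
    (auto intro!: borel_measurable_times[OF borel_measurable_indicator borel_measurable_const])

lemma Linf_add [intro]:
  assumes "\<phi> \<in> Linf m" and "\<psi> \<in> Linf m"
  shows "(\<lambda>x. \<phi> x + \<psi> x) \<in> Linf m"
proof -
  obtain a b where ab: "\<And>x. \<bar>\<phi> x\<bar> \<le> a" "\<And>x. \<bar>\<psi> x\<bar> \<le> b" using assms Linf_bounded by metis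
  show ?thesis
  proof (rule LinfI[of _ "a + b"])
    show "\<bar>\<phi> x + \<psi> x\<bar> \<le> a + b" for x
      using ab by (intro order_trans[OF abs_triangle_ineq] add_mono)
    fix K :: "'a set" assume "compact K"
    then show "(\<lambda>x. indicator K x * (\<phi> x + \<psi> x)) \<in> borel_measurable M"
      unfolding distrib_left by (intro borel_measurable_add Linf_measurable assms)
  qed
qed

lemma Linf_cmult [intro]:
  assumes "\<phi> \<in> Linf m"
  shows "(\<lambda>x. c * \<phi> x) \<in> Linf m"
proof -
  obtain a where a: "\<And>x. \<bar>\<phi> x\<bar> \<le> a" using assms Linf_bounded by metis
  show ?thesis
  proof (rule LinfI[of _ "\<bar>c\<bar> * a"])
    fix K :: "'a set" assume "compact K"
    then have "(\<lambda>x. c * (indicator K x * \<phi> x)) \<in> borel_measurable M"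
      by (intro borel_measurable_times[OF borel_measurable_const] Linf_measurable assms)
    then show "(\<lambda>x. indicator K x * (c * \<phi> x)) \<in> borel_measurable M"
      by (simp add: mult.left_commute)
  qed (use a in \<open>auto simp: abs_mult intro!: mult_left_mono\<close>)
qed

lemma Linf_diff: "\<phi> \<in> Linf m \<Longrightarrow> \<psi> \<in> Linf m \<Longrightarrow> (\<lambda>x. \<phi> x - \<psi> x) \<in> Linf m"
  using Linf_add[of \<phi> "\<lambda>x. - 1 * \<psi> x"] Linf_cmult[of \<psi> "-1"] by simp

lemma Linf_sum: "(\<And>i. i \<in> I \<Longrightarrow> \<phi> i \<in> Linf m) \<Longrightarrow> (\<lambda>x. \<Sum>i\<in>I. \<phi> i x) \<in> Linf m"
proof (induction I rule: infinite_finite_induct)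
  case (insert i I)
  then show ?case using Linf_add[of "\<phi> i" "\<lambda>x. \<Sum>i\<in>I. \<phi> i x"] by simp
qed simp_all

lemma Linf_indicator:
  assumes "locally_measurable_set m E"
  shows "indicator E \<in> Linf m"
proof (rule LinfI[of _ 1])
  fix K :: "'a set" assume "compact K"
  then have "E \<inter> K \<in> sets M" using assms unfolding locally_measurable_set_def by blast
  moreover have "indicator K x * indicator E x = (indicator (E \<inter> K) x :: real)" for x
    by (auto simp: indicator_def of_bool_def split: if_splits)
  ultimately show "(\<lambda>x. indicator K x * indicator E x :: real) \<in> borel_measurable M"
    by (simp del: space_completion)
qed (auto simp: indicator_def of_bool_def split: if_splits)

lemma locally_measurable_borel: "E \<in> sets borel \<Longrightarrow> locally_measurable_set m E"
  unfolding locally_measurable_set_def by auto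

lemma locally_null_subset:
  "locally_null_set m E \<Longrightarrow> F \<subseteq> E \<Longrightarrow> locally_null_set m F"
  unfolding locally_null_set_def by (meson Int_mono null_sets_completion_subset order_refl)

lemma locally_null_empty [simp]: "locally_null_set m {}"
  unfolding locally_null_set_def by simp

lemma Linf_integrable:
  assumes "\<phi> \<in> Linf m" and "compact A"
  shows "integrable M (\<lambda>x. indicator A x * \<phi> x)"
proof -
  obtain b where b: "\<And>x. \<bar>\<phi> x\<bar> \<le> b" "b \<ge> 0" using assms Linf_bounded by metis
  show ?thesis
    by (rule integrableI_bounded_set[of A _ _ b])
      (use b emeasure_compact[OF assms(2)] Linf_measurable[OF assms] assms(2) in
        \<open>auto simp: indicator_def of_bool_def emeasure_completion\<close>)
qed

lemma Linf_norm_le: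
  assumes "0 \<le> c" and "\<And>x. \<bar>\<phi> x\<bar> \<le> c"
  shows "Linf_norm m \<phi> \<le> c"
proof -
  have "{x. c < \<bar>\<phi> x\<bar>} = {}" using assms(2) by (auto simp: not_less)
  then show ?thesis
    unfolding Linf_norm_def by (intro cInf_lower) (use assms(1) in \<open>auto intro: bdd_belowI[of _ 0]\<close>)
qed

text \<open>
  With a strict inequality it does not matter whether the infimum defining the norm is attained.
\<close>

lemma Linf_normD:
  assumes "\<phi> \<in> Linf m" and "Linf_norm m \<phi> < c"
  shows "locally_null_set m {x. c < \<bar>\<phi> x\<bar>}"
proof -
  let ?S = "{c. 0 \<le> c \<and> locally_null_set m {x. c < \<bar>\<phi> x\<bar>}}"
  obtain b where b: "\<And>x. \<bar>\<phi> x\<bar> \<le> b" "b \<ge> 0" using assms Linf_bounded by metis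
  have "{x. b < \<bar>\<phi> x\<bar>} = {}" using b(1) by (auto simp: not_less)
  then have "b \<in> ?S" using b(2) by simp
  then have "?S \<noteq> {}" by blast
  then obtain d where "d \<in> ?S" "d < c"
    using cInf_lessD[of ?S c] assms(2) unfolding Linf_norm_def by blast
  then show ?thesis by (auto intro: locally_null_subset)
qed

context
  fixes \<mu> assumes \<mu>: "\<mu> \<in> means m"
begin

lemma mean_add: "\<phi> \<in> Linf m \<Longrightarrow> \<psi> \<in> Linf m \<Longrightarrow> \<mu> (\<lambda>x. \<phi> x + \<psi> x) = \<mu> \<phi> + \<mu> \<psi>"
  using \<mu> unfolding means_def Linf_functional_def by blast

lemma mean_cmult: "\<phi> \<in> Linf m \<Longrightarrow> \<mu> (\<lambda>x. c * \<phi> x) = c * \<mu> \<phi>"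
  using \<mu> unfolding means_def Linf_functional_def by blast

lemma mean_nonneg: "\<phi> \<in> Linf m \<Longrightarrow> locally_null_set m {x. \<phi> x < 0} \<Longrightarrow> 0 \<le> \<mu> \<phi>"
  using \<mu> unfolding means_def by blast

lemma mean_diff: "\<phi> \<in> Linf m \<Longrightarrow> \<psi> \<in> Linf m \<Longrightarrow> \<mu> (\<lambda>x. \<phi> x - \<psi> x) = \<mu> \<phi> - \<mu> \<psi>"
  using mean_add[of \<phi> "\<lambda>x. - 1 * \<psi> x"] mean_cmult[of \<psi> "-1"] Linf_cmult[of \<psi> "-1"] by simp

lemma mean_zero: "\<mu> (\<lambda>x. 0) = 0"
  using mean_cmult[of "\<lambda>x. 0" 0] by simp

lemma mean_sum:
  "(\<And>i. i \<in> I \<Longrightarrow> \<phi> i \<in> Linf m) \<Longrightarrow> \<mu> (\<lambda>x. \<Sum>i\<in>I. \<phi> i x) = (\<Sum>i\<in>I. \<mu> (\<phi> i))"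
proof (induction I rule: infinite_finite_induct)
  case (insert i I)
  then show ?case using mean_add[of "\<phi> i" "\<lambda>x. \<Sum>i\<in>I. \<phi> i x"] Linf_sum[of I \<phi>] by simp
qed (simp_all add: mean_zero)

lemma mean_le:
  assumes "\<phi> \<in> Linf m" "\<psi> \<in> Linf m" "locally_null_set m {x. \<psi> x < \<phi> x}"
  shows "\<mu> \<phi> \<le> \<mu> \<psi>"
  using mean_nonneg[OF Linf_diff[OF assms(2,1)]] mean_diff[OF assms(2,1)] assms(3) by simp

lemma mean_mono:
  assumes "\<phi> \<in> Linf m" "\<psi> \<in> Linf m" "\<And>x. \<phi> x \<le> \<psi> x"
  shows "\<mu> \<phi> \<le> \<mu> \<psi>"
proof -
  have "{x. \<psi> x < \<phi> x} = {}" using assms(3) by (auto simp: not_less)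
  then show ?thesis using mean_le assms(1,2) by simp
qed

text \<open>
  Positivity makes the constant function \<open>1\<close> extremal in the unit ball, so the norm of \<open>\<mu>\<close> is \<open>\<mu> 1\<close>.
\<close>

lemma mean_one: "\<mu> (\<lambda>x. 1) = 1"
proof (rule antisym)
  have norm: "functional_norm m \<mu> = 1" using \<mu> unfolding means_def by blast
  have "ereal \<bar>\<mu> (\<lambda>x. 1)\<bar> \<le> functional_norm m \<mu>"
    unfolding functional_norm_def by (intro SUP_upper) (auto intro!: Linf_norm_le)
  then show "\<mu> (\<lambda>x. 1) \<le> 1" using norm by (simp add: one_ereal_def)
  have one0: "0 \<le> \<mu> (\<lambda>x. 1)" by (intro mean_nonneg) auto
  have "\<bar>\<mu> \<phi>\<bar> \<le> \<mu> (\<lambda>x. 1)" if \<phi>: "\<phi> \<in> Linf m" and n: "Linf_norm m \<phi> \<le> 1" for \<phi>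
  proof (rule field_le_epsilon)
    fix e :: real assume e: "e > 0"
    define d where "d = e / (\<mu> (\<lambda>x. 1) + 1)"
    have d: "d > 0" "d * \<mu> (\<lambda>x. 1) \<le> e" unfolding d_def using e one0 by (auto simp: field_simps)
    have null: "locally_null_set m {x. 1 + d < \<bar>\<phi> x\<bar>}" using n d by (intro Linf_normD[OF \<phi>]) auto
    have "\<mu> \<phi> \<le> \<mu> (\<lambda>x. (1 + d) * 1)"
      by (intro mean_le \<phi> Linf_cmult Linf_const locally_null_subset[OF null]) auto
    moreover have "\<mu> (\<lambda>x. - 1 * \<phi> x) \<le> \<mu> (\<lambda>x. (1 + d) * 1)"
      by (intro mean_le \<phi> Linf_cmult Linf_const locally_null_subset[OF null]) auto
    moreover have "\<mu> (\<lambda>x. - 1 * \<phi> x) = - 1 * \<mu> \<phi>" by (rule mean_cmult[OF \<phi>])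
    moreover have "\<mu> (\<lambda>x. (1 + d) * 1) = (1 + d) * \<mu> (\<lambda>x. 1)" by (rule mean_cmult) auto
    ultimately have "\<bar>\<mu> \<phi>\<bar> \<le> (1 + d) * \<mu> (\<lambda>x. 1)" by linarith
    then show "\<bar>\<mu> \<phi>\<bar> \<le> \<mu> (\<lambda>x. 1) + e" using d(2) by (simp add: distrib_right)
  qed
  then have "functional_norm m \<mu> \<le> ereal (\<mu> (\<lambda>x. 1))"
    unfolding functional_norm_def by (intro SUP_least) auto
  then show "1 \<le> \<mu> (\<lambda>x. 1)" using norm by (simp add: one_ereal_def)
qed

end

lemma set_mean_eq:
  assumes "\<phi> \<in> Linf m"
  shows "set_mean m A \<phi> = (\<integral>x. indicator A x * \<phi> x \<partial>M) / measure m A"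
  using assms unfolding set_mean_def set_lebesgue_integral_def by simp

lemma set_mean_indicator:
  assumes "locally_measurable_set m E" and "compact A"
  shows "set_mean m A (indicator E) = measure M (E \<inter> A) / measure m A"
proof -
  have "E \<inter> A \<in> sets M" using assms unfolding locally_measurable_set_def by blast
  moreover have "indicator A x * indicator E x = (indicator (E \<inter> A) x :: real)" for x
    by (auto simp: indicator_def of_bool_def split: if_splits)
  ultimately show ?thesis using set_mean_eq[OF Linf_indicator[OF assms(1)], of A]
    by (simp del: space_completion)
qed

lemma set_mean_in_means:
  assumes A: "compact A" and pos: "0 < emeasure m A"
  shows "set_mean m A \<in> means m"
proof -
  have mA: "0 < measure m A"
    using pos emeasure_compact[OF A] by (simp add: measure_def enn2real_positive_iff)
  have AE_A: "AE x in M. x \<in> A \<longrightarrow> P x" if null: "locally_null_set m {x. \<not> P x}" for P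
  proof (rule AE_I')
    show "{x. \<not> P x} \<inter> A \<in> null_sets M" using null A unfolding locally_null_set_def by blast
  qed auto
  have nonneg: "0 \<le> set_mean m A \<phi>" if "\<phi> \<in> Linf m" "locally_null_set m {x. \<phi> x < 0}" for \<phi>
  proof -
    have "AE x in M. x \<in> A \<longrightarrow> 0 \<le> \<phi> x" using that(2) by (intro AE_A) (simp add: not_le)
    then have "0 \<le> (\<integral>x. indicator A x * \<phi> x \<partial>M)"
      by (intro integral_nonneg_AE) (auto simp: indicator_def of_bool_def elim!: eventually_mono)
    then show ?thesis unfolding set_mean_eq[OF that(1)] by simp
  qed
  have cong: "set_mean m A \<phi> = set_mean m A \<psi>"
    if \<phi>: "\<phi> \<in> Linf m" and \<psi>: "\<psi> \<in> Linf m" and null: "locally_null_set m {x. \<phi> x \<noteq> \<psi> x}" for \<phi> \<psi>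
  proof -
    have "AE x in M. x \<in> A \<longrightarrow> \<phi> x = \<psi> x" using null by (intro AE_A) simp
    then have "(\<integral>x. indicator A x * \<phi> x \<partial>M) = (\<integral>x. indicator A x * \<psi> x \<partial>M)"
      by (intro integral_cong_AE Linf_measurable A \<phi> \<psi>) (auto simp: indicator_def of_bool_def elim!: eventually_mono)
    then show ?thesis using set_mean_eq \<phi> \<psi> by simp
  qed
  have add: "set_mean m A (\<lambda>x. \<phi> x + \<psi> x) = set_mean m A \<phi> + set_mean m A \<psi>"
    if "\<phi> \<in> Linf m" "\<psi> \<in> Linf m" for \<phi> \<psi>
    using that set_mean_eq Linf_add[OF that] Linf_integrable[OF that(1) A] Linf_integrable[OF that(2) A]
    by (simp add: distrib_left add_divide_distrib)
  have cmult: "set_mean m A (\<lambda>x. c * \<phi> x) = c * set_mean m A \<phi>" if "\<phi> \<in> Linf m" for \<phi> c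
    using that set_mean_eq Linf_cmult[OF that, of c] by (simp add: mult.left_commute[of _ c])
  have one: "set_mean m A (\<lambda>x. 1) = 1"
    using set_mean_eq[OF Linf_const, of A 1] A mA by simp
  have abs_le: "\<bar>set_mean m A \<phi>\<bar> \<le> 1" if \<phi>: "\<phi> \<in> Linf m" and n: "Linf_norm m \<phi> \<le> 1" for \<phi>
  proof (rule field_le_epsilon)
    fix e :: real assume e: "e > 0"
    have null: "locally_null_set m {x. 1 + e < \<bar>\<phi> x\<bar>}" using n e by (intro Linf_normD[OF \<phi>]) auto
    have "0 \<le> set_mean m A (\<lambda>x. (1 + e) * 1 + c * \<phi> x)" if "\<bar>c\<bar> = 1" for c
      by (intro nonneg \<phi> Linf_add Linf_cmult Linf_const locally_null_subset[OF null])
        (use that in \<open>auto simp: abs_if split: if_splits\<close>)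
    moreover have "set_mean m A (\<lambda>x. (1 + e) * 1 + c * \<phi> x) = (1 + e) + c * set_mean m A \<phi>" for c
      using add[of "\<lambda>x. (1 + e) * 1" "\<lambda>x. c * \<phi> x"] cmult[of "\<lambda>x. 1" "1 + e"] cmult[OF \<phi>, of c]
        one Linf_cmult[OF \<phi>, of c] by simp
    ultimately have "0 \<le> (1 + e) + c * set_mean m A \<phi>" if "\<bar>c\<bar> = 1" for c using that by metis
    from this[of 1] this[of "-1"] show "\<bar>set_mean m A \<phi>\<bar> \<le> 1 + e" by simp
  qed
  have "functional_norm m (set_mean m A) = 1"
  proof (rule antisym)
    show "functional_norm m (set_mean m A) \<le> 1"
      unfolding functional_norm_def by (intro SUP_least) (use abs_le in \<open>auto simp: one_ereal_def\<close>)
    have "ereal \<bar>set_mean m A (\<lambda>x. 1)\<bar> \<le> functional_norm m (set_mean m A)"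
      unfolding functional_norm_def by (intro SUP_upper) (auto intro!: Linf_norm_le)
    then show "1 \<le> functional_norm m (set_mean m A)" using one by (simp add: one_ereal_def)
  qed
  moreover have "set_mean m A \<in> extensional (Linf m)" unfolding set_mean_def by simp
  ultimately show ?thesis
    unfolding means_def Linf_functional_def
    by (intro CollectI conjI ballI allI impI)
      (assumption | (rule cong add cmult nonneg; assumption))+
qed

text \<open>
  The many disjoint translates of \<open>H\<close> all have the same mean, and together at most \<open>1\<close>. Consequently an
  invariant mean does not see sigma-compact sets, since each of them lies in such an \<open>H\<close>.
\<close>

lemma invariant_mean_subgroup:
  assumes \<mu>: "\<mu> \<in> LIMeans m" and H: "open H" "sigma_compact H" "subgrp H"
    and nsc: "\<not> sigma_compact (UNIV :: 'a set)"
  shows "\<mu> (indicator H) = 0"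
proof -
  have \<mu>': "\<mu> \<in> means m" using \<mu> unfolding LIMeans_def by blast
  have HL: "indicator ((+) x ` H) \<in> Linf m" for x
    by (intro Linf_indicator locally_measurable_borel borel_open open_left_translation H)
  have H0: "indicator H \<in> Linf m"
    by (intro Linf_indicator locally_measurable_borel borel_open H)
  have inv: "\<mu> (indicator ((+) x ` H)) = \<mu> (indicator H)" for x
  proof -
    have "(indicator ((+) x ` H) :: 'a \<Rightarrow> real) = ltrans x (indicator H)"
      unfolding ltrans_def by (auto simp: fun_eq_iff indicator_def mem_translation)
    then show ?thesis using \<mu> H0 unfolding LIMeans_def by simp
  qed
  have bound: "real n * \<mu> (indicator H) \<le> 1" for n
  proof -
    obtain F where F: "finite F" "card F = n" "disjoint_family_on (\<lambda>x. (+) x ` H) F"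
      using ex_many_disjoint_cosets[OF nsc H(2,3)] by blast
    have "real n * \<mu> (indicator H) = (\<Sum>x\<in>F. \<mu> (indicator ((+) x ` H)))"
      using inv F by simp
    also have "\<dots> = \<mu> (\<lambda>y. \<Sum>x\<in>F. indicator ((+) x ` H) y)"
      by (rule mean_sum[OF \<mu>', symmetric]) (rule HL)
    also have "\<dots> \<le> \<mu> (\<lambda>x. 1)"
    proof (intro mean_mono[OF \<mu>'] Linf_sum HL Linf_const)
      fix y
      have "(\<Sum>x\<in>F. indicator ((+) x ` H) y) = (indicator (\<Union>x\<in>F. (+) x ` H) y :: real)"
        by (rule indicator_UN_disjoint[symmetric]) (use F in auto)
      then show "(\<Sum>x\<in>F. indicator ((+) x ` H) y) \<le> (1 :: real)" by (simp add: indicator_def)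
    qed
    finally show ?thesis using mean_one[OF \<mu>'] by simp
  qed
  have "0 \<le> \<mu> (indicator H)"
  proof -
    have "\<mu> (\<lambda>x. 0) \<le> \<mu> (indicator H)" by (intro mean_mono[OF \<mu>'] H0 Linf_const) auto
    then show ?thesis by (simp add: mean_zero[OF \<mu>'])
  qed
  moreover have "\<not> 0 < \<mu> (indicator H)"
  proof
    assume "0 < \<mu> (indicator H)"
    then obtain n :: nat where "1 < real n * \<mu> (indicator H)" using reals_Archimedean3 by blast
    then show False using bound[of n] by simp
  qed
  ultimately show ?thesis by simp
qed

end

section \<open>Functionals bounded by the measure have densities\<close>

context haar
begin

text \<open>
  The Haar measure need not be sigma-finite, so finiteness of the measure of a set is carried along.
\<close>

definition fin_borel :: "'a set \<Rightarrow> bool" where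
  "fin_borel A \<longleftrightarrow> A \<in> sets borel \<and> emeasure m A < \<infinity>"

lemma fin_borel_subset: "fin_borel A \<Longrightarrow> B \<in> sets borel \<Longrightarrow> B \<subseteq> A \<Longrightarrow> fin_borel B"
  unfolding fin_borel_def by (metis emeasure_mono le_less_trans sets_m)

lemma fin_borel_compact: "compact K \<Longrightarrow> fin_borel K"
  unfolding fin_borel_def using emeasure_compact by blast

lemma fin_borel_emeasure: "fin_borel A \<Longrightarrow> emeasure m A = ennreal (measure m A)"
  unfolding fin_borel_def by (simp add: emeasure_eq_ennreal_measure less_top)

lemma fin_borel_UN:
  assumes "finite I" and "\<And>i. i \<in> I \<Longrightarrow> fin_borel (A i)"
  shows "fin_borel (\<Union>i\<in>I. A i)"
proof -
  have "emeasure m (\<Union>i\<in>I. A i) \<le> (\<Sum>i\<in>I. emeasure m (A i))"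
    using assms by (intro emeasure_subadditive_finite) (auto simp: fin_borel_def)
  also have "\<dots> < \<infinity>" using assms by (auto simp: fin_borel_def)
  finally show ?thesis using assms unfolding fin_borel_def by auto
qed

lemma integrable_fin_borel:
  assumes A: "fin_borel A" and \<phi>: "\<phi> \<in> borel_measurable borel" and b: "\<And>x. \<bar>\<phi> x\<bar> \<le> (b::real)"
  shows "integrable m (\<lambda>x. indicator A x * \<phi> x)"
proof (rule integrableI_bounded_set[of A _ _ b])
  show "(\<lambda>x. indicator A x * \<phi> x) \<in> borel_measurable m"
    using A \<phi> unfolding fin_borel_def by (simp add: borel_measurable_times[OF borel_measurable_indicator])
qed (use A b in \<open>auto simp: fin_borel_def indicator_def of_bool_def\<close>)

text \<open>
  Radon-Nikodym. Domination by \<open>m\<close> turns finite into countable additivity, and \<open>A \<mapsto> F A + m A\<close> is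
  a positive measure on \<open>D\<close> below \<open>2 m\<close>; the density of \<open>F\<close> is its density minus \<open>1\<close>.
\<close>

lemma bounded_set_function_density_finite:
  fixes F :: "'a set \<Rightarrow> real"
  assumes D: "fin_borel D"
    and add: "\<And>A B. fin_borel A \<Longrightarrow> fin_borel B \<Longrightarrow> A \<inter> B = {} \<Longrightarrow> F (A \<union> B) = F A + F B"
    and bound: "\<And>A. fin_borel A \<Longrightarrow> \<bar>F A\<bar> \<le> measure m A"
  shows "\<exists>\<phi>\<in>borel_measurable borel. (\<forall>x. \<bar>\<phi> x\<bar> \<le> 1) \<and>
    (\<forall>A\<in>sets borel. A \<subseteq> D \<longrightarrow> F A = (\<integral>x. indicator A x * \<phi> x \<partial>m))"
proof -
  note [measurable_cong] = sets_m
  have Dm [measurable]: "D \<in> sets m" using D unfolding fin_borel_def by simp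
  define \<nu> where "\<nu> A = ennreal (F (A \<inter> D) + measure m (A \<inter> D))" for A
  have fb: "fin_borel (A \<inter> D)" if "A \<in> sets borel" for A
    using D that by (intro fin_borel_subset[OF D]) (auto simp: fin_borel_def)
  have nonneg: "0 \<le> F (A \<inter> D) + measure m (A \<inter> D)" if "A \<in> sets borel" for A
    using bound[OF fb[OF that]] by linarith
  have le2: "\<nu> A \<le> 2 * emeasure m (A \<inter> D)" if "A \<in> sets borel" for A
  proof -
    have "\<nu> A \<le> ennreal (2 * measure m (A \<inter> D))"
      unfolding \<nu>_def using bound[OF fb[OF that]] by (intro ennreal_leI) linarith
    then show ?thesis using fin_borel_emeasure[OF fb[OF that]] by (simp add: ennreal_mult)
  qed
  define N where "N = measure_of UNIV (sets borel) \<nu>"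
  interpret B: sigma_algebra "UNIV :: 'a set" "sets borel"
    using sets.sigma_algebra_axioms[of "borel :: 'a measure"] by simp
  have pos: "positive (sets borel) \<nu>"
    unfolding positive_def \<nu>_def using bound[of "{}"] fb[of "{}"] by simp
  have "countably_additive (sets borel) \<nu>"
  proof (rule B.empty_continuous_imp_countably_additive[OF pos])
    show "additive (sets borel) \<nu>"
      unfolding additive_def
    proof (intro ballI impI)
      fix A B :: "'a set" assume AB: "A \<in> sets borel" "B \<in> sets borel" "A \<inter> B = {}"
      have eq: "(A \<union> B) \<inter> D = (A \<inter> D) \<union> (B \<inter> D)" by blast
      have "F ((A \<union> B) \<inter> D) = F (A \<inter> D) + F (B \<inter> D)"
        unfolding eq using AB by (intro add fb) auto
      moreover have "measure m ((A \<union> B) \<inter> D) = measure m (A \<inter> D) + measure m (B \<inter> D)"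
        unfolding eq using AB fb[OF AB(1)] fb[OF AB(2)]
        by (intro measure_Union) (auto simp: fin_borel_def)
      ultimately show "\<nu> (A \<union> B) = \<nu> A + \<nu> B"
        unfolding \<nu>_def using nonneg[OF AB(1)] nonneg[OF AB(2)]
        by (subst ennreal_plus[symmetric]) (auto simp: algebra_simps)
    qed
    show "\<forall>A\<in>sets borel. \<nu> A \<noteq> \<infinity>" unfolding \<nu>_def by simp
    fix A :: "nat \<Rightarrow> 'a set"
    assume A: "range A \<subseteq> sets borel" "decseq A" "(\<Inter>i. A i) = {}"
    have "(\<lambda>i. emeasure m (A i \<inter> D)) \<longlonglongrightarrow> emeasure m (\<Inter>i. A i \<inter> D)"
    proof (rule Lim_emeasure_decseq)
      show "decseq (\<lambda>i. A i \<inter> D)" using A(2) unfolding decseq_def by blast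
      show "emeasure m (A i \<inter> D) \<noteq> \<infinity>" for i
        using fb[of "A i"] A(1) unfolding fin_borel_def by (simp add: less_top range_subsetD)
    qed (use A(1) Dm in auto)
    moreover have "(\<Inter>i. A i \<inter> D) = {}" using A(3) by blast
    ultimately have "(\<lambda>i. emeasure m (A i \<inter> D)) \<longlonglongrightarrow> 0" by simp
    then have "(\<lambda>i. 2 * emeasure m (A i \<inter> D)) \<longlonglongrightarrow> 2 * 0"
      by (intro ennreal_tendsto_cmult) auto
    then have lim: "(\<lambda>i. 2 * emeasure m (A i \<inter> D)) \<longlonglongrightarrow> 0" by simp
    show "(\<lambda>i. \<nu> (A i)) \<longlonglongrightarrow> 0"
      by (rule tendsto_sandwich[OF _ _ tendsto_const lim])
        (use A(1) le2 in \<open>auto intro!: always_eventually simp: range_subsetD\<close>)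
  qed
  then have emN: "emeasure N A = \<nu> A" if "A \<in> sets borel" for A
    using emeasure_measure_of_sigma[OF B.sigma_algebra_axioms pos _ that] unfolding N_def by blast
  have setsN: "sets N = sets borel"
    unfolding N_def using B.sigma_sets_eq by (simp add: sets_measure_of)
  define MD where "MD = density m (indicator D)"
  have emMD: "emeasure MD A = emeasure m (D \<inter> A)" if "A \<in> sets borel" for A
    unfolding MD_def using that Dm by (intro emeasure_restricted) auto
  have setsMD [measurable_cong]: "sets MD = sets borel" unfolding MD_def by simp
  have spMD: "space MD = UNIV" unfolding MD_def by simp
  interpret MD: finite_measure MD
  proof
    show "emeasure MD (space MD) \<noteq> \<infinity>"
      using emMD[of UNIV] D spMD unfolding fin_borel_def by (simp add: less_top)
  qed
  have "absolutely_continuous MD N"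
    unfolding absolutely_continuous_def
  proof
    fix A assume A: "A \<in> null_sets MD"
    then have Ab: "A \<in> sets borel" using setsMD by (auto simp: null_sets_def)
    have "emeasure m (A \<inter> D) = 0" using A emMD[OF Ab] by (simp add: null_sets_def Int_commute)
    then have "\<nu> A = 0" using le2[OF Ab] by simp
    then show "A \<in> null_sets N" using Ab emN setsN by (simp add: null_sets_def)
  qed
  then obtain f where f: "f \<in> borel_measurable MD" "density MD f = N"
    using MD.Radon_Nikodym setsN setsMD by metis
  have fb' [measurable]: "f \<in> borel_measurable borel"
    using f(1) measurable_cong_sets[OF setsMD refl, of borel] by simp
  have Nint: "(\<integral>\<^sup>+x. f x * indicator A x \<partial>MD) = \<nu> A" if "A \<in> sets borel" for A
    using emeasure_density[OF f(1), of A] f(2) emN[OF that] that setsMD by simp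
  have fle: "AE x in MD. f x \<le> 2"
  proof -
    let ?B = "{x. f x > 2}"
    have Bb [measurable]: "?B \<in> sets borel" by measurable
    have "AE x in MD. f x * indicator ?B x \<le> 2 * indicator ?B x"
    proof (rule ccontr)
      assume n: "\<not> ?thesis"
      have eq: "(\<integral>\<^sup>+x. 2 * indicator ?B x \<partial>MD) = 2 * emeasure MD ?B"
        using setsMD by (subst nn_integral_cmult_indicator) auto
      have "(\<integral>\<^sup>+x. 2 * indicator ?B x \<partial>MD) < (\<integral>\<^sup>+x. f x * indicator ?B x \<partial>MD)"
      proof (rule nn_integral_less[OF _ _ _ _ n])
        show "(\<integral>\<^sup>+x. 2 * indicator ?B x \<partial>MD) \<noteq> \<infinity>"
          unfolding eq using MD.emeasure_finite[of ?B] by (simp add: ennreal_mult_eq_top_iff)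
        show "AE x in MD. 2 * indicator ?B x \<le> f x * indicator ?B x"
          by (intro AE_I2) (auto simp: indicator_def of_bool_def)
      qed (use f(1) setsMD in auto)
      then have "2 * emeasure MD ?B < \<nu> ?B" unfolding eq using Nint[OF Bb] by simp
      then show False using le2[OF Bb] emMD[OF Bb] by (simp add: Int_commute not_less)
    qed
    then show ?thesis
      by eventually_elim (auto simp: indicator_def of_bool_def not_less split: if_splits)
  qed
  define \<phi> where "\<phi> x = enn2real (min (f x) 2) - 1" for x
  have \<phi>m [measurable]: "\<phi> \<in> borel_measurable borel" unfolding \<phi>_def by measurable
  have min2: "min (f x) 2 \<noteq> top" for x
    using le_less_trans[OF min.cobounded2[of "f x" 2], of top] by (simp add: less_top)
  have r: "ennreal (\<phi> x + 1) = min (f x) 2" "0 \<le> \<phi> x + 1" "\<phi> x + 1 \<le> 2" for x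
  proof -
    show "0 \<le> \<phi> x + 1" unfolding \<phi>_def by simp
    show eq: "ennreal (\<phi> x + 1) = min (f x) 2" unfolding \<phi>_def using min2[of x] by (simp add: less_top)
    have "min (f x) 2 \<le> ennreal 2" by simp
    then have "ennreal (\<phi> x + 1) \<le> ennreal 2" unfolding eq .
    then show "\<phi> x + 1 \<le> 2" by (subst (asm) ennreal_le_iff) simp_all
  qed
  have \<phi>1: "\<bar>\<phi> x\<bar> \<le> 1" for x using r(2,3)[of x] by linarith
  have "F A = (\<integral>x. indicator A x * \<phi> x \<partial>m)" if A: "A \<in> sets borel" "A \<subseteq> D" for A
  proof -
    note [measurable] = A(1)
    have Am: "A \<in> sets m" using A by simp
    have fA: "fin_borel A" by (rule fin_borel_subset[OF D A])
    have AD: "A \<inter> D = A" using A by blast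
    have "\<nu> A = (\<integral>\<^sup>+x. min (f x) 2 * indicator A x \<partial>MD)"
      unfolding Nint[OF A(1), symmetric]
      by (intro nn_integral_cong_AE, use fle in eventually_elim) (simp add: min_def)
    also have "\<dots> = (\<integral>\<^sup>+x. indicator D x * (min (f x) 2 * indicator A x) \<partial>m)"
      unfolding MD_def using Am by (intro nn_integral_density) measurable
    also have "\<dots> = (\<integral>\<^sup>+x. ennreal (indicator A x * (\<phi> x + 1)) \<partial>m)"
      using A(2) r(1) by (intro nn_integral_cong) (auto simp: indicator_def of_bool_def)
    finally have \<nu>A: "\<nu> A = (\<integral>\<^sup>+x. ennreal (indicator A x * (\<phi> x + 1)) \<partial>m)" .
    have "(\<integral>x. indicator A x * (\<phi> x + 1) \<partial>m) = enn2real (\<nu> A)"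
      unfolding \<nu>A using Am r(2) by (intro integral_eq_nn_integral) (auto intro!: AE_I2)
    also have "\<dots> = F A + measure m A"
      unfolding \<nu>_def AD using nonneg[OF A(1)] AD by simp
    finally have "(\<integral>x. indicator A x * (\<phi> x + 1) \<partial>m) = F A + measure m A" .
    moreover have "(\<integral>x. indicator A x * (\<phi> x + 1) \<partial>m) = (\<integral>x. indicator A x * \<phi> x \<partial>m) + measure m A"
    proof -
      have "integrable m (\<lambda>x. indicator A x * \<phi> x)" by (rule integrable_fin_borel[OF fA \<phi>m \<phi>1])
      moreover have "integrable m (indicator A :: 'a \<Rightarrow> real)"
        using fA Am unfolding fin_borel_def by simp
      ultimately show ?thesis using Am by (simp add: distrib_left)
    qed
    ultimately show ?thesis by simp
  qed
  then show ?thesis using \<phi>m \<phi>1 by blast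
qed

text \<open>
  The group is cut into Borel pieces of finite measure: \<open>E r n\<close> is the \<open>n\<close>-th piece of the coset
  \<open>r + H\<close> of an open sigma-compact subgroup \<open>H\<close>, where \<open>r\<close> runs through chosen representatives. The
  densities on the pieces are glued. Although there may be uncountably many pieces, a compact set \<open>K\<close> meets
  only finitely many of the open cosets, hence countably many pieces; this makes the glued function
  Borel measurable on \<open>K\<close> and lets \<open>F K\<close> be computed as a limit over finite unions of pieces. A set function
  of this kind is a functional on \<open>L\<^sub>1\<close>, and the lemma replaces the duality of \<open>L\<^sub>1\<close> and \<open>L\<^sub>\<infinity>\<close>.
\<close>

lemma bounded_set_function_density:
  fixes F :: "'a set \<Rightarrow> real"
  assumes lc: "locally_compact_space (euclidean :: 'a topology)"
    and add: "\<And>A B. fin_borel A \<Longrightarrow> fin_borel B \<Longrightarrow> A \<inter> B = {} \<Longrightarrow> F (A \<union> B) = F A + F B"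
    and bound: "\<And>A. fin_borel A \<Longrightarrow> \<bar>F A\<bar> \<le> measure m A"
  shows "\<exists>\<phi>. (\<forall>x. \<bar>\<phi> x\<bar> \<le> 1) \<and> (\<forall>K. compact K \<longrightarrow>
    (\<lambda>x. indicator K x * \<phi> x) \<in> borel_measurable borel \<and> F K = (\<integral>x. indicator K x * \<phi> x \<partial>m))"
proof -
  obtain H where H: "open H" "sigma_compact H" "subgrp (H :: 'a set)"
    using ex_open_sigma_compact_subgroup[OF lc sigma_compact_compact[OF compact_empty]] by blast
  obtain \<C> where \<C>: "countable \<C>" "\<forall>C\<in>\<C>. compact C" "\<Union>\<C> = H"
    using H(2) unfolding sigma_compact_def by blast
  have zH: "0 \<in> H" by (rule subgrp_zero[OF H(3)])
  then have ne: "\<C> \<noteq> {}" using \<C>(3) by blast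
  define C where "C = from_nat_into \<C>"
  have C: "compact (C n)" "(\<Union>n. C n) = H" for n
    unfolding C_def using from_nat_into[OF ne] \<C> range_from_nat_into[OF ne \<C>(1)] by auto
  define D where "D = disjointed C"
  have DH: "(\<Union>n. D n) = H" unfolding D_def by (simp add: UN_disjointed_eq C)
  have Ddisj: "n = k" if "x \<in> D n" "x \<in> D k" for x n k
    using disjoint_family_disjointed[of C] that unfolding D_def disjoint_family_on_def by blast
  define E where "E r n = (+) r ` D n" for r :: 'a and n
  have E: "fin_borel (E r n)" for r n
  proof (rule fin_borel_subset)
    show "fin_borel ((+) r ` C n)" by (intro fin_borel_compact compact_left_translation C)
    show "E r n \<subseteq> (+) r ` C n" unfolding E_def D_def by (intro image_mono disjointed_subset)
    have "D n \<in> sets borel" unfolding D_def disjointed_def using C by auto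
    then show "E r n \<in> sets borel"
      unfolding E_def translation_eq_vimage
      using measurable_sets_borel[of "\<lambda>y. - r + y" borel "D n"]
      by (simp add: borel_measurable_continuous_onI continuous_on_translation)
  qed
  define \<rho> where "\<rho> y = (SOME z. z \<in> (+) y ` H)" for y :: 'a
  have self: "y \<in> (+) y ` H" for y :: 'a using zH by (simp add: mem_translation)
  have \<rho>: "(+) (\<rho> y) ` H = (+) y ` H" for y
  proof (rule coset_eq[OF H(3)])
    show "\<rho> y \<in> (+) y ` H" unfolding \<rho>_def using self[of y] by (rule someI)
  qed
  have \<rho>_cong: "\<rho> y = \<rho> z" if "y \<in> (+) z ` H" for y z
    unfolding \<rho>_def coset_eq[OF H(3) that] by simp
  define N where "N y = (SOME n. y \<in> E (\<rho> y) n)" for y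
  have "\<exists>n. y \<in> E (\<rho> y) n" for y
  proof -
    have "y \<in> (+) (\<rho> y) ` H" using self[of y] by (simp add: \<rho>)
    then show ?thesis unfolding DH[symmetric] E_def by blast
  qed
  then have N: "y \<in> E (\<rho> y) (N y)" for y unfolding N_def by (rule someI_ex)
  have EH: "E r n \<subseteq> (+) r ` H" for r n unfolding E_def DH[symmetric] by blast
  have Euniq: "\<rho> y = \<rho> r" if "y \<in> E r n" for y r n using \<rho>_cong EH that by blast
  have \<rho>\<rho>: "\<rho> (\<rho> y) = \<rho> y" for y
    by (rule \<rho>_cong) (use self[of "\<rho> y"] \<rho> in simp)
  have Euniq2: "n = k" if "y \<in> E r n" "y \<in> E r k" for y r n k
    using that Ddisj unfolding E_def mem_translation by blast
  have "\<forall>r n. \<exists>\<phi>\<in>borel_measurable borel. (\<forall>x. \<bar>\<phi> x\<bar> \<le> 1) \<and>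
    (\<forall>A\<in>sets borel. A \<subseteq> E r n \<longrightarrow> F A = (\<integral>x. indicator A x * \<phi> x \<partial>m))"
    using bounded_set_function_density_finite[OF E add bound] by blast
  then obtain \<Phi> where \<Phi>: "\<And>r n. \<Phi> r n \<in> borel_measurable borel" "\<And>r n x. \<bar>\<Phi> r n x\<bar> \<le> 1"
    "\<And>r n A. A \<in> sets borel \<Longrightarrow> A \<subseteq> E r n \<Longrightarrow> F A = (\<integral>x. indicator A x * \<Phi> r n x \<partial>m)"
    by metis
  define \<phi> where "\<phi> y = \<Phi> (\<rho> y) (N y) y" for y
  have \<phi>1: "\<bar>\<phi> x\<bar> \<le> 1" for x unfolding \<phi>_def by (rule \<Phi>)
  have F0: "F {} = 0" using bound[of "{}"] by (simp add: fin_borel_def)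
  have Fsum: "F (\<Union>i\<in>I. A i) = (\<Sum>i\<in>I. F (A i))"
    if "finite I" "\<And>i. i \<in> I \<Longrightarrow> fin_borel (A i)" "disjoint_family_on A I"
    for I :: "('a \<times> nat) set" and A
    using that
  proof (induction I)
    case (insert i I)
    have "F (A i \<union> (\<Union>i\<in>I. A i)) = F (A i) + F (\<Union>i\<in>I. A i)"
      using insert.prems insert.hyps
      by (intro add fin_borel_UN) (auto simp: disjoint_family_on_def)
    moreover have "disjoint_family_on A I"
      using insert.prems(2) by (rule disjoint_family_on_mono[rotated]) blast
    ultimately show ?case using insert by simp
  qed (simp add: F0)
  have "(\<lambda>x. indicator K x * \<phi> x) \<in> borel_measurable borel \<and> F K = (\<integral>x. indicator K x * \<phi> x \<partial>m)"
    if K: "compact K" for K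
  proof -
    obtain T where T: "T \<subseteq> K" "finite T" "K \<subseteq> (\<Union>y\<in>T. (+) y ` H)"
    proof (rule compactE_image[OF K])
      show "open ((+) y ` H)" for y by (rule open_left_translation[OF H(1)])
      show "K \<subseteq> (\<Union>y\<in>K. (+) y ` H)" using self by (intro subsetI UN_I)
    qed (rule that)
    define I where "I k = \<rho> ` T \<times> {..<k}" for k :: nat
    define A where "A i = K \<inter> E (fst i) (snd i)" for i
    define B where "B k = (\<Union>i\<in>I k. A i)" for k
    have fK: "fin_borel K" by (rule fin_borel_compact[OF K])
    have fA: "fin_borel (A i)" for i
      using E[of "fst i" "snd i"] K by (intro fin_borel_subset[OF fK]) (auto simp: A_def fin_borel_def)
    have finI: "finite (I k)" for k unfolding I_def using T(2) by simp
    have fB: "fin_borel (B k)" for k unfolding B_def by (intro fin_borel_UN finI fA)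
    have BK: "B k \<subseteq> K" for k unfolding B_def A_def by blast
    have uniq: "fst i = \<rho> x \<and> snd i = N x" if "x \<in> A i" "i \<in> I k" for x i k
    proof -
      obtain t where t: "fst i = \<rho> t" using \<open>i \<in> I k\<close> unfolding I_def by auto
      have x: "x \<in> E (fst i) (snd i)" using that(1) unfolding A_def by blast
      have "\<rho> x = fst i" using Euniq[OF x] \<rho>\<rho> t by simp
      then show ?thesis using Euniq2[of x "fst i" "snd i" "N x"] x N[of x] by simp
    qed
    have disj: "disjoint_family_on A (I k)" for k
      unfolding disjoint_family_on_def using uniq prod_eqI by (metis disjoint_iff)
    have xB: "x \<in> B k" if x: "x \<in> K" and k: "N x < k" for x k
    proof -
      obtain t where t: "t \<in> T" "x \<in> (+) t ` H" using T(3) x by blast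
      then have "\<rho> x = \<rho> t" by (intro \<rho>_cong)
      then have "(\<rho> x, N x) \<in> I k" unfolding I_def using t k by simp
      moreover have "x \<in> A (\<rho> x, N x)" unfolding A_def using x N by simp
      ultimately show ?thesis unfolding B_def by blast
    qed
    define s where "s k x = (\<Sum>i\<in>I k. indicator (A i) x * \<Phi> (fst i) (snd i) x)" for k x
    have s_eq: "s k x = indicator (B k) x * \<phi> x" for k x
    proof -
      have "s k x = (\<Sum>i\<in>I k. indicator (A i) x * \<phi> x)"
        unfolding s_def
      proof (rule sum.cong)
        fix i assume "i \<in> I k"
        then show "indicator (A i) x * \<Phi> (fst i) (snd i) x = indicator (A i) x * \<phi> x"
          using uniq[of x i k] unfolding \<phi>_def by (cases "x \<in> A i") auto
      qed simp
      also have "\<dots> = indicator (B k) x * \<phi> x"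
        unfolding sum_distrib_right[symmetric] B_def
        by (subst indicator_UN_disjoint[OF finI disj]) simp
      finally show ?thesis .
    qed
    have intA: "integrable m (\<lambda>x. indicator (A i) x * \<Phi> (fst i) (snd i) x)" for i
      by (rule integrable_fin_borel[OF fA \<Phi>(1,2)])
    have ints: "integrable m (s k)" for k unfolding s_def by (intro Bochner_Integration.integrable_sum intA)
    then have sm: "s k \<in> borel_measurable borel" for k using borel_measurable_integrable by fastforce
    have lim: "(\<lambda>k. s k x) \<longlonglongrightarrow> indicator K x * \<phi> x" for x
    proof (rule tendsto_eventually)
      show "\<forall>\<^sub>F k in sequentially. s k x = indicator K x * \<phi> x"
        using eventually_gt_at_top[of "N x"]
        by eventually_elim (use xB BK in \<open>auto simp: s_eq indicator_def of_bool_def\<close>)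
    qed
    have meas: "(\<lambda>x. indicator K x * \<phi> x) \<in> borel_measurable borel"
      by (rule borel_measurable_LIMSEQ_real[OF lim sm])
    have "(\<integral>x. s k x \<partial>m) = F (B k)" for k
    proof -
      have "(\<integral>x. s k x \<partial>m) = (\<Sum>i\<in>I k. \<integral>x. indicator (A i) x * \<Phi> (fst i) (snd i) x \<partial>m)"
        unfolding s_def by (intro Bochner_Integration.integral_sum intA)
      also have "\<dots> = (\<Sum>i\<in>I k. F (A i))"
        using fA unfolding fin_borel_def by (intro sum.cong refl \<Phi>(3)[symmetric]) (auto simp: A_def)
      also have "\<dots> = F (B k)" unfolding B_def by (rule Fsum[OF finI fA disj, symmetric])
      finally show ?thesis .
    qed
    moreover have "(\<lambda>k. \<integral>x. s k x \<partial>m) \<longlonglongrightarrow> (\<integral>x. indicator K x * \<phi> x \<partial>m)"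
    proof (rule integral_dominated_convergence[where w = "indicator K"])
      show "integrable m (indicator K :: 'a \<Rightarrow> real)" using fK unfolding fin_borel_def by simp
      show "AE x in m. norm (s k x) \<le> indicator K x" for k
        using \<phi>1 BK by (intro AE_I2) (auto simp: s_eq indicator_def of_bool_def)
    qed (use meas sm lim in auto)
    ultimately have lim1: "(\<lambda>k. F (B k)) \<longlonglongrightarrow> (\<integral>x. indicator K x * \<phi> x \<partial>m)" by simp
    have lim0: "(\<lambda>k. measure m (K - B k)) \<longlonglongrightarrow> measure m (\<Inter>k. K - B k)"
    proof (rule Lim_measure_decseq)
      show "range (\<lambda>k. K - B k) \<subseteq> sets m" using fK fB by (auto simp: fin_borel_def)
      have "B k \<subseteq> B l" if "k \<le> l" for k l
        unfolding B_def I_def using that by (intro UN_mono) auto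
      then show "decseq (\<lambda>k. K - B k)" unfolding decseq_def by blast
      show "emeasure m (K - B k) \<noteq> \<infinity>" for k
        using fin_borel_subset[OF fK, of "K - B k"] fK fB[of k] by (auto simp: fin_borel_def)
    qed
    have "(\<Inter>k. K - B k) = {}" using xB lessI by blast
    from lim0[unfolded this measure_empty] have lim0: "(\<lambda>k. measure m (K - B k)) \<longlonglongrightarrow> 0" .
    have "(\<lambda>k. F K - F (B k)) \<longlonglongrightarrow> 0"
    proof (rule tendsto_rabs_zero_cancel, rule tendsto_sandwich[OF _ _ tendsto_const lim0])
      have f': "fin_borel (K - B k)" for k
        using fK fB[of k] by (intro fin_borel_subset[OF fK]) (auto simp: fin_borel_def)
      have "F K - F (B k) = F (K - B k)" for k
      proof -
        have "K = B k \<union> (K - B k)" using BK by blast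
        then have "F K = F (B k \<union> (K - B k))" by simp
        also have "\<dots> = F (B k) + F (K - B k)" by (intro add fB f') auto
        finally show ?thesis by simp
      qed
      then show "\<forall>\<^sub>F k in sequentially. \<bar>F K - F (B k)\<bar> \<le> measure m (K - B k)"
        using bound[OF f'] by simp
    qed simp
    then have "(\<lambda>k. F K - (F K - F (B k))) \<longlonglongrightarrow> F K - 0" by (intro tendsto_diff tendsto_const)
    then have "(\<lambda>k. F (B k)) \<longlonglongrightarrow> F K" by simp
    then have "F K = (\<integral>x. indicator K x * \<phi> x \<partial>m)" using lim1 LIMSEQ_unique by blast
    then show ?thesis using meas by blast
  qed
  then show ?thesis using \<phi>1 by blast
qed

end

section \<open>Layers of simple functions\<close>

text \<open>
  The distance of a level \<open>t\<close> to the next lower one, \<open>0\<close> counting as a level. With these weights a simple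
  function with values in \<open>T \<union> {0}\<close> is the sum of the indicators of its level sets.
\<close>

definition gap :: "real set \<Rightarrow> real \<Rightarrow> real" where
  "gap T t = t - Max (insert 0 {s\<in>T. s < t})"

lemma gap_nonneg: "finite T \<Longrightarrow> 0 < t \<Longrightarrow> 0 \<le> gap T t"
  unfolding gap_def by (auto intro: less_imp_le)

lemma gap_sum:
  assumes "finite T" and "T \<subseteq> {0<..}" and "u \<in> insert 0 T"
  shows "(\<Sum>t\<in>T. gap T t * of_bool (t \<le> u)) = u"
  using assms
proof (induction T arbitrary: u rule: finite_linorder_max_induct)
  case (insert b A)
  let ?M = "Max (insert 0 A)"
  have b0: "0 < b" and A0: "A \<subseteq> {0<..}" using insert.prems by auto
  have bA: "b \<notin> A" using insert.hyps(2) by blast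
  have gapA: "gap (insert b A) t = gap A t" if "t \<in> A" for t
  proof -
    have "{s \<in> insert b A. s < t} = {s \<in> A. s < t}" using insert.hyps(2) that by fastforce
    then show ?thesis unfolding gap_def by simp
  qed
  have gapb: "gap (insert b A) b = b - ?M"
  proof -
    have "{s \<in> insert b A. s < b} = A" using insert.hyps(2) by auto
    then show ?thesis unfolding gap_def by simp
  qed
  have split: "(\<Sum>t\<in>insert b A. gap (insert b A) t * of_bool (t \<le> u))
    = (b - ?M) * of_bool (b \<le> u) + (\<Sum>t\<in>A. gap A t * of_bool (t \<le> u))"
    using insert.hyps(1) bA gapA gapb by (simp add: sum.insert)
  show ?case
  proof (cases "u = b")
    case True
    have "(\<Sum>t\<in>A. gap A t * of_bool (t \<le> u)) = (\<Sum>t\<in>A. gap A t * of_bool (t \<le> ?M))"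
      using insert.hyps True by (intro sum.cong) (auto simp: less_imp_le)
    also have "\<dots> = ?M" using insert.hyps(1) A0 Max_in[of "insert 0 A"] by (intro insert.IH) auto
    finally show ?thesis unfolding split using True by simp
  next
    case False
    then have u: "u \<in> insert 0 A" using insert.prems by blast
    then have "\<not> b \<le> u" using insert.hyps(2) b0 by auto
    then show ?thesis unfolding split using insert.IH[OF A0 u] by simp
  qed
qed simp

text \<open>
  No cancellation occurs between layers, because the level sets are nested. This makes the \<open>L\<^sub>1\<close> distance of
  a function to its translate the sum of the distances of its layers to theirs.
\<close>

lemma gap_sum_abs_diff:
  assumes "finite T" and "T \<subseteq> {0<..}" and "u \<in> insert 0 T" and "v \<in> insert 0 T"
  shows "(\<Sum>t\<in>T. gap T t * \<bar>of_bool (t \<le> u) - of_bool (t \<le> v)\<bar>) = \<bar>u - v\<bar>"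
proof -
  have "(\<Sum>t\<in>T. gap T t * \<bar>of_bool (t \<le> u) - of_bool (t \<le> v)\<bar>) = v - u"
    if "u \<le> v" "u \<in> insert 0 T" "v \<in> insert 0 T" for u v
  proof -
    have "(\<Sum>t\<in>T. gap T t * \<bar>of_bool (t \<le> u) - of_bool (t \<le> v)\<bar>)
      = (\<Sum>t\<in>T. gap T t * of_bool (t \<le> v) - gap T t * of_bool (t \<le> u))"
      using that(1) by (intro sum.cong) auto
    then show ?thesis using gap_sum[OF assms(1,2)] that by (simp add: sum_subtractf)
  qed
  from this[of u v] this[of v u] show ?thesis
    using assms by (cases "u \<le> v") (simp_all add: abs_minus_commute)
qed

text \<open>
  Nonnegative simple functions that are upper semicontinuous with compact support off \<open>S\<close>: nonnegative
  combinations of indicators of compact sets disjoint from \<open>S\<close>. They form a convex cone, and their level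
  sets at positive levels are compact, as sets in a Foelner net have to be.
\<close>

definition cpt_simple :: "'a::topological_space set \<Rightarrow> ('a \<Rightarrow> real) set" where
  "cpt_simple S = {f. finite (range f) \<and> (\<forall>x. 0 \<le> f x) \<and> (\<forall>t>0. compact {x. t \<le> f x}) \<and>
     (\<forall>x\<in>S. f x = 0)}"

lemma cpt_simple_add:
  fixes f g :: "'a::t2_space \<Rightarrow> real"
  assumes f: "f \<in> cpt_simple S" and g: "g \<in> cpt_simple S"
  shows "(\<lambda>x. f x + g x) \<in> cpt_simple S"
proof -
  let ?I = "\<lambda>t. {(a, b). a \<in> range f \<and> b \<in> range g \<and> t \<le> a + b}"
  have fin: "finite (range f)" "finite (range g)"
    and ge: "\<And>x. 0 \<le> f x" "\<And>x. 0 \<le> g x"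
    and cf: "\<And>t. 0 < t \<Longrightarrow> compact {x. t \<le> f x}" and cg: "\<And>t. 0 < t \<Longrightarrow> compact {x. t \<le> g x}"
    using f g unfolding cpt_simple_def by auto
  have "compact {x. t \<le> f x + g x}" if t: "0 < t" for t
  proof -
    have "{x. t \<le> f x + g x} = (\<Union>(a, b)\<in>?I t. {x. a \<le> f x} \<inter> {x. b \<le> g x})"
      by fastforce
    moreover have "finite (?I t)"
      by (rule finite_subset[of _ "range f \<times> range g"]) (use fin in auto)
    moreover have "compact ({x. a \<le> f x} \<inter> {x. b \<le> g x})" if ab: "(a, b) \<in> ?I t" for a b
    proof -
      have ab0: "0 \<le> a" "0 \<le> b" using ab ge by auto
      consider "a = 0" "0 < b" | "b = 0" "0 < a" | "0 < a" "0 < b"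
        using ab0 ab t by fastforce
      then show ?thesis
      proof cases
        case 1
        then have "{x. a \<le> f x} = UNIV" using ge by simp
        then show ?thesis using cg[OF 1(2)] by simp
      next
        case 2
        then have "{x. b \<le> g x} = UNIV" using ge by simp
        then show ?thesis using cf[OF 2(2)] by simp
      next
        case 3
        then show ?thesis by (intro compact_Int cf cg)
      qed
    qed
    ultimately show ?thesis by (auto intro!: compact_UN)
  qed
  moreover have "finite (range (\<lambda>x. f x + g x))"
    by (rule finite_subset[of _ "(\<lambda>(a, b). a + b) ` (range f \<times> range g)"]) (use fin in auto)
  ultimately show ?thesis using f g unfolding cpt_simple_def by auto
qed

lemma cpt_simple_zero: "(\<lambda>x. 0) \<in> cpt_simple S"
  unfolding cpt_simple_def by (auto simp: not_le[symmetric])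

lemma cpt_simple_cmult:
  assumes f: "f \<in> cpt_simple S" and r: "0 \<le> r"
  shows "(\<lambda>x. r * f x) \<in> cpt_simple S"
proof (cases "r = 0")
  case True
  then show ?thesis by (simp add: cpt_simple_zero)
next
  case False
  then have r: "0 < r" using r by simp
  have "{x. t \<le> r * f x} = {x. t / r \<le> f x}" for t using r by (auto simp: field_simps)
  moreover have "finite (range (\<lambda>x. r * f x))"
    using f finite_imageI[of "range f" "(*) r"] unfolding cpt_simple_def by (simp add: image_image)
  ultimately show ?thesis using f r unfolding cpt_simple_def by auto
qed

lemma cpt_simple_indicator:
  assumes "compact B" and "B \<inter> S = {}"
  shows "indicator B \<in> cpt_simple S"
proof -
  have "{x. t \<le> (indicator B x :: real)} = (if t \<le> 1 then B else {})" if "0 < t" for t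
    using that by (auto simp: indicator_def of_bool_def split: if_splits)
  moreover have "range (indicator B :: 'a \<Rightarrow> real) \<subseteq> {0, 1}" by (auto simp: indicator_def of_bool_def)
  then have "finite (range (indicator B :: 'a \<Rightarrow> real))" by (rule finite_subset) simp
  ultimately show ?thesis using assms unfolding cpt_simple_def by (auto simp: indicator_def of_bool_def)
qed

abbreviation levels :: "('a \<Rightarrow> real) \<Rightarrow> real set" where "levels f \<equiv> range f - {0}"

lemma cpt_simple_levels:
  assumes "f \<in> cpt_simple S"
  shows "finite (levels f)" "levels f \<subseteq> {0<..}" "f x \<in> insert 0 (levels f)"
    "t \<in> levels f \<Longrightarrow> compact {x. t \<le> f x}" "t \<in> levels f \<Longrightarrow> {x. t \<le> f x} \<inter> S = {}"
proof -
  have f: "finite (range f)" "\<And>x. 0 \<le> f x" "\<And>t. 0 < t \<Longrightarrow> compact {x. t \<le> f x}" "\<And>x. x \<in> S \<Longrightarrow> f x = 0"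
    using assms unfolding cpt_simple_def by auto
  show "finite (levels f)" "f x \<in> insert 0 (levels f)" using f(1) by auto
  show sub: "levels f \<subseteq> {0<..}" 
  proof
    fix t assume "t \<in> levels f"
    then obtain x where "t = f x" "f x \<noteq> 0" by blast
    then show "t \<in> {0<..}" using f(2)[of x] by simp
  qed
  show "compact {x. t \<le> f x}" if "t \<in> levels f" using sub that by (intro f(3)) auto
  show "{x. t \<le> f x} \<inter> S = {}" if "t \<in> levels f"
  proof -
    have "0 < t" using sub that by auto
    then show ?thesis using f(4) by force
  qed
qed

lemma cpt_simple_layers:
  assumes "f \<in> cpt_simple S"
  shows "f x = (\<Sum>t\<in>levels f. gap (levels f) t * indicator {y. t \<le> f y} x)"
  using gap_sum[OF cpt_simple_levels(1-3)[OF assms], of x] by (simp add: indicator_def)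

context haar
begin

lemma cpt_simple_integrable:
  assumes f: "f \<in> cpt_simple S"
  shows "integrable m f" "f \<in> borel_measurable borel"
    "(\<integral>x. f x \<partial>m) = (\<Sum>t\<in>levels f. gap (levels f) t * measure m {x. t \<le> f x})"
proof -
  let ?g = "\<lambda>t x. gap (levels f) t * indicator {y. t \<le> f y} x"
  have L: "f = (\<lambda>x. \<Sum>t\<in>levels f. ?g t x)" by (rule ext) (rule cpt_simple_layers[OF f])
  have int: "integrable m (?g t)" if "t \<in> levels f" for t
    using cpt_simple_levels(4)[OF f that] emeasure_compact by simp
  show I: "integrable m f" by (subst L) (rule Bochner_Integration.integrable_sum[OF int])
  show "f \<in> borel_measurable borel" using borel_measurable_integrable[OF I] by simp
  have "(\<integral>x. f x \<partial>m) = (\<Sum>t\<in>levels f. \<integral>x. ?g t x \<partial>m)"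
    by (subst L) (rule Bochner_Integration.integral_sum[OF int])
  then show "(\<integral>x. f x \<partial>m) = (\<Sum>t\<in>levels f. gap (levels f) t * measure m {x. t \<le> f x})"
    using cpt_simple_levels(4)[OF f] by simp
qed

lemma measure_M: "A \<in> sets borel \<Longrightarrow> measure M A = measure m A"
  unfolding measure_def by simp

lemma cpt_simple_integral_over:
  assumes f: "f \<in> cpt_simple S" and E: "locally_measurable_set m E"
  shows "integrable M (\<lambda>x. indicator E x * f x)"
    "(\<integral>x. indicator E x * f x \<partial>M) = (\<Sum>t\<in>levels f. gap (levels f) t * measure M (E \<inter> {x. t \<le> f x}))"
proof -
  let ?g = "\<lambda>t x. gap (levels f) t * indicator (E \<inter> {y. t \<le> f y}) x"
  have "indicator E x * f x = (\<Sum>t\<in>levels f. ?g t x)" for x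
    by (subst cpt_simple_layers[OF f, of x])
      (auto simp: sum_distrib_left indicator_def of_bool_def intro!: sum.cong)
  then have L: "(\<lambda>x. indicator E x * f x) = (\<lambda>x. \<Sum>t\<in>levels f. ?g t x)" by (rule ext)
  have sets: "E \<inter> {x. t \<le> f x} \<in> sets M" if "t \<in> levels f" for t
    using E cpt_simple_levels(4)[OF f that] unfolding locally_measurable_set_def by blast
  have "emeasure M (E \<inter> {x. t \<le> f x}) < \<infinity>" if "t \<in> levels f" for t
  proof -
    have "emeasure M (E \<inter> {x. t \<le> f x}) \<le> emeasure M {x. t \<le> f x}"
      using cpt_simple_levels(4)[OF f that] by (intro emeasure_mono) auto
    also have "\<dots> < \<infinity>" using emeasure_compact[OF cpt_simple_levels(4)[OF f that]]
        cpt_simple_levels(4)[OF f that] by simp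
    finally show ?thesis .
  qed
  then have int: "integrable M (?g t)" if "t \<in> levels f" for t
    using that sets by simp
  show "integrable M (\<lambda>x. indicator E x * f x)"
    unfolding L by (rule Bochner_Integration.integrable_sum[OF int])
  have "(\<integral>x. indicator E x * f x \<partial>M) = (\<Sum>t\<in>levels f. \<integral>x. ?g t x \<partial>M)"
    unfolding L by (rule Bochner_Integration.integral_sum[OF int])
  then show "(\<integral>x. indicator E x * f x \<partial>M)
      = (\<Sum>t\<in>levels f. gap (levels f) t * measure M (E \<inter> {x. t \<le> f x}))"
    using sets by (simp del: space_completion)
qed

lemma borel_measurable_translation:
  "g \<in> borel_measurable borel \<Longrightarrow> (\<lambda>y. g (x + y)) \<in> borel_measurable borel" for x :: 'a
  by (rule measurable_compose[of "(+) x" _ borel])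
    (simp_all add: borel_measurable_continuous_onI continuous_on_translation)

lemma distr_translation: "distr m m ((+) x) = m"
proof (rule measure_eqI)
  fix A assume "A \<in> sets (distr m m ((+) x))"
  then have A: "A \<in> sets borel" by simp
  have "(+) x -` A = (+) (- x) ` A" unfolding translation_eq_vimage by simp
  moreover have "(+) x \<in> measurable m m"
    by (subst measurable_cong_sets[OF sets_m sets_m])
      (simp add: borel_measurable_continuous_onI continuous_on_translation)
  ultimately show "emeasure (distr m m ((+) x)) A = emeasure m A"
    using A emeasure_translation[OF A, of "- x"] by (simp add: emeasure_distr)
qed simp

lemma integral_translation:
  fixes g :: "'a \<Rightarrow> real"
  assumes "g \<in> borel_measurable borel"
  shows "(\<integral>y. g (x + y) \<partial>m) = (\<integral>y. g y \<partial>m)"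
proof -
  have "(+) x \<in> measurable m m"
    by (subst measurable_cong_sets[OF sets_m sets_m])
      (simp add: borel_measurable_continuous_onI continuous_on_translation)
  then have "(\<integral>y. g y \<partial>distr m m ((+) x)) = (\<integral>y. g (x + y) \<partial>m)"
    using assms by (intro integral_distr) auto
  then show ?thesis unfolding distr_translation by simp
qed

lemma cpt_simple_translate:
  fixes f :: "'a \<Rightarrow> real"
  assumes f: "f \<in> cpt_simple S"
  shows "(\<lambda>y. f (x + y)) \<in> cpt_simple {}"
proof -
  have "{y. t \<le> f (x + y)} = (+) (- x) ` {y. t \<le> f y}" for t
    unfolding translation_eq_vimage by auto
  moreover have "finite (range (\<lambda>y. f (x + y)))"
    by (rule finite_subset[of _ "range f"]) (use f in \<open>auto simp: cpt_simple_def\<close>)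
  ultimately show ?thesis
    using f unfolding cpt_simple_def by (auto intro!: compact_left_translation)
qed

lemma cpt_simple_translation_norm:
  assumes f: "f \<in> cpt_simple S"
  shows "(\<integral>y. \<bar>f (- x + y) - f y\<bar> \<partial>m) =
    (\<Sum>t\<in>levels f. gap (levels f) t * measure m (sym_diff ((+) x ` {y. t \<le> f y}) {y. t \<le> f y}))"
proof -
  let ?D = "\<lambda>t. sym_diff ((+) x ` {y. t \<le> f y}) {y. t \<le> f y}"
  have D: "\<bar>of_bool (t \<le> f (- x + y)) - of_bool (t \<le> f y)\<bar> = (indicator (?D t) y :: real)" for t y
    by (cases "t \<le> f (- x + y)"; cases "t \<le> f y") (simp_all add: mem_translation)
  have "\<bar>f (- x + y) - f y\<bar> = (\<Sum>t\<in>levels f. gap (levels f) t * indicator (?D t) y)" for y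
    by (subst gap_sum_abs_diff[OF cpt_simple_levels(1-3)[OF f] cpt_simple_levels(3)[OF f], symmetric])
      (simp only: D)
  then have L: "(\<lambda>y. \<bar>f (- x + y) - f y\<bar>) = (\<lambda>y. \<Sum>t\<in>levels f. gap (levels f) t * indicator (?D t) y)"
    by (rule ext)
  have fb: "fin_borel (?D t)" if "t \<in> levels f" for t
  proof -
    have c: "compact {y. t \<le> f y}" by (rule cpt_simple_levels(4)[OF f that])
    show ?thesis
      by (rule fin_borel_subset[of "((+) x ` {y. t \<le> f y}) \<union> {y. t \<le> f y}"])
        (use c compact_left_translation[OF c, of x] in \<open>auto intro!: fin_borel_compact\<close>)
  qed
  have int: "integrable m (\<lambda>y. gap (levels f) t * indicator (?D t) y)" if "t \<in> levels f" for t
    using fb[OF that] unfolding fin_borel_def by simp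
  have "(\<integral>y. \<bar>f (- x + y) - f y\<bar> \<partial>m) = (\<Sum>t\<in>levels f. \<integral>y. gap (levels f) t * indicator (?D t) y \<partial>m)"
    unfolding L by (rule Bochner_Integration.integral_sum[OF int])
  then show ?thesis using fb unfolding fin_borel_def by simp
qed

text \<open>
  Inner regularity is only given for open sets; inside a compact set it follows from outer regularity of the
  complement.
\<close>

lemma ex_compact_subset_pos:
  assumes A: "A \<in> sets M" and AC: "A \<subseteq> C" and C: "compact C" and pos: "emeasure M A \<noteq> 0"
  shows "\<exists>B\<subseteq>A. compact B \<and> 0 < measure m B"
proof -
  let ?A = "main_part m A"
  have A': "?A \<in> sets borel" "?A \<subseteq> A" "emeasure m ?A \<noteq> 0"
  proof -
    show "?A \<in> sets borel" using main_part_sets[OF A] by simp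
    show "?A \<subseteq> A" using main_part_null_part_Un[OF A] by blast
    show "emeasure m ?A \<noteq> 0" using pos A by simp
  qed
  have fC: "fin_borel C" by (rule fin_borel_compact[OF C])
  have Cb: "C \<in> sets borel" using C by simp
  have fA: "fin_borel ?A" "fin_borel (C - ?A)"
    using A' AC Cb by (auto intro!: fin_borel_subset[OF fC])
  have "measure m C = measure m (C - ?A) + measure m ?A"
  proof -
    have "C = (C - ?A) \<union> ?A" using A'(2) AC by blast
    then have "measure m C = measure m ((C - ?A) \<union> ?A)" by simp
    also have "\<dots> = measure m (C - ?A) + measure m ?A"
      by (rule measure_Union) (use fA in \<open>auto simp: fin_borel_def\<close>)
    finally show ?thesis .
  qed
  moreover have "measure m ?A \<noteq> 0" using A'(3) fin_borel_emeasure[OF fA(1)] by auto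
  then have "0 < measure m ?A" by (simp add: order_less_le)
  ultimately have "emeasure m (C - ?A) < emeasure m C"
    unfolding fin_borel_emeasure[OF fC] fin_borel_emeasure[OF fA(2)] by (simp add: ennreal_less_iff)
  moreover have "C - ?A \<in> sets borel" using Cb A' by auto
  ultimately obtain U where U: "open U" "C - ?A \<subseteq> U" "emeasure m U < emeasure m C"
    unfolding outer_regular[OF \<open>C - ?A \<in> sets borel\<close>] INF_less_iff by auto
  have B: "compact (C - U)" using C U(1) by (rule compact_diff)
  have "0 < measure m (C - U)"
  proof (rule ccontr)
    assume "\<not> ?thesis"
    then have "measure m (C - U) = 0" by (simp add: order_less_le)
    then have "emeasure m (C - U) = 0" using fin_borel_emeasure[OF fin_borel_compact[OF B]] by simp
    moreover have "emeasure m C \<le> emeasure m (U \<union> (C - U))"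
      using U(1) borel_open[OF U(1)] compact_in_borel[OF B] by (intro emeasure_mono) (auto simp del: Un_Diff_cancel)
    moreover have "\<dots> \<le> emeasure m U + emeasure m (C - U)"
      using U(1) B by (intro emeasure_subadditive) auto
    ultimately show False using U(3) by simp
  qed
  then show ?thesis using B U(2) A'(2) AC by blast
qed

end

section \<open>Almost invariant densities\<close>

text \<open>
  Families of \<open>L\<^sub>1\<close> functions, indexed by group elements, are treated as vectors.
\<close>

instantiation "fun" :: (type, real_vector) real_vector
begin

definition scaleR_fun_def: "r *\<^sub>R f = (\<lambda>x. r *\<^sub>R f x)"

instance
  by standard (simp_all add: scaleR_fun_def fun_eq_iff scaleR_add_right scaleR_add_left)

end

lemma scaleR_fun_apply [simp]: "(r *\<^sub>R f) x = r *\<^sub>R f x"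
  by (simp add: scaleR_fun_def)

lemma sum_fun_apply: "(\<Sum>i\<in>I. g i) x = (\<Sum>i\<in>I. g i x)"
  by (induction I rule: infinite_finite_induct) simp_all

context haar
begin

lemma Linf_locally_borel:
  assumes "\<And>x. \<bar>\<phi> x\<bar> \<le> b"
    and "\<And>K. compact K \<Longrightarrow> (\<lambda>x. indicator K x * \<phi> x) \<in> borel_measurable borel"
  shows "\<phi> \<in> Linf m"
proof (rule LinfI)
  fix K :: "'a set" assume "compact K"
  then show "(\<lambda>x. indicator K x * \<phi> x) \<in> borel_measurable M"
    by (intro measurable_completion) (simp add: assms(2))
qed (rule assms(1))

lemma translate_locally_borel:
  assumes "\<And>K. compact K \<Longrightarrow> (\<lambda>x. indicator K x * \<phi> x) \<in> borel_measurable borel" and K: "compact K"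
  shows "(\<lambda>y. indicator K y * \<phi> (x + y) :: real) \<in> borel_measurable borel"
    and "(\<integral>y. indicator K y * \<phi> (x + y) \<partial>m) = (\<integral>y. indicator ((+) x ` K) y * \<phi> y \<partial>m)"
proof -
  have g: "(\<lambda>y. indicator ((+) x ` K) y * \<phi> y) \<in> borel_measurable borel"
    by (intro assms(1) compact_left_translation K)
  have eq: "indicator ((+) x ` K) (x + y) * \<phi> (x + y) = indicator K y * \<phi> (x + y)" for y
    by (simp add: indicator_def mem_translation add.assoc[symmetric])
  show "(\<lambda>y. indicator K y * \<phi> (x + y) :: real) \<in> borel_measurable borel"
    using borel_measurable_translation[OF g, of x] unfolding eq .
  show "(\<integral>y. indicator K y * \<phi> (x + y) \<partial>m) = (\<integral>y. indicator ((+) x ` K) y * \<phi> y \<partial>m)"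
    using integral_translation[OF g, of x] unfolding eq .
qed

text \<open>
  Otherwise \<open>h < \<delta>\<close> on a compact set of positive measure off \<open>H\<close>, whose integral is then too small.
\<close>

lemma locally_null_below:
  assumes h: "h \<in> Linf m" and H: "H \<in> sets borel"
    and int: "\<And>B. compact B \<Longrightarrow> B \<inter> H = {} \<Longrightarrow> \<delta> * measure m B \<le> (\<integral>y. indicator B y * h y \<partial>M)"
  shows "locally_null_set m {y. y \<notin> H \<and> h y < \<delta>}"
  unfolding locally_null_set_def
proof (intro allI impI)
  fix C :: "'a set" assume C: "compact C"
  let ?A = "{y. y \<notin> H \<and> h y < \<delta>} \<inter> C"
  have "h -` {..<\<delta>} \<inter> C \<in> sets M"
    using h C unfolding Linf_def locally_measurable_fun_def locally_measurable_set_def by simp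
  then have "(h -` {..<\<delta>} \<inter> C) - H \<in> sets M" by (rule sets.Diff[OF _ borel_in_M[OF H]])
  also have "(h -` {..<\<delta>} \<inter> C) - H = ?A" by auto
  finally have A: "?A \<in> sets M" .
  have "emeasure M ?A = 0"
  proof (rule ccontr)
    assume "emeasure M ?A \<noteq> 0"
    then obtain B where B: "B \<subseteq> ?A" "compact B" "0 < measure m B"
      using ex_compact_subset_pos[OF A _ C] by blast
    have BM: "B \<in> sets M" using B(2) by (intro borel_in_M compact_in_borel)
    have mB: "measure M B = measure m B" by (rule measure_M[OF compact_in_borel[OF B(2)]])
    have I: "integrable M (\<lambda>y. indicator B y * h y)" by (rule Linf_integrable[OF h B(2)])
    have I': "integrable M (\<lambda>y. indicator B y * \<delta>)" by (rule Linf_integrable[OF Linf_const B(2)])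
    have I2: "integrable M (\<lambda>y. indicator B y * \<delta> - indicator B y * h y)"
      using I I' by (rule Bochner_Integration.integrable_diff[rotated])
    have nonneg: "0 \<le> indicator B y * \<delta> - indicator B y * h y" for y
      using B(1) by (auto simp: indicator_def of_bool_def)
    have "(\<integral>y. indicator B y * \<delta> - indicator B y * h y \<partial>M)
      = \<delta> * measure m B - (\<integral>y. indicator B y * h y \<partial>M)"
      using Bochner_Integration.integral_diff[OF I' I] BM mB by (simp add: mult.commute)
    also have "\<dots> \<le> 0" using int[OF B(2)] B(1) by auto
    finally have "(\<integral>y. indicator B y * \<delta> - indicator B y * h y \<partial>M) = 0"
      using integral_nonneg_AE[of "\<lambda>y. indicator B y * \<delta> - indicator B y * h y" M] nonneg by simp
    then have "AE y in M. indicator B y * \<delta> - indicator B y * h y = 0"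
      using integral_nonneg_eq_0_iff_AE[OF I2] nonneg by simp
    then have "AE y in M. y \<notin> B"
      by eventually_elim (use B(1) in \<open>auto simp: indicator_def of_bool_def split: if_splits\<close>)
    then have "B \<in> null_sets M" using BM by (simp add: AE_iff_null_sets)
    then have "measure M B = 0" by (simp add: null_sets_def measure_def)
    then show False using B(3) mB by simp
  qed
  then show "?A \<in> null_sets M" using A by (simp add: null_sets_def)
qed

text \<open>
  This is the step from weak to norm convergence due to Namioka. If no density \<open>f\<close> off \<open>H\<close> were almost
  invariant with approximately the right integrals over the members of \<open>P\<close>, Hahn-Banach would give a
  functional on \<open>L\<^sub>1\<^sup>X \<times> \<real>\<^sup>P\<close> that separates, uniformly by \<open>\<delta>\<close>, the defects of all densities from \<open>0\<close>. Its
  components are integration against functions \<open>\<phi> x\<close> in \<open>L\<^sub>\<infinity>\<close> and scalars. Moving the translations from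
  densities to the \<open>\<phi> x\<close>, the separation says that the function \<open>h\<close>, a sum of differences
  of a \<open>\<phi> x\<close> and its translate and of multiples of \<open>indicator E - \<mu> (indicator E)\<close>, is at
  least \<open>\<delta>\<close> almost everywhere off \<open>H\<close>. But \<open>\<mu> h = 0\<close> by invariance, while \<open>H\<close> does not count for \<open>\<mu>\<close>.
\<close>

lemma almost_invariant_density:
  assumes lc: "locally_compact_space (euclidean :: 'a topology)"
    and \<mu>: "\<mu> \<in> LIMeans m" and H: "H \<in> sets borel" "\<mu> (indicator H) = 0"
    and X: "finite X" and P: "finite P" "\<And>E. E \<in> P \<Longrightarrow> locally_measurable_set m E"
    and \<delta>: "0 < \<delta>"
  shows "\<exists>f\<in>cpt_simple H. (\<Sum>x\<in>X. \<integral>y. \<bar>f (- x + y) - f y\<bar> \<partial>m) +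
     (\<Sum>E\<in>P. \<bar>(\<integral>y. indicator E y * f y \<partial>M) - \<mu> (indicator E) * (\<integral>y. f y \<partial>m)\<bar>)
     < \<delta> * (\<integral>y. f y \<partial>m)"
proof (rule ccontr)
  assume contra: "\<not> ?thesis"
  have \<mu>': "\<mu> \<in> means m" using \<mu> unfolding LIMeans_def by blast
  \<comment> \<open>The seminorm \<open>p\<close> lives on \<open>W\<close>; the defects of a density \<open>f\<close> are the components of \<open>\<Lambda> f\<close>.\<close>
  define W :: "(('a \<Rightarrow> 'a \<Rightarrow> real) \<times> ('a set \<Rightarrow> real)) set"
    where "W = {v. \<forall>x\<in>X. integrable m (fst v x)}"
  define p where "p v = (\<Sum>x\<in>X. \<integral>y. \<bar>fst v x y\<bar> \<partial>m) + (\<Sum>E\<in>P. \<bar>snd v E\<bar>)"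
    for v :: "('a \<Rightarrow> 'a \<Rightarrow> real) \<times> ('a set \<Rightarrow> real)"
  define \<Lambda> :: "('a \<Rightarrow> real) \<Rightarrow> ('a \<Rightarrow> 'a \<Rightarrow> real) \<times> ('a set \<Rightarrow> real)" where
    "\<Lambda> f = ((\<lambda>x y. f (- x + y) - f y),
      (\<lambda>E. (\<integral>y. indicator E y * f y \<partial>M) * of_bool (E \<in> P) - \<mu> (indicator E) * (\<integral>y. f y \<partial>m)))" for f
  define C where "C = (\<lambda>f. (\<Lambda> f, \<delta> * (\<integral>y. f y \<partial>m))) ` cpt_simple H"
  have W: "subspace W"
    unfolding subspace_def W_def
    by (auto simp: plus_fun_def zero_fun_def scaleR_fun_def)
  note Wadd = subspace_add[OF W] and Wsc = subspace_scale[OF W] and Wneg = subspace_neg[OF W]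
  have p_add: "p (u + v) \<le> p u + p v" if "u \<in> W" "v \<in> W" for u v
  proof -
    have "(\<integral>y. \<bar>fst (u + v) x y\<bar> \<partial>m) \<le> (\<integral>y. \<bar>fst u x y\<bar> \<partial>m) + (\<integral>y. \<bar>fst v x y\<bar> \<partial>m)" if "x \<in> X" for x
    proof -
      have i: "integrable m (fst u x)" "integrable m (fst v x)"
        using \<open>u \<in> W\<close> \<open>v \<in> W\<close> that unfolding W_def by auto
      have "(\<integral>y. \<bar>fst (u + v) x y\<bar> \<partial>m) \<le> (\<integral>y. \<bar>fst u x y\<bar> + \<bar>fst v x y\<bar> \<partial>m)"
        using i by (intro integral_mono) auto
      then show ?thesis using i by simp
    qed
    then have "(\<Sum>x\<in>X. \<integral>y. \<bar>fst (u + v) x y\<bar> \<partial>m)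
      \<le> (\<Sum>x\<in>X. (\<integral>y. \<bar>fst u x y\<bar> \<partial>m) + (\<integral>y. \<bar>fst v x y\<bar> \<partial>m))" by (rule sum_mono)
    moreover have "(\<Sum>E\<in>P. \<bar>snd (u + v) E\<bar>) \<le> (\<Sum>E\<in>P. \<bar>snd u E\<bar> + \<bar>snd v E\<bar>)"
      by (rule sum_mono) simp
    ultimately show ?thesis unfolding p_def sum.distrib by linarith
  qed
  have p_scale: "p (c *\<^sub>R v) = c * p v" if "0 \<le> c" for c v
    unfolding p_def using that by (simp add: abs_mult distrib_left sum_distrib_left)
  have int_E: "integrable M (\<lambda>y. indicator E y * f y)" if "E \<in> P" "f \<in> cpt_simple H" for E f
    using cpt_simple_integral_over(1)[OF that(2) P(2)[OF that(1)]] .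
  have \<Lambda>W: "\<Lambda> f \<in> W" if f: "f \<in> cpt_simple H" for f
    unfolding W_def \<Lambda>_def
    using cpt_simple_integrable(1)[OF f] cpt_simple_integrable(1)[OF cpt_simple_translate[OF f]] by auto
  have \<Lambda>add: "\<Lambda> (\<lambda>y. f y + g y) = \<Lambda> f + \<Lambda> g"
    if f: "f \<in> cpt_simple H" and g: "g \<in> cpt_simple H" for f g
  proof (intro prod_eqI ext)
    have i1: "(\<integral>y. indicator E y * (f y + g y) \<partial>M)
      = (\<integral>y. indicator E y * f y \<partial>M) + (\<integral>y. indicator E y * g y \<partial>M)" if "E \<in> P" for E
      using int_E[OF that f] int_E[OF that g] by (simp add: distrib_left)
    have i2: "(\<integral>y. f y + g y \<partial>m) = (\<integral>y. f y \<partial>m) + (\<integral>y. g y \<partial>m)"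
      using cpt_simple_integrable(1)[OF f] cpt_simple_integrable(1)[OF g] by simp
    show "snd (\<Lambda> (\<lambda>y. f y + g y)) E = snd (\<Lambda> f + \<Lambda> g) E" for E
      unfolding \<Lambda>_def i2 by (cases "E \<in> P") (simp_all add: i1, simp_all add: ring_distribs(1))
  qed (simp add: \<Lambda>_def)
  have \<Lambda>sc: "\<Lambda> (\<lambda>y. r * f y) = r *\<^sub>R \<Lambda> f" for f r
    unfolding \<Lambda>_def by (auto simp: fun_eq_iff algebra_simps)
  have Cp: "s \<le> p c" if cs: "(c, s) \<in> C" for c s
  proof -
    obtain f where f: "f \<in> cpt_simple H" "c = \<Lambda> f" "s = \<delta> * (\<integral>y. f y \<partial>m)"
      using cs unfolding C_def by blast
    have "p (\<Lambda> f) = (\<Sum>x\<in>X. \<integral>y. \<bar>f (- x + y) - f y\<bar> \<partial>m) +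
     (\<Sum>E\<in>P. \<bar>(\<integral>y. indicator E y * f y \<partial>M) - \<mu> (indicator E) * (\<integral>y. f y \<partial>m)\<bar>)"
      unfolding p_def \<Lambda>_def by simp
    then show ?thesis using contra f by (auto simp: not_less)
  qed
  have "\<exists>L. (\<forall>u\<in>W. \<forall>v\<in>W. L (u + v) = L u + L v) \<and> (\<forall>c. \<forall>v\<in>W. L (c *\<^sub>R v) = c * L v) \<and>
     (\<forall>v\<in>W. L v \<le> p v) \<and> (\<forall>(c, s)\<in>C. s \<le> (L c :: real))"
  proof (rule mazur_orlicz[OF W p_add _ _ _ _ _ Cp])
    show "c \<in> W" if "(c, s) \<in> C" for c s using that \<Lambda>W unfolding C_def by auto
    have "\<Lambda> (\<lambda>y. 0) = 0" using \<Lambda>sc[of 0 "\<lambda>y. 0"] by simp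
    then show "(0, 0) \<in> C" unfolding C_def using cpt_simple_zero by (auto intro!: image_eqI[of _ _ "\<lambda>y. 0"])
    show "u + v \<in> C" if uv: "u \<in> C" "v \<in> C" for u v
    proof -
      obtain f g where f: "f \<in> cpt_simple H" "u = (\<Lambda> f, \<delta> * (\<integral>y. f y \<partial>m))"
        and g: "g \<in> cpt_simple H" "v = (\<Lambda> g, \<delta> * (\<integral>y. g y \<partial>m))" using uv unfolding C_def by blast
      have "u + v = (\<Lambda> (\<lambda>y. f y + g y), \<delta> * (\<integral>y. f y + g y \<partial>m))"
        using f g \<Lambda>add cpt_simple_integrable(1) by (simp add: distrib_left)
      then show ?thesis unfolding C_def using cpt_simple_add[OF f(1) g(1)] by blast
    qed
    show "r *\<^sub>R u \<in> C" if u: "u \<in> C" and r: "0 \<le> r" for r u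
    proof -
      obtain f where f: "f \<in> cpt_simple H" "u = (\<Lambda> f, \<delta> * (\<integral>y. f y \<partial>m))" using u unfolding C_def by blast
      have "r *\<^sub>R u = (\<Lambda> (\<lambda>y. r * f y), \<delta> * (\<integral>y. r * f y \<partial>m))" using f \<Lambda>sc by simp
      then show ?thesis unfolding C_def using cpt_simple_cmult[OF f(1) r] by blast
    qed
  qed (auto simp: p_scale)
  then obtain L where Ladd: "\<And>u v. u \<in> W \<Longrightarrow> v \<in> W \<Longrightarrow> L (u + v) = L u + L v"
    and Lsc: "\<And>c v. v \<in> W \<Longrightarrow> L (c *\<^sub>R v) = c * L v"
    and Lp: "\<And>v. v \<in> W \<Longrightarrow> L v \<le> p v" and LC: "\<And>c s. (c, s) \<in> C \<Longrightarrow> s \<le> L c"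
    by blast
  have Lneg: "L (- v) = - L v" if "v \<in> W" for v using Lsc[OF that, of "-1"] by simp
  have Labs: "\<bar>L v\<bar> \<le> p v" if v: "v \<in> W" for v
  proof -
    have "p (- v) = p v" unfolding p_def by simp
    then show ?thesis using Lp[OF v] Lp[OF Wneg[OF v]] Lneg[OF v] by linarith
  qed
  have Lsum: "L (\<Sum>i\<in>I. v i) = (\<Sum>i\<in>I. L (v i))" if "\<And>i. i \<in> I \<Longrightarrow> v i \<in> W" for I :: "'i set" and v
    using that
  proof (induction I rule: infinite_finite_induct)
    case (insert i I)
    then show ?case using Ladd[of "v i" "\<Sum>i\<in>I. v i"] subspace_sum[OF W, of I v] by simp
  qed (use Lsc[OF subspace_0[OF W], of 0] in simp_all)
  \<comment> \<open>The coordinate embeddings of the two factors; a vector is determined by its coordinates up to \<open>p\<close>.\<close>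
  define e :: "'a \<Rightarrow> ('a \<Rightarrow> real) \<Rightarrow> ('a \<Rightarrow> 'a \<Rightarrow> real) \<times> ('a set \<Rightarrow> real)" where
    "e x g = ((\<lambda>z. if z = x then g else (\<lambda>y. 0)), (\<lambda>E. 0))" for x g
  define u :: "'a set \<Rightarrow> ('a \<Rightarrow> 'a \<Rightarrow> real) \<times> ('a set \<Rightarrow> real)" where
    "u E = ((\<lambda>z y. 0), (\<lambda>F. of_bool (F = E)))" for E
  have eW: "e x g \<in> W" if "integrable m g" for x g unfolding W_def e_def using that by simp
  have uW: "u E \<in> W" for E unfolding W_def u_def by simp
  have Ldecomp: "L v = (\<Sum>x\<in>X. L (e x (fst v x))) + (\<Sum>E\<in>P. snd v E * L (u E))" if v: "v \<in> W" for v
  proof -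
    define v1 where "v1 = (\<Sum>x\<in>X. e x (fst v x))"
    define v2 where "v2 = (\<Sum>E\<in>P. snd v E *\<^sub>R u E)"
    have eW': "e x (fst v x) \<in> W" if "x \<in> X" for x using v that by (intro eW) (simp add: W_def)
    have W12: "v1 \<in> W" "v2 \<in> W" unfolding v1_def v2_def
      by (intro subspace_sum[OF W] eW' Wsc uW; assumption)+
    have fst1: "fst v1 z = (if z \<in> X then fst v z else (\<lambda>y. 0))" for z
    proof
      fix y
      have "fst v1 z y = (\<Sum>x\<in>X. if z = x then fst v z y else 0)"
        unfolding v1_def e_def by (auto simp: fst_sum sum_fun_apply intro!: sum.cong)
      then show "fst v1 z y = (if z \<in> X then fst v z else (\<lambda>y. 0)) y" using X by simp
    qed
    have snd1: "snd v1 E = 0" for E unfolding v1_def e_def by (simp add: snd_sum sum_fun_apply)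
    have fst2: "fst v2 z y = 0" for z y unfolding v2_def u_def by (simp add: fst_sum sum_fun_apply)
    have snd2: "snd v2 E = (if E \<in> P then snd v E else 0)" for E
    proof -
      have "snd v2 E = (\<Sum>F\<in>P. if E = F then snd v E else 0)"
        unfolding v2_def u_def by (auto simp: snd_sum sum_fun_apply intro!: sum.cong)
      then show ?thesis using P by simp
    qed
    define r where "r = v - (v1 + v2)"
    have rW: "r \<in> W" unfolding r_def by (intro subspace_diff[OF W] Wadd v W12)
    have "p r = 0" unfolding p_def r_def by (simp add: fst1 snd1 fst2 snd2)
    then have "L r = 0" using Labs[OF rW] by simp
    moreover have "L v = L (r + (v1 + v2))" unfolding r_def by simp
    ultimately have "L v = L v1 + L v2" using Ladd rW W12 Wadd by simp
    moreover have "L v1 = (\<Sum>x\<in>X. L (e x (fst v x)))" unfolding v1_def by (intro Lsum eW')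
    moreover have "L v2 = (\<Sum>E\<in>P. snd v E * L (u E))"
      unfolding v2_def by (subst Lsum) (auto simp: Lsc uW intro: Wsc)
    ultimately show ?thesis by simp
  qed
  define F where "F x A = L (e x (indicator A))" for x A
  have int_ind: "integrable m (indicator A :: 'a \<Rightarrow> real)" if "fin_borel A" for A
    using that unfolding fin_borel_def by simp
  have "\<exists>\<phi>. (\<forall>y. \<bar>\<phi> y\<bar> \<le> 1) \<and> (\<forall>K. compact K \<longrightarrow>
    (\<lambda>y. indicator K y * \<phi> y) \<in> borel_measurable borel \<and> F x K = (\<integral>y. indicator K y * \<phi> y \<partial>m))"
    if x: "x \<in> X" for x
  proof (rule bounded_set_function_density[OF lc])
    fix A B assume A: "fin_borel A" and B: "fin_borel B" and AB: "A \<inter> B = {}"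
    have "e x (indicator (A \<union> B)) = e x (indicator A) + e x (indicator B)"
      unfolding e_def using AB by (auto simp: fun_eq_iff indicator_def of_bool_def)
    then show "F x (A \<union> B) = F x A + F x B"
      unfolding F_def using Ladd[OF eW[OF int_ind[OF A]] eW[OF int_ind[OF B]]] by simp
  next
    fix A assume A: "fin_borel A"
    have "p (e x (indicator A)) = (\<Sum>z\<in>X. if z = x then measure m A else 0)"
      unfolding p_def e_def using A by (auto simp: fin_borel_def intro!: sum.cong)
    also have "\<dots> = measure m A" using X x by simp
    finally show "\<bar>F x A\<bar> \<le> measure m A"
      unfolding F_def using Labs[OF eW[OF int_ind[OF A]], of x] by simp
  qed
  then obtain \<phi> where \<phi>1: "\<And>x y. x \<in> X \<Longrightarrow> \<bar>\<phi> x y\<bar> \<le> 1"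
    and \<phi>b: "\<And>x K. x \<in> X \<Longrightarrow> compact K \<Longrightarrow> (\<lambda>y. indicator K y * \<phi> x y) \<in> borel_measurable borel"
    and \<phi>F: "\<And>x K. x \<in> X \<Longrightarrow> compact K \<Longrightarrow> F x K = (\<integral>y. indicator K y * \<phi> x y \<partial>m)"
    by metis
  have \<phi>L: "\<phi> x \<in> Linf m" if "x \<in> X" for x
    by (rule Linf_locally_borel[OF \<phi>1[OF that] \<phi>b[OF that]])
  have \<phi>tL: "(\<lambda>y. \<phi> x (x + y)) \<in> Linf m" if "x \<in> X" for x
    by (rule Linf_locally_borel[OF \<phi>1[OF that] translate_locally_borel(1)[OF \<phi>b[OF that]]])
  have PL: "indicator E \<in> Linf m" if "E \<in> P" for E by (rule Linf_indicator[OF P(2)[OF that]])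
  define h where "h y = (\<Sum>x\<in>X. \<phi> x (x + y) - \<phi> x y) +
    (\<Sum>E\<in>P. L (u E) * (indicator E y - \<mu> (indicator E)))" for y
  have h1L: "(\<lambda>y. \<phi> x (x + y) - \<phi> x y) \<in> Linf m" if "x \<in> X" for x
    by (intro Linf_diff \<phi>L \<phi>tL that)
  have h2L: "(\<lambda>y. L (u E) * (indicator E y - \<mu> (indicator E))) \<in> Linf m" if "E \<in> P" for E
    by (intro Linf_cmult Linf_diff PL that Linf_const)
  have hL: "h \<in> Linf m" unfolding h_def by (intro Linf_add Linf_sum h1L h2L)
  have \<mu>h: "\<mu> h = 0"
  proof -
    have "\<mu> h = \<mu> (\<lambda>y. \<Sum>x\<in>X. \<phi> x (x + y) - \<phi> x y)
      + \<mu> (\<lambda>y. \<Sum>E\<in>P. L (u E) * (indicator E y - \<mu> (indicator E)))"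
      unfolding h_def by (intro mean_add[OF \<mu>'] Linf_sum h1L h2L)
    moreover have "\<mu> (\<lambda>y. \<Sum>x\<in>X. \<phi> x (x + y) - \<phi> x y) = 0"
    proof -
      have "\<mu> (\<lambda>y. \<phi> x (x + y) - \<phi> x y) = 0" if x: "x \<in> X" for x
      proof -
        have "\<mu> (ltrans (- x) (\<phi> x)) = \<mu> (\<phi> x)" using \<mu> \<phi>L[OF x] unfolding LIMeans_def by blast
        then show ?thesis using mean_diff[OF \<mu>' \<phi>tL[OF x] \<phi>L[OF x]] by (simp add: ltrans_def)
      qed
      then show ?thesis using mean_sum[OF \<mu>', of X "\<lambda>x y. \<phi> x (x + y) - \<phi> x y", OF h1L] by simp
    qed
    moreover have "\<mu> (\<lambda>y. \<Sum>E\<in>P. L (u E) * (indicator E y - \<mu> (indicator E))) = 0"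
    proof -
      have "\<mu> (\<lambda>y. L (u E) * (indicator E y - \<mu> (indicator E))) = 0" if E: "E \<in> P" for E
      proof -
        have "\<mu> (\<lambda>y. \<mu> (indicator E)) = \<mu> (indicator E)"
          using mean_cmult[OF \<mu>' Linf_const, of "\<mu> (indicator E)" 1] mean_one[OF \<mu>'] by simp
        then have "\<mu> (\<lambda>y. indicator E y - \<mu> (indicator E)) = 0"
          using mean_diff[OF \<mu>' PL[OF E] Linf_const, of "\<mu> (indicator E)"] by simp
        then show ?thesis
          using mean_cmult[OF \<mu>' Linf_diff[OF PL[OF E] Linf_const], of "L (u E)" "\<mu> (indicator E)"] by simp
      qed
      then show ?thesis 
        using mean_sum[OF \<mu>', of P "\<lambda>E y. L (u E) * (indicator E y - \<mu> (indicator E))", OF h2L]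
        by simp
    qed
    ultimately show ?thesis by simp
  qed
  have hB: "\<delta> * measure m B \<le> (\<integral>y. indicator B y * h y \<partial>M)" if B: "compact B" "B \<inter> H = {}" for B
  proof -
    have Bs: "indicator B \<in> cpt_simple H" by (rule cpt_simple_indicator[OF B])
    have fB: "fin_borel B" by (rule fin_borel_compact[OF B(1)])
    have BM: "B \<in> sets M" using B(1) by (intro borel_in_M compact_in_borel)
    have intB: "(\<integral>y. indicator B y \<partial>m) = measure m B" using fB unfolding fin_borel_def by simp
    have mB: "measure M B = measure m B" using measure_M[of B] fB unfolding fin_borel_def by simp
    have "\<delta> * measure m B \<le> L (\<Lambda> (indicator B))"
    proof (rule LC)
      show "(\<Lambda> (indicator B), \<delta> * measure m B) \<in> C"
        unfolding C_def using Bs intB by (intro image_eqI[of _ _ "indicator B"]) auto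
    qed
    also have "L (\<Lambda> (indicator B)) = (\<Sum>x\<in>X. L (e x (fst (\<Lambda> (indicator B)) x)))
      + (\<Sum>E\<in>P. snd (\<Lambda> (indicator B)) E * L (u E))"
      by (rule Ldecomp[OF \<Lambda>W[OF Bs]])
    also have "(\<Sum>x\<in>X. L (e x (fst (\<Lambda> (indicator B)) x)))
      = (\<Sum>x\<in>X. \<integral>y. indicator B y * (\<phi> x (x + y) - \<phi> x y) \<partial>M)"
    proof (rule sum.cong[OF refl])
      fix x assume x: "x \<in> X"
      have cB: "compact ((+) x ` B)" by (rule compact_left_translation[OF B(1)])
      have "e x (fst (\<Lambda> (indicator B)) x) = e x (indicator ((+) x ` B)) + (- e x (indicator B))"
        unfolding e_def \<Lambda>_def by (auto simp: fun_eq_iff indicator_def of_bool_def mem_translation)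
      then have "L (e x (fst (\<Lambda> (indicator B)) x)) = F x ((+) x ` B) - F x B"
        using Ladd[OF eW[OF int_ind[OF fin_borel_compact[OF cB]], of x] Wneg[OF eW[OF int_ind[OF fB], of x]]]
          Lneg[OF eW[OF int_ind[OF fB], of x]] unfolding F_def by simp
      also have "\<dots> = (\<integral>y. indicator B y * \<phi> x (x + y) \<partial>m) - (\<integral>y. indicator B y * \<phi> x y \<partial>m)"
        using \<phi>F[OF x cB] \<phi>F[OF x B(1)] translate_locally_borel(2)[OF \<phi>b[OF x] B(1), of x] by simp
      also have "\<dots> = (\<integral>y. indicator B y * \<phi> x (x + y) \<partial>M) - (\<integral>y. indicator B y * \<phi> x y \<partial>M)"
        using \<phi>b[OF x B(1)] translate_locally_borel(1)[OF \<phi>b[OF x] B(1), of x]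
        by (simp add: integral_completion)
      also have "\<dots> = (\<integral>y. indicator B y * \<phi> x (x + y) - indicator B y * \<phi> x y \<partial>M)"
        by (rule Bochner_Integration.integral_diff[OF Linf_integrable[OF \<phi>tL[OF x] B(1)]
            Linf_integrable[OF \<phi>L[OF x] B(1)], symmetric])
      finally show "L (e x (fst (\<Lambda> (indicator B)) x))
        = (\<integral>y. indicator B y * (\<phi> x (x + y) - \<phi> x y) \<partial>M)"
        by (simp add: right_diff_distrib)
    qed
    also have "(\<Sum>E\<in>P. snd (\<Lambda> (indicator B)) E * L (u E))
      = (\<Sum>E\<in>P. \<integral>y. indicator B y * (L (u E) * (indicator E y - \<mu> (indicator E))) \<partial>M)"
    proof (rule sum.cong[OF refl])
      fix E assume E: "E \<in> P"
      have I1: "integrable M (\<lambda>y. indicator B y * indicator E y :: real)"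
        by (rule Linf_integrable[OF PL[OF E] B(1)])
      have I2: "integrable M (\<lambda>y. indicator B y * \<mu> (indicator E))"
        by (rule Linf_integrable[OF Linf_const B(1)])
      have "(\<integral>y. indicator B y * (L (u E) * (indicator E y - \<mu> (indicator E))) \<partial>M)
        = (\<integral>y. L (u E) * (indicator B y * indicator E y - indicator B y * \<mu> (indicator E)) \<partial>M)"
        by (intro Bochner_Integration.integral_cong) (auto simp: algebra_simps)
      also have "\<dots> = L (u E) * ((\<integral>y. indicator B y * indicator E y \<partial>M) - measure m B * \<mu> (indicator E))"
        using I1 I2 BM mB by (simp add: Bochner_Integration.integral_diff[OF I1 I2])
      also have "\<dots> = snd (\<Lambda> (indicator B)) E * L (u E)"
        unfolding \<Lambda>_def using E intB by (simp add: mult.commute)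
      finally show "snd (\<Lambda> (indicator B)) E * L (u E)
        = (\<integral>y. indicator B y * (L (u E) * (indicator E y - \<mu> (indicator E))) \<partial>M)" by simp
    qed
    also have "(\<Sum>x\<in>X. \<integral>y. indicator B y * (\<phi> x (x + y) - \<phi> x y) \<partial>M) + \<dots> = (\<integral>y. indicator B y * h y \<partial>M)"
      unfolding h_def distrib_left sum_distrib_left
      using Linf_integrable[OF h1L B(1)] Linf_integrable[OF h2L B(1)]
      by (subst Bochner_Integration.integral_add)
        (auto simp: Bochner_Integration.integral_sum intro!: Bochner_Integration.integrable_sum)
    finally show ?thesis .
  qed
  have null: "locally_null_set m {y. y \<notin> H \<and> h y < \<delta>}"
    by (rule locally_null_below[OF hL H(1) hB])
  have HL: "indicator H \<in> Linf m" by (rule Linf_indicator[OF locally_measurable_borel[OF H(1)]])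
  obtain b where b: "\<And>y. \<bar>h y - \<delta>\<bar> \<le> b" "0 \<le> b"
    using Linf_bounded[OF Linf_diff[OF hL Linf_const]] by metis
  have "\<mu> (\<lambda>y. \<delta> + (- b) * indicator H y) \<le> \<mu> h"
  proof (rule mean_le[OF \<mu>' _ hL locally_null_subset[OF null]])
    show "(\<lambda>y. \<delta> + (- b) * indicator H y) \<in> Linf m"
      by (intro Linf_add Linf_const Linf_cmult HL)
    show "{y. h y < \<delta> + - b * indicator H y} \<subseteq> {y. y \<notin> H \<and> h y < \<delta>}"
    proof safe
      fix y assume "h y < \<delta> + - b * indicator H y" "y \<in> H"
      then show False using b(1)[of y] by simp
    next
      fix y assume "h y < \<delta> + - b * indicator H y"
      then show "h y < \<delta>" using b(2) by (cases "y \<in> H") auto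
    qed
  qed
  moreover have "\<mu> (\<lambda>y. \<delta> + (- b) * indicator H y) = \<delta>"
  proof -
    have "\<mu> (\<lambda>y. \<delta> + (- b) * indicator H y) = \<mu> (\<lambda>y. \<delta>) + \<mu> (\<lambda>y. (- b) * indicator H y)"
      by (intro mean_add[OF \<mu>'] Linf_const Linf_cmult HL)
    moreover have "\<mu> (\<lambda>y. \<delta>) = \<delta>" using mean_cmult[OF \<mu>' Linf_const, of \<delta> 1] mean_one[OF \<mu>'] by simp
    moreover have "\<mu> (\<lambda>y. (- b) * indicator H y) = 0" using mean_cmult[OF \<mu>' HL, of "- b"] H(2) by simp
    ultimately show ?thesis by simp
  qed
  ultimately show False using \<mu>h \<delta> by simp
qed

end

section \<open>From densities to a single set\<close>

context haar
begin

definition shift_defect :: "'a \<Rightarrow> 'a set \<Rightarrow> real" where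
  "shift_defect x A = measure m (sym_diff ((+) x ` A) A)"

definition quasi_invariant :: "'a set \<Rightarrow> real \<Rightarrow> 'a set \<Rightarrow> bool" where
  "quasi_invariant X \<epsilon> A \<longleftrightarrow> compact A \<and> (\<forall>x\<in>X. shift_defect x A \<le> \<epsilon> * measure m A)"

definition mass_in :: "'a set \<Rightarrow> 'a set \<Rightarrow> real" where
  "mass_in E A = measure M (E \<inter> A)"

lemma mass_in_nonneg: "0 \<le> mass_in E A"
  unfolding mass_in_def by simp

lemma fin_M:
  assumes "compact A" and "locally_measurable_set m E"
  shows "E \<inter> A \<in> sets M" "emeasure M (E \<inter> A) \<noteq> \<infinity>"
proof -
  show "E \<inter> A \<in> sets M" using assms unfolding locally_measurable_set_def by blast
  have "emeasure M (E \<inter> A) \<le> emeasure M A" using assms by (intro emeasure_mono) auto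
  also have "\<dots> < \<infinity>" using emeasure_compact[OF assms(1)] assms(1) by simp
  finally show "emeasure M (E \<inter> A) \<noteq> \<infinity>" by simp
qed

lemma mass_in_le:
  assumes A: "compact A" and E: "locally_measurable_set m E"
  shows "mass_in E A \<le> measure m A"
proof -
  have "measure M (E \<inter> A) \<le> measure M A"
    using emeasure_compact[OF A] A by (intro measure_mono_fmeasurable fin_M E)
      (auto simp: fmeasurable_def)
  then show ?thesis unfolding mass_in_def using measure_M A by simp
qed

lemma mass_in_Un:
  assumes "compact A" "compact B" "A \<inter> B = {}" and E: "locally_measurable_set m E"
  shows "mass_in E (A \<union> B) = mass_in E A + mass_in E B"
proof -
  have "measure M ((E \<inter> A) \<union> (E \<inter> B)) = measure M (E \<inter> A) + measure M (E \<inter> B)"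
    using fin_M[OF assms(1) E] fin_M[OF assms(2) E] assms(3) by (intro measure_Union) auto
  then show ?thesis unfolding mass_in_def by (simp add: Int_Un_distrib)
qed

lemma measure_compact_Un:
  "compact A \<Longrightarrow> compact B \<Longrightarrow> A \<inter> B = {} \<Longrightarrow> measure m (A \<union> B) = measure m A + measure m B"
  using emeasure_compact by (intro measure_Union) (auto simp: less_top)

lemma fin_borel_sym_diff:
  assumes "compact A"
  shows "fin_borel (sym_diff ((+) x ` A) A)"
  by (rule fin_borel_subset[of "((+) x ` A) \<union> A"])
    (use assms compact_left_translation[OF assms, of x] in \<open>auto intro!: fin_borel_compact\<close>)

lemma shift_defect_Un:
  assumes "compact A" "compact B"
  shows "shift_defect x (A \<union> B) \<le> shift_defect x A + shift_defect x B"
proof -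
  let ?A = "sym_diff ((+) x ` A) A" and ?B = "sym_diff ((+) x ` B) B"
  have f: "fin_borel ?A" "fin_borel ?B" using assms by (auto intro: fin_borel_sym_diff)
  have f': "fin_borel (\<Union>b\<in>UNIV. if b then ?A else ?B)" by (rule fin_borel_UN) (use f in auto)
  have "(\<Union>b\<in>UNIV. if b then ?A else ?B) = ?A \<union> ?B" by (simp add: UNIV_bool Un_commute)
  with f' have f': "fin_borel (?A \<union> ?B)" by simp
  have s: "sym_diff ((+) x ` (A \<union> B)) (A \<union> B) \<subseteq> ?A \<union> ?B" by blast
  have "measure m (sym_diff ((+) x ` (A \<union> B)) (A \<union> B)) \<le> measure m (?A \<union> ?B)"
    using fin_borel_sym_diff[OF compact_Un[OF assms], of x] f'
    by (intro measure_mono_fmeasurable s) (auto simp: fin_borel_def fmeasurable_def)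
  also have "\<dots> \<le> measure m ?A + measure m ?B"
    using f by (intro measure_Un_le) (auto simp: fin_borel_def)
  finally show ?thesis unfolding shift_defect_def .
qed

lemma quasi_invariant_Un:
  assumes A: "quasi_invariant X \<epsilon> A" and B: "quasi_invariant X \<epsilon> B" and AB: "A \<inter> B = {}"
  shows "quasi_invariant X \<epsilon> (A \<union> B)"
  unfolding quasi_invariant_def
proof (intro conjI ballI)
  have c: "compact A" "compact B" using A B unfolding quasi_invariant_def by auto
  show "compact (A \<union> B)" using c by (rule compact_Un)
  fix x assume "x \<in> X"
  then have "shift_defect x A \<le> \<epsilon> * measure m A" "shift_defect x B \<le> \<epsilon> * measure m B"
    using A B unfolding quasi_invariant_def by auto
  then show "shift_defect x (A \<union> B) \<le> \<epsilon> * measure m (A \<union> B)"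
    using shift_defect_Un[OF c, of x] measure_compact_Un[OF c AB] by (simp add: distrib_left)
qed

lemma quasi_invariant_empty: "quasi_invariant X \<epsilon> {}"
  unfolding quasi_invariant_def shift_defect_def by simp

text \<open>
  After normalisation, a density \<open>f\<close> with small defects is a convex combination of the uniform densities on
  its level sets, with weights \<open>c t\<close>, and its translation defect is the same combination of theirs. By Markov's
  inequality the level sets that are not \<open>\<epsilon>\<close>-invariant have total weight below \<open>\<delta> / \<epsilon>\<close>. Replacing each of
  them by one good level set \<open>A t0\<close> keeps the total weight at \<open>1\<close> and changes the averages by at most
  their weight.
\<close>

lemma mean_convex_combination:
  assumes lc: "locally_compact_space (euclidean :: 'a topology)"
    and \<mu>: "\<mu> \<in> LIMeans m" and H: "H \<in> sets borel" "\<mu> (indicator H) = 0"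
    and X: "finite X" and P: "finite P" "\<And>E. E \<in> P \<Longrightarrow> locally_measurable_set m E"
    and \<epsilon>: "0 < \<epsilon>" and \<eta>: "0 < \<eta>"
  shows "\<exists>(T :: real set) c A. finite T \<and> (\<forall>t\<in>T. 0 \<le> c t) \<and> (\<Sum>t\<in>T. c t) = 1 \<and>
    (\<forall>t\<in>T. quasi_invariant X \<epsilon> (A t) \<and> 0 < measure m (A t) \<and> A t \<inter> H = {}) \<and>
    (\<forall>E\<in>P. \<bar>(\<Sum>t\<in>T. c t * (mass_in E (A t) / measure m (A t))) - \<mu> (indicator E)\<bar> < \<eta>)"
proof -
  \<comment> \<open>The averages are off by \<open>\<delta>\<close>, and by the weight \<open>\<delta> / \<epsilon>\<close> of the bad levels after their replacement.\<close>
  define \<delta> where "\<delta> = min (\<epsilon> / 2) (\<eta> * \<epsilon> / (2 * (1 + \<epsilon>)))"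
  have \<delta>: "0 < \<delta>" "\<delta> < \<epsilon>" unfolding \<delta>_def using \<epsilon> \<eta> by (auto simp: min_less_iff_disj)
  have "\<delta> * (1 + \<epsilon>) \<le> \<eta> * \<epsilon> / (2 * (1 + \<epsilon>)) * (1 + \<epsilon>)"
    unfolding \<delta>_def using \<epsilon> by (intro mult_right_mono) auto
  also have "\<dots> = \<eta> * \<epsilon> / 2" using \<epsilon> by (simp add: field_simps)
  also have "\<dots> < \<eta> * \<epsilon>" using \<epsilon> \<eta> by simp
  finally have \<delta>\<eta>: "\<delta> + \<delta> / \<epsilon> < \<eta>" using \<epsilon> by (simp add: field_simps)
  obtain f where f: "f \<in> cpt_simple H"
    and small: "(\<Sum>x\<in>X. \<integral>y. \<bar>f (- x + y) - f y\<bar> \<partial>m) +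
     (\<Sum>E\<in>P. \<bar>(\<integral>y. indicator E y * f y \<partial>M) - \<mu> (indicator E) * (\<integral>y. f y \<partial>m)\<bar>)
     < \<delta> * (\<integral>y. f y \<partial>m)"
    using almost_invariant_density[OF lc \<mu> H X P \<delta>(1)] by blast
  define I where "I = (\<integral>y. f y \<partial>m)"
  define T where "T = levels f"
  define g where "g = gap T"
  define A where "A t = {y. t \<le> f y}" for t
  have finT: "finite T" unfolding T_def by (rule cpt_simple_levels(1)[OF f])
  have g0: "0 \<le> g t" if "t \<in> T" for t
    unfolding g_def using gap_nonneg[OF finT] cpt_simple_levels(2)[OF f] that T_def by auto
  have A: "compact (A t)" "A t \<inter> H = {}" if "t \<in> T" for t
    using cpt_simple_levels(4,5)[OF f] that unfolding A_def T_def by auto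
  have Xsum: "(\<Sum>x\<in>X. \<integral>y. \<bar>f (- x + y) - f y\<bar> \<partial>m) = (\<Sum>t\<in>T. g t * (\<Sum>x\<in>X. shift_defect x (A t)))"
    unfolding cpt_simple_translation_norm[OF f] shift_defect_def A_def T_def g_def sum_distrib_left
    by (rule sum.swap)
  have Isum: "I = (\<Sum>t\<in>T. g t * measure m (A t))"
    unfolding I_def cpt_simple_integrable(3)[OF f] A_def T_def g_def ..
  have Esum: "(\<integral>y. indicator E y * f y \<partial>M) = (\<Sum>t\<in>T. g t * mass_in E (A t))" if "E \<in> P" for E
    unfolding cpt_simple_integral_over(2)[OF f P(2)[OF that]] A_def T_def g_def mass_in_def ..
  have sd0: "0 \<le> (\<Sum>x\<in>X. shift_defect x (A t))" for t unfolding shift_defect_def by (simp add: sum_nonneg)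
  have X0: "0 \<le> (\<Sum>t\<in>T. g t * (\<Sum>x\<in>X. shift_defect x (A t)))"
    by (rule sum_nonneg, rule mult_nonneg_nonneg) (use g0 sd0 in auto)
  have P0: "0 \<le> (\<Sum>E\<in>P. \<bar>(\<integral>y. indicator E y * f y \<partial>M) - \<mu> (indicator E) * I\<bar>)"
    by (intro sum_nonneg) simp
  have "0 < \<delta> * I" using small X0 P0 unfolding Xsum I_def[symmetric] by linarith
  then have I: "0 < I" using \<delta>(1) by (simp add: zero_less_mult_iff)
  define c where "c t = g t * measure m (A t) / I" for t
  have c0: "0 \<le> c t" if "t \<in> T" for t unfolding c_def using g0[OF that] I by simp
  have c1: "(\<Sum>t\<in>T. c t) = 1"
    unfolding c_def using I by (simp add: sum_divide_distrib[symmetric] Isum[symmetric])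
  define good where "good t \<longleftrightarrow> quasi_invariant X \<epsilon> (A t) \<and> 0 < measure m (A t)" for t
  have "\<epsilon> * (\<Sum>t\<in>{t\<in>T. \<not> good t}. c t) = (\<Sum>t\<in>{t\<in>T. \<not> good t}. \<epsilon> * c t)"
    by (rule sum_distrib_left)
  also have "\<dots> \<le> (\<Sum>t\<in>{t\<in>T. \<not> good t}. g t * (\<Sum>x\<in>X. shift_defect x (A t)) / I)"
  proof (rule sum_mono)
    fix t assume t: "t \<in> {t \<in> T. \<not> good t}"
    have "\<epsilon> * measure m (A t) \<le> (\<Sum>x\<in>X. shift_defect x (A t))"
    proof (cases "measure m (A t) = 0")
      case True
      then show ?thesis using sd0[of t] by simp
    next
      case False
      then have "0 < measure m (A t)" by (simp add: order_less_le)
      then obtain x where x: "x \<in> X" "\<epsilon> * measure m (A t) < shift_defect x (A t)"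
        using t A(1)[of t] unfolding good_def quasi_invariant_def by (auto simp: not_le)
      have "shift_defect x (A t) \<le> (\<Sum>x\<in>X. shift_defect x (A t))"
        by (rule member_le_sum[OF x(1) _ X]) (simp add: shift_defect_def)
      then show ?thesis using x(2) by linarith
    qed
    then have "g t * (\<epsilon> * measure m (A t)) / I \<le> g t * (\<Sum>x\<in>X. shift_defect x (A t)) / I"
      using g0 t I by (intro divide_right_mono mult_left_mono) auto
    then show "\<epsilon> * c t \<le> g t * (\<Sum>x\<in>X. shift_defect x (A t)) / I"
      unfolding c_def by (simp add: mult.left_commute)
  qed
  also have "\<dots> \<le> (\<Sum>t\<in>T. g t * (\<Sum>x\<in>X. shift_defect x (A t)) / I)"
  proof (rule sum_mono2)
    show "0 \<le> g t * (\<Sum>x\<in>X. shift_defect x (A t)) / I" if "t \<in> T - {t\<in>T. \<not> good t}" for t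
      using mult_nonneg_nonneg[OF g0 sd0] that I by (simp add: divide_nonneg_pos)
  qed (use finT in auto)
  also have "\<dots> = (\<Sum>t\<in>T. g t * (\<Sum>x\<in>X. shift_defect x (A t))) / I"
    by (simp add: sum_divide_distrib)
  also have "\<dots> < \<delta>"
  proof -
    have "(\<Sum>t\<in>T. g t * (\<Sum>x\<in>X. shift_defect x (A t))) < \<delta> * I"
      using small P0 unfolding Xsum I_def[symmetric] by linarith
    then show ?thesis using I by (simp add: divide_less_eq)
  qed
  finally have bad: "(\<Sum>t\<in>{t\<in>T. \<not> good t}. c t) < \<delta> / \<epsilon>" using \<epsilon> by (simp add: field_simps)
  have "\<exists>t\<in>T. good t"
  proof (rule ccontr)
    assume "\<not> ?thesis"
    then have "{t\<in>T. \<not> good t} = T" by blast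
    then have "1 < \<delta> / \<epsilon>" using bad c1 by simp
    then show False using \<delta>(2) \<epsilon> by (simp add: field_simps)
  qed
  then obtain t0 where t0: "t0 \<in> T" "good t0" by blast
  define B where "B t = (if good t then A t else A t0)" for t
  have B: "quasi_invariant X \<epsilon> (B t) \<and> 0 < measure m (B t) \<and> B t \<inter> H = {}" if "t \<in> T" for t
    unfolding B_def using A(2) t0 that by (auto simp: good_def)
  have "\<bar>(\<Sum>t\<in>T. c t * (mass_in E (B t) / measure m (B t))) - \<mu> (indicator E)\<bar> < \<eta>" if E: "E \<in> P" for E
  proof -
    let ?d = "\<lambda>A. mass_in E A / measure m A"
    have d: "0 \<le> ?d A" "?d A \<le> 1" if "compact A" for A
      using mass_in_nonneg[of E A] mass_in_le[OF that P(2)[OF E]] by (auto intro: divide_le_eq_1[THEN iffD2] simp: divide_le_eq_1)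
    have "(\<Sum>t\<in>T. c t * ?d (A t)) = (\<Sum>t\<in>T. g t * mass_in E (A t) / I)"
    proof (rule sum.cong[OF refl])
      fix t assume t: "t \<in> T"
      show "c t * ?d (A t) = g t * mass_in E (A t) / I"
      proof (cases "measure m (A t) = 0")
        case True
        then have "mass_in E (A t) = 0"
          using mass_in_nonneg[of E "A t"] mass_in_le[OF A(1)[OF t] P(2)[OF E]] by linarith
        then show ?thesis by simp
      qed (simp add: c_def)
    qed
    also have "\<dots> = (\<Sum>t\<in>T. g t * mass_in E (A t)) / I" by (rule sum_divide_distrib[symmetric])
    finally have 1: "(\<Sum>t\<in>T. c t * ?d (A t)) * I = (\<integral>y. indicator E y * f y \<partial>M)"
      using Esum[OF E] I by simp
    have "\<bar>(\<integral>y. indicator E y * f y \<partial>M) - \<mu> (indicator E) * I\<bar>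
      \<le> (\<Sum>E\<in>P. \<bar>(\<integral>y. indicator E y * f y \<partial>M) - \<mu> (indicator E) * I\<bar>)"
      by (rule member_le_sum[OF E _ P(1)]) simp
    also have "\<dots> < \<delta> * I" using small X0 unfolding Xsum I_def[symmetric] by linarith
    finally have "\<bar>(\<Sum>t\<in>T. c t * ?d (A t)) - \<mu> (indicator E)\<bar> * I < \<delta> * I"
      unfolding 1[symmetric] left_diff_distrib[symmetric] using I by (simp add: abs_mult)
    then have 2: "\<bar>(\<Sum>t\<in>T. c t * ?d (A t)) - \<mu> (indicator E)\<bar> < \<delta>" using I by simp
    have "\<bar>(\<Sum>t\<in>T. c t * ?d (B t)) - (\<Sum>t\<in>T. c t * ?d (A t))\<bar>
      \<le> (\<Sum>t\<in>T. \<bar>c t * ?d (B t) - c t * ?d (A t)\<bar>)"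
      unfolding sum_subtractf[symmetric] by (rule sum_abs)
    also have "\<dots> \<le> (\<Sum>t\<in>T. if \<not> good t then c t else 0)"
    proof (rule sum_mono)
      fix t assume t: "t \<in> T"
      show "\<bar>c t * ?d (B t) - c t * ?d (A t)\<bar> \<le> (if \<not> good t then c t else 0)"
      proof (cases "good t")
        case False
        have "\<bar>?d (A t0) - ?d (A t)\<bar> \<le> 1" using d[OF A(1)[OF t]] d[OF A(1)[OF t0(1)]] by linarith
        then have "c t * \<bar>?d (A t0) - ?d (A t)\<bar> \<le> c t * 1" using c0[OF t] by (rule mult_left_mono)
        then show ?thesis
          unfolding right_diff_distrib[symmetric] abs_mult B_def using False c0[OF t] by simp
      qed (simp add: B_def)
    qed
    also have "\<dots> = (\<Sum>t\<in>{t\<in>T. \<not> good t}. c t)" using finT by (simp add: sum.inter_filter)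
    finally show ?thesis using bad 2 \<delta>\<eta> by linarith
  qed
  then show ?thesis
    using finT c0 c1 B by (intro exI[of _ T] exI[of _ c] exI[of _ B]) blast
qed

text \<open>
  Off a sigma-compact set means far out: these are the sets that an invariant mean ignores.
\<close>

definition recurrent :: "('a set \<Rightarrow> bool) \<Rightarrow> bool" where
  "recurrent Q \<longleftrightarrow> (\<forall>S. sigma_compact S \<longrightarrow> (\<exists>A. Q A \<and> A \<inter> S = {}))"

lemma recurrent_mono: "recurrent Q \<Longrightarrow> (\<And>A. Q A \<Longrightarrow> R A) \<Longrightarrow> recurrent R"
  unfolding recurrent_def by blast

text \<open>
  For each property that is not recurrent, some sigma-compact set meets every set having it; \<open>S\<close> is the union
  of these obstructions.
\<close>

lemma ex_recurrent_support:
  assumes \<T>: "countable \<T>"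
  shows "\<exists>S. sigma_compact S \<and> (\<forall>Q\<in>\<T>. \<forall>A. Q A \<longrightarrow> A \<inter> S = {} \<longrightarrow> recurrent Q)"
proof -
  have "\<forall>Q. \<exists>S. sigma_compact S \<and> ((\<exists>A. Q A \<and> A \<inter> S = {}) \<longrightarrow> recurrent Q)"
    unfolding recurrent_def using sigma_compact_compact[OF compact_empty] by blast
  then obtain S where S: "\<And>Q. sigma_compact (S Q)" "\<And>Q A. Q A \<Longrightarrow> A \<inter> S Q = {} \<Longrightarrow> recurrent Q"
    by metis
  show ?thesis
  proof (intro exI[of _ "\<Union>Q\<in>\<T>. S Q"] conjI ballI allI impI)
    show "sigma_compact (\<Union>Q\<in>\<T>. S Q)" using \<T> S(1) by (intro sigma_compact_Union) auto
    fix Q A assume "Q \<in> \<T>" "Q A" "A \<inter> (\<Union>Q\<in>\<T>. S Q) = {}"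
    then show "recurrent Q" by (intro S(2)[of Q A]) blast+
  qed
qed

text \<open>
  An almost invariant set with a share of about \<open>v E\<close> in each \<open>E\<close>. The definition is stated
  without division, so that it passes to disjoint unions and holds for the empty set.
\<close>

definition block :: "'a set \<Rightarrow> real \<Rightarrow> 'a set set \<Rightarrow> ('a set \<Rightarrow> real) \<Rightarrow> real \<Rightarrow> 'a set \<Rightarrow> bool" where
  "block X \<epsilon> P v \<theta> A \<longleftrightarrow> quasi_invariant X \<epsilon> A \<and>
     (\<forall>E\<in>P. \<bar>mass_in E A - v E * measure m A\<bar> \<le> \<theta> * measure m A)"

lemma block_Un:
  assumes P: "\<And>E. E \<in> P \<Longrightarrow> locally_measurable_set m E"
    and A: "block X \<epsilon> P v \<theta> A" and B: "block X \<epsilon> P v \<theta> B" and AB: "A \<inter> B = {}"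
  shows "block X \<epsilon> P v \<theta> (A \<union> B)"
proof -
  have c: "compact A" "compact B" using A B unfolding block_def quasi_invariant_def by auto
  have "\<bar>mass_in E (A \<union> B) - v E * measure m (A \<union> B)\<bar> \<le> \<theta> * measure m (A \<union> B)" if E: "E \<in> P" for E
  proof -
    have "\<bar>mass_in E A - v E * measure m A\<bar> \<le> \<theta> * measure m A"
      "\<bar>mass_in E B - v E * measure m B\<bar> \<le> \<theta> * measure m B" using A B E unfolding block_def by auto
    then show ?thesis
      unfolding mass_in_Un[OF c AB P[OF E]] measure_compact_Un[OF c AB] distrib_left by linarith
  qed
  then show ?thesis using quasi_invariant_Un[OF _ _ AB] A B unfolding block_def by blast
qed

text \<open>
  Disjoint blocks are added one at a time until the measure reaches \<open>R\<close>. Each of them adds at least \<open>1 / n\<close>,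
  so this happens, and at most \<open>n\<close>, so that the target is overshot by at most \<open>n\<close>.
\<close>

lemma ex_block_of_size:
  fixes n :: nat and R :: real
  assumes P: "\<And>E. E \<in> P \<Longrightarrow> locally_measurable_set m E"
    and rec: "recurrent (\<lambda>A. block X \<epsilon> P v \<theta> A \<and> measure m A \<le> n \<and> 1 \<le> n * measure m A)"
    and S: "sigma_compact S" and R: "0 \<le> R"
  shows "\<exists>B. block X \<epsilon> P v \<theta> B \<and> B \<inter> S = {} \<and> R \<le> measure m B \<and> measure m B \<le> R + n"
proof -
  have "\<exists>B. block X \<epsilon> P v \<theta> B \<and> B \<inter> S = {} \<and> measure m B \<le> R + n \<and>
    (R \<le> measure m B \<or> real k \<le> n * measure m B)" for k
  proof (induction k)
    case 0
    show ?case
      by (intro exI[of _ "{}"]) (use R in \<open>auto simp: block_def quasi_invariant_empty mass_in_def\<close>)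
  next
    case (Suc k)
    then obtain B where B: "block X \<epsilon> P v \<theta> B" "B \<inter> S = {}" "measure m B \<le> R + n"
      "R \<le> measure m B \<or> real k \<le> n * measure m B" by blast
    show ?case
    proof (cases "R \<le> measure m B")
      case True
      then show ?thesis using B by blast
    next
      case False
      have c: "compact B" using B unfolding block_def quasi_invariant_def by blast
      obtain A where A: "block X \<epsilon> P v \<theta> A" "measure m A \<le> n" "1 \<le> n * measure m A" "A \<inter> (S \<union> B) = {}"
        using rec sigma_compact_Un[OF S sigma_compact_compact[OF c]] unfolding recurrent_def by blast
      have cA: "compact A" using A unfolding block_def quasi_invariant_def by blast
      have AB: "A \<inter> B = {}" using A(4) by blast
      have mAB: "measure m (A \<union> B) = measure m A + measure m B" by (rule measure_compact_Un[OF cA c AB])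
      show ?thesis
      proof (intro exI[of _ "A \<union> B"] conjI)
        show "block X \<epsilon> P v \<theta> (A \<union> B)" by (rule block_Un[OF P A(1) B(1) AB])
        show "(A \<union> B) \<inter> S = {}" using A(4) B(2) by blast
        show "measure m (A \<union> B) \<le> R + n" using mAB A(2) False by simp
        show "R \<le> measure m (A \<union> B) \<or> real (Suc k) \<le> n * measure m (A \<union> B)"
          using mAB A(3) B(4) False by (simp add: distrib_left)
      qed
    qed
  qed
  moreover obtain k where k: "n * R < real k" using reals_Archimedean2 by blast
  ultimately obtain B where B: "block X \<epsilon> P v \<theta> B" "B \<inter> S = {}" "measure m B \<le> R + n"
    "R \<le> measure m B \<or> real k \<le> n * measure m B" by blast
  have "R \<le> measure m B"
  proof (rule ccontr)
    assume n: "\<not> ?thesis"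
    then have "n * measure m B \<le> n * R" by (intro mult_left_mono) auto
    then show False using B(4) k n by linarith
  qed
  then show ?thesis using B by blast
qed

text \<open>
  Blocks of the finitely many types, of measure about \<open>R * c t\<close> for the type \<open>t\<close>, are formed one after the
  other, each off the previous ones. The overshoot, at most \<open>n t\<close> each, does not depend on \<open>R\<close>.
\<close>

lemma combine_blocks:
  fixes n :: "'t \<Rightarrow> nat" and v :: "'t \<Rightarrow> 'a set \<Rightarrow> real" and c :: "'t \<Rightarrow> real" and R :: real
  assumes P: "\<And>E. E \<in> P \<Longrightarrow> locally_measurable_set m E" and R: "0 \<le> R"
    and T: "finite T" "\<And>t. t \<in> T \<Longrightarrow> 0 \<le> c t"
    and v: "\<And>t E. t \<in> T \<Longrightarrow> E \<in> P \<Longrightarrow> 0 \<le> v t E \<and> v t E \<le> 1"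
    and rec: "\<And>t. t \<in> T \<Longrightarrow>
      recurrent (\<lambda>A. block X \<epsilon> P (v t) \<theta> A \<and> measure m A \<le> n t \<and> 1 \<le> n t * measure m A)"
  shows "\<exists>B. quasi_invariant X \<epsilon> B \<and>
    R * (\<Sum>t\<in>T. c t) \<le> measure m B \<and> measure m B \<le> R * (\<Sum>t\<in>T. c t) + (\<Sum>t\<in>T. real (n t)) \<and>
    (\<forall>E\<in>P. \<bar>mass_in E B - R * (\<Sum>t\<in>T. c t * v t E)\<bar> \<le> \<theta> * measure m B + (\<Sum>t\<in>T. real (n t)))"
  using T v rec
proof (induction T)
  case empty
  show ?case by (intro exI[of _ "{}"]) (auto simp: quasi_invariant_empty mass_in_def)
next
  case (insert t T)
  obtain B where B: "quasi_invariant X \<epsilon> B"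
    "R * (\<Sum>t\<in>T. c t) \<le> measure m B" "measure m B \<le> R * (\<Sum>t\<in>T. c t) + (\<Sum>t\<in>T. real (n t))"
    "\<And>E. E \<in> P \<Longrightarrow> \<bar>mass_in E B - R * (\<Sum>t\<in>T. c t * v t E)\<bar> \<le> \<theta> * measure m B + (\<Sum>t\<in>T. real (n t))"
    using insert.IH[OF insert.prems(1)[OF insertI2] insert.prems(2)[OF insertI2] insert.prems(3)[OF insertI2]]
    by blast
  have cB: "compact B" using B unfolding quasi_invariant_def by blast
  have Rc: "0 \<le> R * c t" using R insert.prems(1) by simp
  obtain A where A: "block X \<epsilon> P (v t) \<theta> A" "A \<inter> B = {}" "R * c t \<le> measure m A" "measure m A \<le> R * c t + n t"
    using ex_block_of_size[OF P insert.prems(3) sigma_compact_compact[OF cB] Rc] by blast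
  have qA: "quasi_invariant X \<epsilon> A" and cA: "compact A"
    using A(1) unfolding block_def quasi_invariant_def by auto
  have mAB: "measure m (A \<union> B) = measure m A + measure m B" by (rule measure_compact_Un[OF cA cB A(2)])
  show ?case
  proof (intro exI[of _ "A \<union> B"] conjI ballI)
    show "quasi_invariant X \<epsilon> (A \<union> B)" by (rule quasi_invariant_Un[OF qA B(1) A(2)])
    show "R * (\<Sum>t\<in>insert t T. c t) \<le> measure m (A \<union> B)"
      using A(3) B(2) mAB insert.hyps by (simp add: distrib_left)
    show "measure m (A \<union> B) \<le> R * (\<Sum>t\<in>insert t T. c t) + (\<Sum>t\<in>insert t T. real (n t))"
      using A(4) B(3) mAB insert.hyps by (simp add: distrib_left)
    fix E assume E: "E \<in> P"
    have pE: "mass_in E (A \<union> B) = mass_in E A + mass_in E B" by (rule mass_in_Un[OF cA cB A(2) P[OF E]])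
    have 1: "\<bar>mass_in E A - v t E * measure m A\<bar> \<le> \<theta> * measure m A"
      using A(1) E unfolding block_def by blast
    have v: "0 \<le> v t E" "v t E \<le> 1" using insert.prems(2)[of t E] E by auto
    have "\<bar>measure m A - R * c t\<bar> \<le> n t" using A(3,4) by linarith
    then have "v t E * \<bar>measure m A - R * c t\<bar> \<le> 1 * real (n t)" using v by (intro mult_mono) auto
    moreover have "v t E * measure m A - R * (c t * v t E) = v t E * (measure m A - R * c t)"
      by (simp add: algebra_simps)
    ultimately have 2: "\<bar>v t E * measure m A - R * (c t * v t E)\<bar> \<le> n t"
      using v by (simp add: abs_mult)
    show "\<bar>mass_in E (A \<union> B) - R * (\<Sum>t\<in>insert t T. c t * v t E)\<bar>
      \<le> \<theta> * measure m (A \<union> B) + (\<Sum>t\<in>insert t T. real (n t))"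
      using 1 2 B(4)[OF E] insert.hyps unfolding pE mAB by (simp add: distrib_left)
  qed
qed

text \<open>
  The averages over the sets \<open>A t\<close> are rounded to multiples of \<open>\<eta>\<close> and their sizes are bounded
  by an integer, which leaves countably many types. The convex combination can therefore be taken off a
  sigma-compact set outside which only recurrent types occur. Sets of the same type may differ in size, but
  two-sided bounds are all that is needed to fill up a prescribed measure with them.
\<close>

lemma ex_recurrent_blocks:
  assumes lc: "locally_compact_space (euclidean :: 'a topology)"
    and nsc: "\<not> sigma_compact (UNIV :: 'a set)" and \<mu>: "\<mu> \<in> LIMeans m"
    and X: "finite X" and P: "finite P" "\<And>E. E \<in> P \<Longrightarrow> locally_measurable_set m E"
    and \<epsilon>: "0 < \<epsilon>" and \<eta>: "0 < \<eta>"
  shows "\<exists>(T :: real set) c v (n :: real \<Rightarrow> nat). finite T \<and> (\<forall>t\<in>T. 0 \<le> c t) \<and> (\<Sum>t\<in>T. c t) = 1 \<and>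
    (\<forall>t\<in>T. \<forall>E\<in>P. 0 \<le> v t E \<and> v t E \<le> 1) \<and>
    (\<forall>t\<in>T. recurrent (\<lambda>A. block X \<epsilon> P (v t) (2 * \<eta>) A \<and> measure m A \<le> n t \<and> 1 \<le> n t * measure m A)) \<and>
    (\<forall>E\<in>P. \<bar>(\<Sum>t\<in>T. c t * v t E) - \<mu> (indicator E)\<bar> < \<eta>)"
proof -
  define Q where "Q = (\<lambda>(w, n :: nat) A. block X \<epsilon> P (\<lambda>E. \<eta> * real (w E)) \<eta> A \<and>
    measure m A \<le> n \<and> 1 \<le> n * measure m A)"
  define \<T> where "\<T> = Q ` ((P \<rightarrow>\<^sub>E (UNIV :: nat set)) \<times> UNIV)"
  have "countable (P \<rightarrow>\<^sub>E (UNIV :: nat set))" by (rule countable_PiE[OF P(1)]) simp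
  then have "countable \<T>" unfolding \<T>_def by (rule countable_image[OF countable_SIGMA]) simp
  from ex_recurrent_support[OF this] obtain S where S: "sigma_compact S"
    and Srec: "\<forall>q\<in>\<T>. \<forall>A. q A \<longrightarrow> A \<inter> S = {} \<longrightarrow> recurrent q" by (elim exE conjE)
  obtain H where H: "open H" "sigma_compact H" "S \<subseteq> H" "subgrp H"
    using ex_open_sigma_compact_subgroup[OF lc S] by blast
  have \<mu>H: "\<mu> (indicator H) = 0" by (rule invariant_mean_subgroup[OF \<mu> H(1,2,4) nsc])
  obtain T :: "real set" and c A where T: "finite T" "\<forall>t\<in>T. 0 \<le> c t" "(\<Sum>t\<in>T. c t) = 1"
    and A: "\<And>t. t \<in> T \<Longrightarrow> quasi_invariant X \<epsilon> (A t) \<and> 0 < measure m (A t) \<and> A t \<inter> H = {}"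
    and approx: "\<forall>E\<in>P. \<bar>(\<Sum>t\<in>T. c t * (mass_in E (A t) / measure m (A t))) - \<mu> (indicator E)\<bar> < \<eta>"
    using mean_convex_combination[OF lc \<mu> borel_open[OF H(1)] \<mu>H X P \<epsilon> \<eta>] by blast
  define v where "v t E = mass_in E (A t) / measure m (A t)" for t E
  have v: "0 \<le> v t E \<and> v t E \<le> 1" if "t \<in> T" "E \<in> P" for t E
    using mass_in_nonneg[of E "A t"] mass_in_le[OF _ P(2)[OF that(2)], of "A t"] A[OF that(1)]
    unfolding v_def quasi_invariant_def by (simp add: divide_le_eq_1)
  have "\<exists>n :: nat. recurrent (\<lambda>B. block X \<epsilon> P (v t) (2 * \<eta>) B \<and> measure m B \<le> n \<and> 1 \<le> n * measure m B)"
    if t: "t \<in> T" for t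
  proof -
    have pos: "0 < measure m (A t)" using A[OF t] by blast
    define w where "w = (\<lambda>E\<in>P. nat \<lfloor>v t E / \<eta>\<rfloor>)"
    have w: "\<bar>v t E - \<eta> * real (w E)\<bar> \<le> \<eta>" if E: "E \<in> P" for E
    proof -
      have "real (w E) = real_of_int \<lfloor>v t E / \<eta>\<rfloor>"
        unfolding w_def using E v[OF t E] \<eta> by simp
      then have "real (w E) \<le> v t E / \<eta>" "v t E / \<eta> < real (w E) + 1" by linarith+
      then have "\<eta> * real (w E) \<le> v t E" "v t E < \<eta> * real (w E) + \<eta>"
        using \<eta> by (auto simp: field_simps)
      then show ?thesis by linarith
    qed
    obtain n :: nat where n: "max (measure m (A t)) (1 / measure m (A t)) \<le> real n"
      using real_arch_simple by blast
    have n': "measure m (A t) \<le> n" "1 \<le> n * measure m (A t)"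
      using n pos by (auto simp: field_simps)
    have "\<bar>mass_in E (A t) - \<eta> * real (w E) * measure m (A t)\<bar> \<le> \<eta> * measure m (A t)" if E: "E \<in> P" for E
    proof -
      have "mass_in E (A t) - \<eta> * real (w E) * measure m (A t) = (v t E - \<eta> * real (w E)) * measure m (A t)"
        unfolding v_def left_diff_distrib using pos by simp
      then show ?thesis using mult_right_mono[OF w[OF E], of "measure m (A t)"] pos by (simp add: abs_mult)
    qed
    then have "Q (w, n) (A t)" unfolding Q_def block_def using A[OF t] n' by simp
    moreover have "Q (w, n) \<in> \<T>" unfolding \<T>_def w_def by auto
    moreover have "A t \<inter> S = {}" using A[OF t] H(3) by blast
    ultimately have "recurrent (Q (w, n))" using Srec[rule_format, of "Q (w, n)" "A t"] by simp
    moreover have "block X \<epsilon> P (v t) (2 * \<eta>) B \<and> measure m B \<le> n \<and> 1 \<le> n * measure m B"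
      if B: "Q (w, n) B" for B
    proof -
      have "\<bar>mass_in E B - v t E * measure m B\<bar> \<le> 2 * \<eta> * measure m B" if E: "E \<in> P" for E
      proof -
        have "\<bar>mass_in E B - \<eta> * real (w E) * measure m B\<bar> \<le> \<eta> * measure m B"
          using B E unfolding Q_def block_def by simp
        moreover have "\<bar>v t E - \<eta> * real (w E)\<bar> * measure m B \<le> \<eta> * measure m B"
          by (intro mult_right_mono w E) simp
        then have "\<bar>v t E * measure m B - \<eta> * real (w E) * measure m B\<bar> \<le> \<eta> * measure m B"
          unfolding left_diff_distrib[symmetric] by (simp add: abs_mult)
        ultimately show ?thesis by linarith
      qed
      then show ?thesis using B unfolding Q_def block_def by simp
    qed
    ultimately show ?thesis by (intro exI[of _ n]) (rule recurrent_mono)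
  qed
  then obtain n :: "real \<Rightarrow> nat" where
    "\<And>t. t \<in> T \<Longrightarrow> recurrent (\<lambda>B. block X \<epsilon> P (v t) (2 * \<eta>) B \<and> measure m B \<le> n t \<and> 1 \<le> n t * measure m B)"
    by metis
  then show ?thesis using T v approx unfolding v_def[symmetric]
    by (intro exI[of _ T] exI[of _ c] exI[of _ v] exI[of _ n]) blast
qed

text \<open>
  For large \<open>R\<close> the overshoot \<open>N\<close> of the blocks is negligible compared with the measure of the set.
\<close>

lemma ex_single_set:
  assumes lc: "locally_compact_space (euclidean :: 'a topology)"
    and nsc: "\<not> sigma_compact (UNIV :: 'a set)" and \<mu>: "\<mu> \<in> LIMeans m"
    and X: "finite X" and P: "finite P" "\<And>E. E \<in> P \<Longrightarrow> locally_measurable_set m E"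
    and \<epsilon>: "0 < \<epsilon>"
  shows "\<exists>A. quasi_invariant X (\<epsilon> / 2) A \<and> 0 < measure m A \<and>
    (\<forall>E\<in>P. \<bar>\<mu> (indicator E) - mass_in E A / measure m A\<bar> < \<epsilon>)"
proof -
  \<comment> \<open>Rounding costs \<open>2 * \<eta>\<close>, the overshoot \<open>\<eta>\<close> and the convex approximation \<open>\<eta>\<close>.\<close>
  define \<eta> where "\<eta> = \<epsilon> / 8"
  have \<eta>: "0 < \<eta>" unfolding \<eta>_def using \<epsilon> by simp
  obtain T :: "real set" and c v and n :: "real \<Rightarrow> nat" where
    T: "finite T" "\<forall>t\<in>T. 0 \<le> c t" "(\<Sum>t\<in>T. c t) = 1"
    and v: "\<forall>t\<in>T. \<forall>E\<in>P. 0 \<le> v t E \<and> v t E \<le> 1"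
    and rec: "\<forall>t\<in>T. recurrent (\<lambda>A. block X (\<epsilon> / 2) P (v t) (2 * \<eta>) A \<and>
      measure m A \<le> n t \<and> 1 \<le> n t * measure m A)"
    and approx: "\<forall>E\<in>P. \<bar>(\<Sum>t\<in>T. c t * v t E) - \<mu> (indicator E)\<bar> < \<eta>"
    using ex_recurrent_blocks[OF lc nsc \<mu> X P half_gt_zero[OF \<epsilon>] \<eta>]
    by - (drule meta_mp, assumption, elim exE conjE, rule that)
  note c0 = bspec[OF T(2)] and v = v[rule_format] and rec = bspec[OF rec] and approx = bspec[OF approx]
  define N where "N = (\<Sum>t\<in>T. real (n t))"
  have N: "0 \<le> N" unfolding N_def by (rule sum_nonneg) simp
  define R where "R = 2 * N / \<eta> + 1"
  have R: "0 < R" "2 * N \<le> \<eta> * R" unfolding R_def using N \<eta> by (auto simp: field_simps add_pos_nonneg)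
  have "\<exists>B. quasi_invariant X (\<epsilon> / 2) B \<and>
    R * (\<Sum>t\<in>T. c t) \<le> measure m B \<and> measure m B \<le> R * (\<Sum>t\<in>T. c t) + (\<Sum>t\<in>T. real (n t)) \<and>
    (\<forall>E\<in>P. \<bar>mass_in E B - R * (\<Sum>t\<in>T. c t * v t E)\<bar> \<le> 2 * \<eta> * measure m B + (\<Sum>t\<in>T. real (n t)))"
    by (rule combine_blocks[OF P(2) less_imp_le[OF R(1)] T(1) c0 v rec])
  then obtain B where B: "quasi_invariant X (\<epsilon> / 2) B" "R \<le> measure m B" "measure m B \<le> R + N"
    "\<And>E. E \<in> P \<Longrightarrow> \<bar>mass_in E B - R * (\<Sum>t\<in>T. c t * v t E)\<bar> \<le> 2 * \<eta> * measure m B + N"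
    unfolding T(3) N_def[symmetric] by auto
  have pos: "0 < measure m B" using B(2) R(1) by linarith
  have "\<bar>\<mu> (indicator E) - mass_in E B / measure m B\<bar> < \<epsilon>" if E: "E \<in> P" for E
  proof -
    define w where "w = (\<Sum>t\<in>T. c t * v t E)"
    have w0: "0 \<le> w" unfolding w_def using c0 v E by (intro sum_nonneg mult_nonneg_nonneg) auto
    have "w \<le> (\<Sum>t\<in>T. c t * 1)" unfolding w_def using c0 v E by (intro sum_mono mult_left_mono) auto
    then have w1: "w \<le> 1" using T(3) by simp
    have "\<bar>R * w - measure m B * w\<bar> = \<bar>R - measure m B\<bar> * w"
      using w0 by (simp add: left_diff_distrib[symmetric] abs_mult)
    also have "\<dots> \<le> N * 1" using B(2,3) w0 w1 by (intro mult_mono) auto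
    finally have "\<bar>mass_in E B - measure m B * w\<bar> \<le> 2 * \<eta> * measure m B + 2 * N"
      using B(4)[OF E] unfolding w_def[symmetric] by linarith
    also have "2 * N \<le> \<eta> * measure m B" using R(2) mult_left_mono[OF B(2), of \<eta>] \<eta> by linarith
    finally have "\<bar>mass_in E B - measure m B * w\<bar> \<le> 3 * \<eta> * measure m B" by linarith
    moreover have "mass_in E B - measure m B * w = (mass_in E B / measure m B - w) * measure m B"
      using pos by (simp add: left_diff_distrib)
    ultimately have "\<bar>mass_in E B / measure m B - w\<bar> * measure m B \<le> 3 * \<eta> * measure m B"
      using pos by (simp add: abs_mult)
    then have "\<bar>mass_in E B / measure m B - w\<bar> \<le> 3 * \<eta>" using pos by simp
    then show ?thesis using approx[OF E] \<epsilon> unfolding w_def[symmetric] \<eta>_def by linarith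
  qed
  then show ?thesis using B(1) pos by blast
qed

end

theorem mainTheorem13:
  fixes m :: "'a::{topological_group_add, t2_space} measure"
  assumes "locally_compact_space (euclidean :: 'a topology)"
    and "left_haar_measure m"
    and "natLeq <o (\<kappa> :: 'a set rel)"
  shows "LIMeans\<^sub>0 m = LIMeans m"
proof
  show "LIMeans\<^sub>0 m \<subseteq> LIMeans m" unfolding LIMeans\<^sub>0_def by blast
  interpret haar m using assms(2) by unfold_locales
  note nsc = not_sigma_compact_UNIV[OF assms(3)]
  show "LIMeans m \<subseteq> LIMeans\<^sub>0 m"
  proof
    fix \<mu> assume \<mu>: "\<mu> \<in> LIMeans m"
    have "\<exists>A\<in>folner_sets m K \<epsilon>. set_mean m A \<in> mean_nhd m \<mu> P \<epsilon>"
      if H: "finite P" "measurable_partition m P" "finite K" "0 < \<epsilon>" for P K \<epsilon>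
    proof -
      have P: "locally_measurable_set m E" if "E \<in> P" for E
        using H(2) that unfolding measurable_partition_def by blast
      obtain A where A: "quasi_invariant K (\<epsilon> / 2) A" "0 < measure m A"
        "\<And>E. E \<in> P \<Longrightarrow> \<bar>\<mu> (indicator E) - mass_in E A / measure m A\<bar> < \<epsilon>"
        using ex_single_set[OF assms(1) nsc \<mu> H(3,1) P H(4)] by blast
      have cA: "compact A" using A(1) unfolding quasi_invariant_def by blast
      have pos: "0 < emeasure m A"
        using A(2) fin_borel_emeasure[OF fin_borel_compact[OF cA]] by simp
      have "measure m (sym_diff ((+) x ` A) A) / measure m A < \<epsilon>" if "x \<in> K" for x
      proof -
        have "measure m (sym_diff ((+) x ` A) A) \<le> \<epsilon> / 2 * measure m A"
          using A(1) that unfolding quasi_invariant_def shift_defect_def by blast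
        also have "\<dots> < \<epsilon> * measure m A" using A(2) H(4) by simp
        finally show ?thesis using A(2) by (simp add: divide_less_eq)
      qed
      then have "A \<in> folner_sets m K \<epsilon>" unfolding folner_sets_def using cA pos by blast
      moreover have "set_mean m A \<in> mean_nhd m \<mu> P \<epsilon>"
        unfolding mean_nhd_def
        using set_mean_in_means[OF cA pos] A(3) set_mean_indicator[OF P cA] unfolding mass_in_def by simp
      ultimately show ?thesis by blast
    qed
    then show "\<mu> \<in> LIMeans\<^sub>0 m" unfolding LIMeans\<^sub>0_def using \<mu> by blast
  qed
qed

end
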